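(* Let $1<p\le 2$, $1/p+1/q=1$, let $v\in L^p([0,\pi])$ be a complex-valued potential, and let $bc\in\{Per^+,Per^-,Dir\}$. Then there exist $N_*=N_*(\|v\|_p)$ and a constant $C>0$ independent of $N$ such that $$\|S_N-S_N^0 : L^1\to \mathcal{C}\|\le C\,N^{-1/q}\qquad\text{for all } N\ge N_* .$$
   Context: $L^a=L^a([0,\pi])$ with normalized Lebesgue measure: $\|f\|_a=\left(\frac1\pi\int_0^\pi|f(x)|^a\,dx\right)^{1/a}$; $\mathcal{C}=C([0,\pi])$ with the sup norm. For complex-valued $v\in L^1([0,\pi])$ and $bc\in\{Per^+,Per^-,Dir\}$, $L=L_{bc}(v)$ is the closed operator in $L^2([0,\pi])$ given by $Ly=-y''+v\,y$ on the domain of all $y$ such that $y,y'$ are absolutely continuous on $[0,\pi]$, $-y''+vy\in L^2([0,\pi])$, and the boundary conditions hold: $Per^{\pm}$: $y(\pi)=\pm y(0)$, $y'(\pi)=\pm y'(0)$; $Dir$: $y(0)=y(\pi)=0$. $L^0=L_{bc}(0)$ is the free operator. Their spectra are discrete. Let $R_\lambda=(\lambda-L)^{-1}$, $R^0_\lambda=(\lambda-L^0)^{-1}$. For $\omega,h>0$ let $\Pi_N=\{x+iy:\ -\omega\le x\le N^2+N,\ |y|\le h\}$ and $$S_N=\frac1{2\pi i}\int_{\partial\Pi_N}R_\lambda\,d\lambda,\qquad S_N^0=\frac1{2\pi i}\int_{\partial\Pi_N}R^0_\lambda\,d\lambda,$$ where $\omega,h$ are taken large enough that the interior of $\Pi_N$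 contains all eigenvalues of $L$ and $L^0$ with real part at most $N^2+N$, and $N$ is large enough that no eigenvalue lies on the line $\mathrm{Re}\,\lambda=N^2+N$ ($S_N$, $S_N^0$ do not depend on the choice of such $\omega,h$). Operators defined on $L^2$ are regarded as operators from $L^a$, $a<2$, by extension by continuity from the dense subspace $L^2$. *)

theory Defs
  imports "HOL-Analysis.Analysis" "HOL-Library.Numeral_Type" "HOL-Library.Phantom_Type"
begin

section \<open>Lebesgue spaces on \<open>[0,\<pi>]\<close>\<close>

definition Lp_fun :: "real \<Rightarrow> (real \<Rightarrow> complex) set" where
  "Lp_fun a = {f \<in> borel_measurable (lebesgue_on {0..pi}).
                 integrable (lebesgue_on {0..pi}) (\<lambda>x. norm (f x) powr a)}"

definition Lp_norm :: "real \<Rightarrow> (real \<Rightarrow> complex) \<Rightarrow> real" where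
  "Lp_norm a f = (1 / pi * (\<integral>x. norm (f x) powr a \<partial>lebesgue_on {0..pi})) powr (1 / a)"

lemma Lp_fun_meas [measurable_dest]: "f \<in> Lp_fun a \<Longrightarrow> f \<in> borel_measurable (lebesgue_on {0..pi})"
  by (simp add: Lp_fun_def)

lemma Lp_fun_int: "f \<in> Lp_fun a \<Longrightarrow> integrable (lebesgue_on {0..pi}) (\<lambda>x. norm (f x) powr a)"
  by (simp add: Lp_fun_def)

lemma Lp_fun_zero: "(\<lambda>_. 0) \<in> Lp_fun a"
  by (simp add: Lp_fun_def)

lemma powr_convex_nonneg:
  fixes x y s t a :: real
  assumes a: "1 \<le> a" and "0 \<le> x" "0 \<le> y" "0 \<le> s" "0 \<le> t" "s + t = 1"
  shows "(s * x + t * y) powr a \<le> s * x powr a + t * y powr a"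
proof -
  have *: "s powr a \<le> s" if "0 \<le> s" "s \<le> 1" for s :: real
  proof (cases "s = 0")
    case False
    have "s powr a \<le> s powr 1"
      using that a False by (intro powr_mono') auto
    then show ?thesis using that False by simp
  qed simp
  show ?thesis
  proof (cases "x = 0 \<or> y = 0")
    case True
    then show ?thesis
      using assms *[of s] *[of t] by (auto simp: powr_mult intro!: mult_right_mono)
  next
    case False
    have "convex_on {0<..} (\<lambda>x::real. x powr a)"
      using powr_convex a by blast
    moreover have "s = 1 - t" using assms by simp
    ultimately show ?thesis
      using convex_onD[of "{0<..}" "\<lambda>x::real. x powr a" t x y] False assms(1-5) by simp
  qed
qed

lemma Lp_fun_scale:
  assumes "f \<in> Lp_fun a"
  shows "(\<lambda>x. c * f x) \<in> Lp_fun a"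
  using assms by (auto simp: Lp_fun_def norm_mult powr_mult)

lemma Lp_fun_add:
  assumes a: "1 \<le> a" and f: "f \<in> Lp_fun a" and g: "g \<in> Lp_fun a"
  shows "(\<lambda>x. f x + g x) \<in> Lp_fun a"
proof -
  note [measurable] = Lp_fun_meas[OF f] Lp_fun_meas[OF g]
  let ?h = "\<lambda>x. 2 powr a * (1/2 * norm (f x) powr a + 1/2 * norm (g x) powr a)"
  have "integrable (lebesgue_on {0..pi}) ?h"
    using Lp_fun_int[OF f] Lp_fun_int[OF g] by auto
  moreover have "norm (f x + g x) powr a \<le> ?h x" for x
  proof -
    have "norm (f x + g x) powr a \<le> (2 * (1/2 * norm (f x) + 1/2 * norm (g x))) powr a"
      using a norm_triangle_ineq[of "f x" "g x"] by (intro powr_mono2) auto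
    also have "\<dots> = 2 powr a * (1/2 * norm (f x) + 1/2 * norm (g x)) powr a"
      by (rule powr_mult) 
    also have "\<dots> \<le> ?h x"
      using powr_convex_nonneg[OF a, of "norm (f x)" "norm (g x)" "1/2" "1/2"]
      by (intro mult_left_mono) auto
    finally show ?thesis .
  qed
  ultimately have "integrable (lebesgue_on {0..pi}) (\<lambda>x. norm (f x + g x) powr a)"
    by (elim Bochner_Integration.integrable_bound) (auto intro!: AE_I2 intro: order_trans)
  then show ?thesis by (simp add: Lp_fun_def)
qed

lemma Lp_fun_diff:
  assumes "1 \<le> a" "f \<in> Lp_fun a" "g \<in> Lp_fun a"
  shows "(\<lambda>x. f x - g x) \<in> Lp_fun a"
  using Lp_fun_add[OF assms(1,2) Lp_fun_scale[OF assms(3), of "-1"]] by simp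

lemma Lp_fun_bounded:
  assumes "f \<in> borel_measurable (lebesgue_on {0..pi})" "\<And>x. norm (f x) \<le> B" "0 \<le> a"
  shows "f \<in> Lp_fun a"
proof -
  have [measurable]: "f \<in> borel_measurable (lebesgue_on {0..pi})" by fact
  have "finite_measure (lebesgue_on {0..pi})"
    by (auto intro!: finite_measureI simp: emeasure_restrict_space space_restrict_space)
  then have "integrable (lebesgue_on {0..pi}) (\<lambda>x. norm (f x) powr a)"
    by (rule finite_measure.integrable_const_bound[where B = "B powr a"])
       (use assms in \<open>auto intro!: AE_I2 powr_mono2\<close>)
  then show ?thesis using assms by (simp add: Lp_fun_def)
qed

lemma Lp_fun_mono:
  assumes f: "f \<in> Lp_fun b" and "0 \<le> a" "a \<le> b"
  shows "f \<in> Lp_fun a"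
proof -
  note [measurable] = Lp_fun_meas[OF f]
  have one: "integrable (lebesgue_on {0..pi}) (\<lambda>x. 1::real)"
    by (simp add: emeasure_restrict_space)
  have "integrable (lebesgue_on {0..pi}) (\<lambda>x. 1 + norm (f x) powr b)"
    using one Lp_fun_int[OF f] by auto
  moreover have "norm (f x) powr a \<le> 1 + norm (f x) powr b" for x
  proof (cases "norm (f x) \<le> 1")
    case True
    then have "norm (f x) powr a \<le> 1 powr a" using assms by (intro powr_mono2) auto
    then show ?thesis by (simp add: add_increasing2)
  next
    case False
    then have "norm (f x) powr a \<le> norm (f x) powr b" using assms by (intro powr_mono) auto
    then show ?thesis by simp
  qed
  ultimately have "integrable (lebesgue_on {0..pi}) (\<lambda>x. norm (f x) powr a)"
    by (elim Bochner_Integration.integrable_bound) (auto intro!: AE_I2 simp: add_nonneg_nonneg intro: order_trans)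
  then show ?thesis by (simp add: Lp_fun_def)
qed

lemma Lp_norm_nonneg: "0 \<le> Lp_norm a f"
  by (simp add: Lp_norm_def)

lemma Lp_norm_powr:
  assumes "1 \<le> a"
  shows "Lp_norm a f powr a = 1 / pi * (\<integral>x. norm (f x) powr a \<partial>lebesgue_on {0..pi})"
  using assms by (simp add: Lp_norm_def powr_powr)

lemma Lp_norm_cong_AE:
  assumes "f \<in> borel_measurable (lebesgue_on {0..pi})" "g \<in> borel_measurable (lebesgue_on {0..pi})"
    and "AE x in lebesgue_on {0..pi}. f x = g x"
  shows "Lp_norm a f = Lp_norm a g"
proof -
  note [measurable] = assms(1,2)
  have "(\<integral>x. norm (f x) powr a \<partial>lebesgue_on {0..pi}) = (\<integral>x. norm (g x) powr a \<partial>lebesgue_on {0..pi})"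
    using assms(3) by (intro integral_cong_AE) auto
  then show ?thesis by (simp add: Lp_norm_def)
qed

lemma Lp_norm_scale:
  assumes "1 \<le> a"
  shows "Lp_norm a (\<lambda>x. c * f x) = norm c * Lp_norm a f"
proof -
  have "Lp_norm a (\<lambda>x. c * f x)
      = (norm c powr a * (1 / pi * (\<integral>x. norm (f x) powr a \<partial>lebesgue_on {0..pi}))) powr (1 / a)"
    by (simp add: Lp_norm_def norm_mult powr_mult)
  also have "\<dots> = norm c * Lp_norm a f"
    unfolding Lp_norm_def powr_mult using assms by (simp add: powr_powr)
  finally show ?thesis .
qed

lemma Lp_norm_eq_0_iff:
  assumes a: "1 \<le> a" and f: "f \<in> Lp_fun a"
  shows "Lp_norm a f = 0 \<longleftrightarrow> (AE x in lebesgue_on {0..pi}. f x = 0)"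
proof -
  have "Lp_norm a f = 0 \<longleftrightarrow> (\<integral>x. norm (f x) powr a \<partial>lebesgue_on {0..pi}) = 0"
    by (simp add: Lp_norm_def)
  also have "\<dots> \<longleftrightarrow> (AE x in lebesgue_on {0..pi}. norm (f x) powr a = 0)"
    by (rule integral_nonneg_eq_0_iff_AE[OF Lp_fun_int[OF f]]) auto
  finally show ?thesis by simp
qed

lemma Lp_norm_triangle:
  assumes a: "1 \<le> a" and f: "f \<in> Lp_fun a" and g: "g \<in> Lp_fun a"
  shows "Lp_norm a (\<lambda>x. f x + g x) \<le> Lp_norm a f + Lp_norm a g"
proof -
  let ?M = "lebesgue_on {0..pi}"
  note [measurable] = Lp_fun_meas[OF f] Lp_fun_meas[OF g]
  have *: "Lp_norm a (\<lambda>x. f x + g x) \<le> A + B" if AB: "Lp_norm a f < A" "Lp_norm a g < B" for A B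
  proof -
    have pos: "0 < A" "0 < B" using AB Lp_norm_nonneg[of a f] Lp_norm_nonneg[of a g] by linarith+
    define s where "s = A / (A + B)"
    define t where "t = B / (A + B)"
    have st: "0 \<le> s" "0 \<le> t" "s + t = 1"
      using pos by (auto simp: s_def t_def add_divide_distrib[symmetric])
    let ?h = "\<lambda>x. (A + B) powr a * (s * (norm (f x) powr a / A powr a) + t * (norm (g x) powr a / B powr a))"
    have pt: "norm (f x + g x) powr a \<le> ?h x" for x
    proof -
      have eq: "norm (f x) + norm (g x) = (A + B) * (s * (norm (f x) / A) + t * (norm (g x) / B))"
      proof -
        have "(A + B) * (s * (norm (f x) / A)) = norm (f x)" "(A + B) * (t * (norm (g x) / B)) = norm (g x)"
          using pos by (simp_all add: s_def t_def)
        then show ?thesis by (simp add: distrib_left)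
      qed
      have "norm (f x + g x) powr a \<le> (norm (f x) + norm (g x)) powr a"
        using a norm_triangle_ineq by (intro powr_mono2) auto
      also have "\<dots> = (A + B) powr a * (s * (norm (f x) / A) + t * (norm (g x) / B)) powr a"
        unfolding eq by (rule powr_mult)
      also have "\<dots> \<le> (A + B) powr a * (s * (norm (f x) / A) powr a + t * (norm (g x) / B) powr a)"
        using pos st by (intro mult_left_mono powr_convex_nonneg[OF a]) auto
      also have "\<dots> = ?h x" using pos by (simp add: powr_divide)
      finally show ?thesis .
    qed
    have fA: "1 / pi * (\<integral>x. norm (f x) powr a \<partial>?M) \<le> A powr a"
      unfolding Lp_norm_powr[OF a, symmetric]
      using AB a by (intro powr_mono2) (auto simp: Lp_norm_nonneg)
    have gB: "1 / pi * (\<integral>x. norm (g x) powr a \<partial>?M) \<le> B powr a"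
      unfolding Lp_norm_powr[OF a, symmetric]
      using AB a by (intro powr_mono2) (auto simp: Lp_norm_nonneg)
    have "(\<integral>x. norm (f x + g x) powr a \<partial>?M) \<le> (\<integral>x. ?h x \<partial>?M)"
      using Lp_fun_int[OF f] Lp_fun_int[OF g] Lp_fun_int[OF Lp_fun_add[OF a f g]] pt
      by (intro integral_mono) auto
    also have "\<dots> = (A + B) powr a * (s * ((\<integral>x. norm (f x) powr a \<partial>?M) / A powr a)
                      + t * ((\<integral>x. norm (g x) powr a \<partial>?M) / B powr a))"
      using Lp_fun_int[OF f] Lp_fun_int[OF g] by simp
    also have "\<dots> \<le> (A + B) powr a * (s * pi + t * pi)"
      using fA gB pos st
      by (intro mult_left_mono add_mono) (auto simp: field_simps)
    also have "\<dots> = (A + B) powr a * pi"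
      using st by (simp add: distrib_right[symmetric])
    finally have "1 / pi * (\<integral>x. norm (f x + g x) powr a \<partial>?M) \<le> (A + B) powr a"
      by (simp add: field_simps)
    then have "Lp_norm a (\<lambda>x. f x + g x) \<le> ((A + B) powr a) powr (1 / a)"
      unfolding Lp_norm_def using a by (intro powr_mono2) auto
    then show ?thesis using a pos by (simp add: powr_powr)
  qed
  show ?thesis
  proof (rule field_le_epsilon)
    fix e :: real assume "0 < e"
    then show "Lp_norm a (\<lambda>x. f x + g x) \<le> Lp_norm a f + Lp_norm a g + e"
      using *[of "Lp_norm a f + e/2" "Lp_norm a g + e/2"] by simp
  qed
qed

text \<open>
  \<open>L\<^sup>a\<close> as a normed space of classes modulo equality almost everywhere.  Since types cannot depend
  on numbers, the exponent of the type \<open>'n Lp\<close> is the cardinality of the index type \<open>'n\<close>; so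
  \<open>1 Lp\<close> and \<open>2 Lp\<close> are \<open>L\<^sup>1([0,\<pi>])\<close> and \<open>L\<^sup>2([0,\<pi>])\<close>.
\<close>

definition Lp_exp :: "'n::finite itself \<Rightarrow> real" where
  "Lp_exp _ = real CARD('n)"

lemma Lp_exp_ge_1 [simp]: "1 \<le> Lp_exp TYPE('n::finite)"
  by (simp add: Lp_exp_def Suc_le_eq)

text \<open>The relation depends on \<open>'n\<close>, so \<open>'n\<close> has to occur in the raw type: hence the phantom wrapper.\<close>

type_synonym 'n Lp_raw = "('n, real \<Rightarrow> complex) phantom"

definition Lp_rel :: "'n::finite Lp_raw \<Rightarrow> 'n Lp_raw \<Rightarrow> bool" where
  "Lp_rel f g \<longleftrightarrow> of_phantom f \<in> Lp_fun (Lp_exp TYPE('n)) \<and> of_phantom g \<in> Lp_fun (Lp_exp TYPE('n)) \<and>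
     (AE x in lebesgue_on {0..pi}. of_phantom f x = of_phantom g x)"

lemma part_equivp_Lp_rel: "part_equivp (Lp_rel :: 'n::finite Lp_raw \<Rightarrow> _)"
proof (rule part_equivpI)
  show "\<exists>f :: 'n Lp_raw. Lp_rel f f"
    by (rule exI[of _ "phantom (\<lambda>_. 0)"]) (simp add: Lp_rel_def Lp_fun_zero)
  show "symp (Lp_rel :: 'n Lp_raw \<Rightarrow> _)"
    by (auto simp: symp_def Lp_rel_def elim: eventually_mono)
  show "transp (Lp_rel :: 'n Lp_raw \<Rightarrow> _)"
    by (auto simp: transp_def Lp_rel_def elim: eventually_elim2)
qed

quotient_type 'n Lp = "'n::finite Lp_raw" / partial: Lp_rel
  by (rule part_equivp_Lp_rel)

text \<open>The class of \<open>f\<close>; meaningful only if \<open>f\<close> is in \<open>Lp_fun\<close> for the exponent in question.\<close>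

definition Lp_class :: "(real \<Rightarrow> complex) \<Rightarrow> 'n::finite Lp" where
  "Lp_class f = abs_Lp (phantom f)"

type_synonym L1 = "1 Lp"
type_synonym L2 = "2 Lp"

instantiation Lp :: (finite) real_normed_vector
begin

lift_definition zero_Lp :: "'a Lp" is "phantom (\<lambda>_. 0)"
  by (simp add: Lp_rel_def Lp_fun_zero)

lift_definition plus_Lp :: "'a Lp \<Rightarrow> 'a Lp \<Rightarrow> 'a Lp" is "\<lambda>f g. phantom (\<lambda>x. of_phantom f x + of_phantom g x)"
  by (auto simp: Lp_rel_def intro!: Lp_fun_add elim: eventually_elim2)

lift_definition minus_Lp :: "'a Lp \<Rightarrow> 'a Lp \<Rightarrow> 'a Lp" is "\<lambda>f g. phantom (\<lambda>x. of_phantom f x - of_phantom g x)"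
  by (auto simp: Lp_rel_def intro!: Lp_fun_diff elim: eventually_elim2)

lift_definition uminus_Lp :: "'a Lp \<Rightarrow> 'a Lp" is "\<lambda>f. phantom (\<lambda>x. - of_phantom f x)"
  using Lp_fun_scale[of _ _ "-1"] by (auto simp: Lp_rel_def elim: eventually_mono)

lift_definition scaleR_Lp :: "real \<Rightarrow> 'a Lp \<Rightarrow> 'a Lp" is "\<lambda>r f. phantom (\<lambda>x. r *\<^sub>R of_phantom f x)"
  by (auto simp: Lp_rel_def scaleR_conv_of_real intro!: Lp_fun_scale elim: eventually_mono)

lift_definition norm_Lp :: "'a Lp \<Rightarrow> real" is "\<lambda>f. Lp_norm (Lp_exp TYPE('a)) (of_phantom f)"
  by (auto simp: Lp_rel_def intro!: Lp_norm_cong_AE Lp_fun_meas)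

definition dist_Lp :: "'a Lp \<Rightarrow> 'a Lp \<Rightarrow> real" where "dist_Lp f g = norm (f - g)"

definition sgn_Lp :: "'a Lp \<Rightarrow> 'a Lp" where "sgn_Lp f = scaleR (inverse (norm f)) f"

definition uniformity_Lp :: "('a Lp \<times> 'a Lp) filter" where
  "uniformity_Lp = (INF e\<in>{0<..}. principal {(f, g). dist f g < e})"

definition open_Lp :: "'a Lp set \<Rightarrow> bool" where
  "open_Lp U = (\<forall>f\<in>U. eventually (\<lambda>(f', g). f' = f \<longrightarrow> g \<in> U) uniformity)"

instance
proof
  fix f g h :: "'a Lp" and r s :: real
  show "f + g + h = f + (g + h)"
    by transfer (auto simp: Lp_rel_def add.assoc intro!: Lp_fun_add)
  show "f + g = g + f"
    by transfer (auto simp: Lp_rel_def add.commute intro!: Lp_fun_add)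
  show "0 + f = f"
    by transfer (auto simp: Lp_rel_def)
  show "- f + f = 0"
    by transfer (auto simp: Lp_rel_def Lp_fun_zero)
  show "f - g = f + - g"
    by transfer (auto simp: Lp_rel_def intro!: Lp_fun_diff)
  show "r *\<^sub>R (f + g) = r *\<^sub>R f + r *\<^sub>R g"
    by transfer (auto simp: Lp_rel_def scaleR_conv_of_real distrib_left
        intro!: Lp_fun_add Lp_fun_scale)
  show "(r + s) *\<^sub>R f = r *\<^sub>R f + s *\<^sub>R f"
    by transfer (auto simp: Lp_rel_def scaleR_conv_of_real distrib_right
        intro!: Lp_fun_add Lp_fun_scale)
  show "r *\<^sub>R s *\<^sub>R f = (r * s) *\<^sub>R f"
    by transfer (auto simp: Lp_rel_def scaleR_conv_of_real intro: Lp_fun_scale)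
  show "1 *\<^sub>R f = f"
    by transfer (auto simp: Lp_rel_def)
  show "dist f g = norm (f - g)" by (rule dist_Lp_def)
  show "sgn f = scaleR (inverse (norm f)) f" by (rule sgn_Lp_def)
  show "uniformity = (INF e\<in>{0<..}. principal {(f :: 'a Lp, g). dist f g < e})"
    by (rule uniformity_Lp_def)
  show "open U = (\<forall>f\<in>U. eventually (\<lambda>(f', g). f' = f \<longrightarrow> g \<in> U) uniformity)" for U :: "'a Lp set"
    by (rule open_Lp_def)
  show "norm f = 0 \<longleftrightarrow> f = 0"
    by transfer (auto simp: Lp_rel_def Lp_norm_eq_0_iff Lp_fun_zero)
  show "norm (f + g) \<le> norm f + norm g"
    by transfer (auto simp: Lp_rel_def intro!: Lp_norm_triangle)
  show "norm (r *\<^sub>R f) = \<bar>r\<bar> * norm f"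
    by transfer (simp add: scaleR_conv_of_real Lp_norm_scale)
qed

end

lift_definition scaleC_Lp :: "complex \<Rightarrow> 'n::finite Lp \<Rightarrow> 'n Lp" is "\<lambda>c f. phantom (\<lambda>x. c * of_phantom f x)"
  by (auto simp: Lp_rel_def intro!: Lp_fun_scale elim: eventually_mono)

lemma norm_scaleC_Lp: "norm (scaleC_Lp c f) = norm c * norm f"
  by transfer (simp add: Lp_norm_scale)

text \<open>Multiplication by a complex scalar as an operator; \<open>scalarop c o\<^sub>L T\<close> is \<open>c T\<close>
  (operators \<open>\<Rightarrow>\<^sub>L\<close> form a real vector space only).\<close>

lift_definition scalarop :: "complex \<Rightarrow> 'n::finite Lp \<Rightarrow>\<^sub>L 'n Lp" is scaleC_Lp
proof (rule bounded_linear_intro)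
  fix c and f g :: "'n Lp" and r
  show "scaleC_Lp c (f + g) = scaleC_Lp c f + scaleC_Lp c g"
    by transfer (auto simp: Lp_rel_def distrib_left intro!: Lp_fun_add Lp_fun_scale)
  show "scaleC_Lp c (r *\<^sub>R f) = r *\<^sub>R scaleC_Lp c f"
    by transfer (auto simp: Lp_rel_def scaleR_conv_of_real mult.left_commute intro!: Lp_fun_scale)
  show "norm (scaleC_Lp c f) \<le> norm f * norm c"
    by (simp add: norm_scaleC_Lp)
qed

lift_definition L2_to_L1 :: "L2 \<Rightarrow> L1" is "\<lambda>f. phantom (of_phantom f)"
  by (auto simp: Lp_rel_def Lp_exp_def elim: Lp_fun_mono)


section \<open>The space \<open>C([0,\<pi>])\<close>\<close>

typedef intv = "{0..pi}"
  by (rule exI[of _ 0]) simp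

setup_lifting type_definition_intv

instantiation intv :: metric_space
begin

lift_definition dist_intv :: "intv \<Rightarrow> intv \<Rightarrow> real" is dist .

definition uniformity_intv :: "(intv \<times> intv) filter" where
  "uniformity_intv = (INF e\<in>{0<..}. principal {(x, y). dist x y < e})"

definition open_intv :: "intv set \<Rightarrow> bool" where
  "open_intv U = (\<forall>x\<in>U. eventually (\<lambda>(x', y). x' = x \<longrightarrow> y \<in> U) uniformity)"

instance
proof
  fix x y z :: intv
  show "dist x y = 0 \<longleftrightarrow> x = y" by transfer simp
  show "dist x y \<le> dist x z + dist y z" by transfer (rule dist_triangle2)
qed (rule uniformity_intv_def open_intv_def)+

end

text \<open>Continuous functions on the compact interval are automatically bounded, so the library's
  space of bounded continuous functions with the supremum norm is \<open>C([0,\<pi>])\<close>.\<close>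

type_synonym Cspace = "intv \<Rightarrow>\<^sub>C complex"

text \<open>The class in \<open>L\<^sup>2\<close> of a continuous function (its values off \<open>[0,\<pi>]\<close> are irrelevant).\<close>

definition C_to_L2 :: "Cspace \<Rightarrow> L2" where
  "C_to_L2 g = Lp_class (\<lambda>x. if x \<in> {0..pi} then apply_bcontfun g (Abs_intv x) else 0)"

lemma C_to_L2_in_Lp:
  fixes g :: Cspace
  shows "(\<lambda>x. if x \<in> {0..pi} then apply_bcontfun g (Abs_intv x) else 0) \<in> Lp_fun 2"
proof (rule Lp_fun_bounded)
  have "continuous_on {0..pi} Abs_intv"
    unfolding continuous_on_iff by (auto simp: dist_intv.rep_eq Abs_intv_inverse)
  then have "continuous_on {0..pi} (\<lambda>x. apply_bcontfun g (Abs_intv x))"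
    by (rule continuous_on_compose2[OF continuous_on_apply_bcontfun]) auto
  then have "(\<lambda>x. apply_bcontfun g (Abs_intv x)) \<in> borel_measurable (lebesgue_on {0..pi})"
    by (intro continuous_imp_measurable_on_sets_lebesgue) auto
  then show "(\<lambda>x. if x \<in> {0..pi} then apply_bcontfun g (Abs_intv x) else 0)
      \<in> borel_measurable (lebesgue_on {0..pi})"
    by (subst measurable_cong[where g = "\<lambda>x. apply_bcontfun g (Abs_intv x)"])
       (auto simp: space_restrict_space)
  show "norm (if x \<in> {0..pi} then apply_bcontfun g (Abs_intv x) else 0) \<le> norm g" for x
    by (simp add: norm_bounded)
qed simp

text \<open>\<open>T\<close> is the extension by continuity to \<open>L\<^sup>1\<close> (unique, as \<open>L\<^sup>2\<close> is dense) of \<open>S\<close>, regarded as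
  an operator with values in \<open>C([0,\<pi>])\<close>.\<close>

definition extends_to_L1_C :: "(L1 \<Rightarrow>\<^sub>L Cspace) \<Rightarrow> (L2 \<Rightarrow>\<^sub>L L2) \<Rightarrow> bool" where
  "extends_to_L1_C T S \<longleftrightarrow>
     (\<forall>f. C_to_L2 (blinfun_apply T (L2_to_L1 f)) = blinfun_apply S f)"


section \<open>Hill operators\<close>

definition abs_cont_on :: "real \<Rightarrow> real \<Rightarrow> (real \<Rightarrow> complex) \<Rightarrow> bool" where
  "abs_cont_on a b f \<longleftrightarrow>
     (\<forall>\<epsilon>>0. \<exists>\<delta>>0. \<forall>I. finite I \<and> (\<forall>(s, t)\<in>I. a \<le> s \<and> s < t \<and> t \<le> b) \<and>
         disjoint_family_on (\<lambda>(s, t). {s<..<t}) I \<and> (\<Sum>(s, t)\<in>I. t - s) < \<delta>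
       \<longrightarrow> (\<Sum>(s, t)\<in>I. norm (f t - f s)) < \<epsilon>)"

datatype bc = Per_plus | Per_minus | Dir

definition vderiv :: "(real \<Rightarrow> complex) \<Rightarrow> real \<Rightarrow> complex" where
  "vderiv y x = vector_derivative y (at x within {0..pi})"

fun satisfies_bc :: "bc \<Rightarrow> (real \<Rightarrow> complex) \<Rightarrow> bool" where
  "satisfies_bc Per_plus y \<longleftrightarrow> y pi = y 0 \<and> vderiv y pi = vderiv y 0"
| "satisfies_bc Per_minus y \<longleftrightarrow> y pi = - y 0 \<and> vderiv y pi = - vderiv y 0"
| "satisfies_bc Dir y \<longleftrightarrow> y 0 = 0 \<and> y pi = 0"

text \<open>For \<open>y'\<close> absolutely continuous, \<open>vderiv (vderiv y)\<close> is the almost everywhere defined \<open>y''\<close>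
  (arbitrary on the exceptional null set).\<close>

definition hill_expr :: "(real \<Rightarrow> complex) \<Rightarrow> (real \<Rightarrow> complex) \<Rightarrow> real \<Rightarrow> complex" where
  "hill_expr v y x = - vderiv (vderiv y) x + v x * y x"

definition hill_dom :: "bc \<Rightarrow> (real \<Rightarrow> complex) \<Rightarrow> (real \<Rightarrow> complex) set" where
  "hill_dom bc v = {y. (\<forall>x\<in>{0..pi}. y differentiable (at x within {0..pi})) \<and>
     abs_cont_on 0 pi y \<and> abs_cont_on 0 pi (vderiv y) \<and>
     hill_expr v y \<in> Lp_fun 2 \<and> satisfies_bc bc y}"

text \<open>The unbounded operator \<open>L\<^bsub>bc\<^esub>(v)\<close> in \<open>L\<^sup>2\<close>, given by its graph.\<close>

definition hill_op :: "bc \<Rightarrow> (real \<Rightarrow> complex) \<Rightarrow> (L2 \<times> L2) set" where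
  "hill_op bc v = {(Lp_class y, Lp_class (hill_expr v y)) | y. y \<in> hill_dom bc v}"

definition is_eigenvalue :: "(L2 \<times> L2) set \<Rightarrow> complex \<Rightarrow> bool" where
  "is_eigenvalue L z \<longleftrightarrow> (\<exists>u. u \<noteq> 0 \<and> (u, scaleC_Lp z u) \<in> L)"

definition is_resolvent :: "(L2 \<times> L2) set \<Rightarrow> complex \<Rightarrow> (L2 \<Rightarrow>\<^sub>L L2) \<Rightarrow> bool" where
  "is_resolvent L z R \<longleftrightarrow>
     (\<forall>f u. blinfun_apply R f = u \<longleftrightarrow> (\<exists>g. (u, g) \<in> L \<and> scaleC_Lp z u - g = f))"

definition resolvent :: "(L2 \<times> L2) set \<Rightarrow> complex \<Rightarrow> (L2 \<Rightarrow>\<^sub>L L2)" where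
  "resolvent L z = (THE R. is_resolvent L z R)"


section \<open>Spectral projections\<close>

text \<open>Operator-valued analogue of the library's \<open>contour_integral\<close>, converging in operator norm.\<close>

definition op_contour_integral :: "(real \<Rightarrow> complex) \<Rightarrow> (complex \<Rightarrow> (L2 \<Rightarrow>\<^sub>L L2)) \<Rightarrow> (L2 \<Rightarrow>\<^sub>L L2)" where
  "op_contour_integral \<gamma> F =
     integral {0..1} (\<lambda>t. scalarop (vector_derivative \<gamma> (at t within {0..1})) o\<^sub>L F (\<gamma> t))"

definition Pi_rect :: "real \<Rightarrow> real \<Rightarrow> nat \<Rightarrow> complex set" where
  "Pi_rect \<omega> h N = {z. - \<omega> \<le> Re z \<and> Re z \<le> real N ^ 2 + real N \<and> \<bar>Im z\<bar> \<le> h}"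

text \<open>The positively oriented boundary of \<open>Pi_rect \<omega> h N\<close>.\<close>

definition Pi_path :: "real \<Rightarrow> real \<Rightarrow> nat \<Rightarrow> real \<Rightarrow> complex" where
  "Pi_path \<omega> h N = rectpath (Complex (- \<omega>) (- h)) (Complex (real N ^ 2 + real N) h)"

definition spectral_proj :: "(L2 \<times> L2) set \<Rightarrow> real \<Rightarrow> real \<Rightarrow> nat \<Rightarrow> (L2 \<Rightarrow>\<^sub>L L2)" where
  "spectral_proj L \<omega> h N =
     scalarop (1 / (2 * of_real pi * \<i>)) o\<^sub>L op_contour_integral (Pi_path \<omega> h N) (resolvent L)"

text \<open>As the interior is open, this also excludes eigenvalues on the line \<open>Re z = N\<^sup>2 + N\<close>.\<close>

definition admissible :: "bc \<Rightarrow> (real \<Rightarrow> complex) \<Rightarrow> nat \<Rightarrow> real \<Rightarrow> real \<Rightarrow> bool" where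
  "admissible bc v N \<omega> h \<longleftrightarrow> 0 < \<omega> \<and> 0 < h \<and>
     (\<forall>z. (is_eigenvalue (hill_op bc v) z \<or> is_eigenvalue (hill_op bc (\<lambda>_. 0)) z) \<and>
           Re z \<le> real N ^ 2 + real N
        \<longrightarrow> z \<in> interior (Pi_rect \<omega> h N))"

end

theory Submission
  imports Defs "HOL-Complex_Analysis.Cauchy_Integral_Theorem"
begin

text \<open>
  Writing \<open>\<lambda> = \<mu>\<^sup>2\<close> with \<open>\<sigma> = Im \<mu> \<ge> 0\<close>, the solution of the free problem
  \<open>y'' + \<mu>\<^sup>2 y = g\<close> is \<open>2i\<mu> y(x) = \<integral> e\<^bsup>i\<mu>|x-t|\<^esup> g(t) dt + \<alpha> e\<^bsup>i\<mu>x\<^esup> + \<beta> e\<^bsup>i\<mu>(\<pi>-x)\<^esup>\<close>, and the boundary conditions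
  bound \<open>\<alpha>, \<beta>\<close> as soon as \<open>|1 - e\<^bsup>2\<pi>i\<mu>\<^esup>| \<ge> 1/2\<close>; this holds on the line \<open>Re \<lambda> = N\<^sup>2 + N\<close> and for
  \<open>\<sigma> \<ge> 1/2\<close>.  Hence \<open>R\<^sub>\<lambda> : L\<^sup>1 \<rightarrow> C\<close> has norm \<open>O(1/|\<mu>|)\<close> once \<open>|\<mu>|\<close> dominates \<open>\<parallel>v\<parallel>\<^sub>1\<close>.  Since
  \<open>R\<^sub>\<lambda> - R\<^sup>0\<^sub>\<lambda> = R\<^sup>0\<^sub>\<lambda> v R\<^sub>\<lambda>\<close> and, by Young's inequality,
  \<open>\<integral> e\<^bsup>-\<sigma>|x-t|\<^esup> |v(t)| dt = O(\<sigma>\<^bsup>-1/q\<^esup>)\<close>, the difference of the resolvents is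
  \<open>O(\<sigma>\<^bsup>-1/q\<^esup> / |\<lambda>|)\<close>, which is integrable over the whole line \<open>Re \<lambda> = N\<^sup>2 + N\<close> with integral
  \<open>O(N\<^bsup>-1/q\<^esup>)\<close>.  As no eigenvalue lies to the left of this line outside \<open>\<Pi>\<^sub>N\<close>, the other three sides
  of the contour can be pushed so far out that they do not matter.

  The resolvent is realised as an operator from \<open>L\<^sup>1\<close> to \<open>C\<close> (\<open>sol_op\<close>), so that all operator
  integrals are taken in a Banach space.  That every absolutely continuous \<open>y'\<close> is differentiable
  almost everywhere is needed to exclude spurious eigenfunctions, because \<open>vderiv\<close> takes arbitrary
  values where the derivative does not exist.
\<close>

section \<open>Absolutely continuous functions\<close>

text \<open>A source in L^1 gives no decay beyond \<open>1 / |\<mu>|\<close>, so the gain must come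
  from the potential, which stands between two resolvents. Hence the free a priori estimate takes an
  abstract majorant \<open>kernel_bound\<close> of its source: with the L^1 norm it lets the
  potential be absorbed, with the bound from Young's inequality it produces the rate. The critical
  line crosses the real axis, where \<open>Im \<mu>\<close> vanishes. With
  \<open>t = Im \<lambda>\<close> one has \<open>Im \<mu> \<ge> |t| / (2 sqrt |\<lambda>|)\<close>,
  so the singularity there is \<open>|t| powr (- 1 / q)\<close>, integrable since
  \<open>q > 1\<close>; at infinity the total exponent is \<open>- 1 - 1 / (2 * q)\<close>,
  integrable since \<open>1 / q > 0\<close>. Solvability comes from differential equations alone: a
  Volterra equation gives a fundamental system, and the boundary conditions become a 2 by 2 linear
  system. For a fixed source and a fixed point the resolvent is a scalar holomorphic function of
  \<open>\<lambda>\<close>, so contours are moved by Cauchy's theorem for complex functions and the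
  operator norm is recovered as a supremum.\<close>

definition disj_ivls :: "(real \<times> real) set \<Rightarrow> bool" where
  "disj_ivls P \<longleftrightarrow> finite P \<and> (\<forall>(s, t)\<in>P. s < t) \<and> disjoint_family_on (\<lambda>(s, t). {s<..<t}) P"

lemma disj_ivls_subset: "disj_ivls P \<Longrightarrow> Q \<subseteq> P \<Longrightarrow> disj_ivls Q"
  unfolding disj_ivls_def by (auto intro: finite_subset disjoint_family_on_mono)

lemma disj_ivls_separated:
  assumes "disj_ivls P" "(s, t) \<in> P" "(u, v) \<in> P" "(s, t) \<noteq> (u, v)"
  shows "v \<le> s \<or> t \<le> u"
proof (rule ccontr)
  assume *: "\<not> ?thesis"
  have "s < t" "u < v" using assms by (auto simp: disj_ivls_def)
  then have "max s u < min t v" using * by auto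
  then obtain x where "max s u < x" "x < min t v" using dense by blast
  then have "x \<in> {s<..<t} \<inter> {u<..<v}" by auto
  moreover have "{s<..<t} \<inter> {u<..<v} = {}"
    using assms unfolding disj_ivls_def disjoint_family_on_def by fastforce
  ultimately show False by blast
qed

lemma disj_ivlsI:
  assumes "finite P" "\<And>s t. (s, t) \<in> P \<Longrightarrow> s < t"
    "\<And>s t u v. (s, t) \<in> P \<Longrightarrow> (u, v) \<in> P \<Longrightarrow> (s, t) \<noteq> (u, v) \<Longrightarrow> v \<le> s \<or> t \<le> u"
  shows "disj_ivls P"
  unfolding disj_ivls_def disjoint_family_on_def
proof (intro conjI ballI impI)
  show "finite P" by fact
  show "case p of (s, t) \<Rightarrow> s < t" if "p \<in> P" for p using that assms(2) by auto
  fix p r assume pr: "p \<in> P" "r \<in> P" "p \<noteq> r"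
  obtain s t u v where [simp]: "p = (s, t)" "r = (u, v)" by force
  have "v \<le> s \<or> t \<le> u" using assms(3)[of s t u v] pr by auto
  then show "(case p of (s, t) \<Rightarrow> {s<..<t}) \<inter> (case r of (s, t) \<Rightarrow> {s<..<t}) = {}" by auto
qed

lemma disj_ivls_length_le:
  assumes P: "disj_ivls P" and sub: "\<And>s t. (s, t) \<in> P \<Longrightarrow> {s<..<t} \<subseteq> U" and U: "U \<in> lmeasurable"
  shows "(\<Sum>(s, t)\<in>P. t - s) \<le> measure lebesgue U"
proof -
  have fin: "finite P" using P by (simp add: disj_ivls_def)
  have "measure lebesgue (\<Union>p\<in>P. case p of (s, t) \<Rightarrow> {s<..<t}) = (\<Sum>p\<in>P. measure lebesgue (case p of (s, t) \<Rightarrow> {s<..<t}))"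
    using P by (intro measure_finite_Union) (auto simp: disj_ivls_def split: prod.splits)
  also have "\<dots> = (\<Sum>(s, t)\<in>P. t - s)"
    using P by (intro sum.cong) (auto simp: disj_ivls_def split: prod.splits)
  finally have "(\<Sum>(s, t)\<in>P. t - s) = measure lebesgue (\<Union>p\<in>P. case p of (s, t) \<Rightarrow> {s<..<t})" by simp
  also have "\<dots> \<le> measure lebesgue U"
    using sub U fin by (intro measure_mono_fmeasurable) (auto split: prod.splits intro!: sets.finite_UN)
  finally show ?thesis .
qed

text \<open>Any member of the family splits the interval into a left and a right part with fewer
  members each, which gives the induction. The identity is quantified over all \<open>G\<close> so
  that one family \<open>Q\<close> serves several purposes: with \<open>G\<close> the identity it
  measures the gaps, with other \<open>G\<close> it compares increments.\<close>

lemma disj_ivls_gaps: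
  assumes "disj_ivls P" "\<And>s t. (s, t) \<in> P \<Longrightarrow> a \<le> s \<and> t \<le> b" "a \<le> b"
  obtains Q where "disj_ivls Q" "\<And>s t. (s, t) \<in> Q \<Longrightarrow> a \<le> s \<and> t \<le> b"
    "\<And>G :: real \<Rightarrow> real. (\<Sum>(s, t)\<in>P. G t - G s) + (\<Sum>(s, t)\<in>Q. G t - G s) = G b - G a"
proof -
  have "\<exists>Q. disj_ivls Q \<and> (\<forall>(s, t)\<in>Q. a \<le> s \<and> t \<le> b) \<and>
    (\<forall>G :: real \<Rightarrow> real. (\<Sum>(s, t)\<in>P. G t - G s) + (\<Sum>(s, t)\<in>Q. G t - G s) = G b - G a)"
    using assms
  proof (induction "card P" arbitrary: P a b rule: less_induct)
    case (less P a b)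
    note P = less.prems
    have finP: "finite P" using P by (simp add: disj_ivls_def)
    show ?case
    proof (cases "P = {}")
      case True
      show ?thesis
      proof (cases "a < b")
        case True
        then show ?thesis using \<open>P = {}\<close>
          by (intro exI[of _ "{(a, b)}"]) (auto simp: disj_ivls_def disjoint_family_on_def)
      next
        case False
        then show ?thesis using \<open>P = {}\<close> \<open>a \<le> b\<close>
          by (intro exI[of _ "{}"]) (auto simp: disj_ivls_def disjoint_family_on_def)
      qed
    next
      case False
      then obtain s t where st: "(s, t) \<in> P" by force
      then have "s < t" "a \<le> s" "t \<le> b" using P by (auto simp: disj_ivls_def)
      define P1 where "P1 = {(u, v)\<in>P. v \<le> s}"
      define P2 where "P2 = {(u, v)\<in>P. t \<le> u}"
      have lt: "u < v" if "(u, v) \<in> P" for u v using that P by (auto simp: disj_ivls_def)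
      have Peq: "P = insert (s, t) (P1 \<union> P2)"
        using disj_ivls_separated[OF P(1) st] st by (force simp: P1_def P2_def)
      have nin: "(s, t) \<notin> P1 \<union> P2" and dis: "P1 \<inter> P2 = {}"
        using \<open>s < t\<close> lt by (fastforce simp: P1_def P2_def)+
      have fin: "finite P1" "finite P2" using finP Peq by (metis finite_Un finite_insert)+
      have card: "card P1 < card P" "card P2 < card P"
        by (intro psubset_card_mono finP; use st nin Peq in blast)+
      have d1: "disj_ivls P1" "disj_ivls P2" using disj_ivls_subset[OF P(1)] Peq by blast+
      have b1: "\<And>u v. (u, v) \<in> P1 \<Longrightarrow> a \<le> u \<and> v \<le> s" "\<And>u v. (u, v) \<in> P2 \<Longrightarrow> t \<le> u \<and> v \<le> b"
        using P(2) by (auto simp: P1_def P2_def)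
      obtain Q1 where Q1: "disj_ivls Q1" "\<And>u v. (u, v)\<in>Q1 \<Longrightarrow> a \<le> u \<and> v \<le> s"
        "\<And>G :: real \<Rightarrow> real. (\<Sum>(s, t)\<in>P1. G t - G s) + (\<Sum>(s, t)\<in>Q1. G t - G s) = G s - G a"
        using less.hyps[OF card(1) d1(1) b1(1) \<open>a \<le> s\<close>] by force
      obtain Q2 where Q2: "disj_ivls Q2" "\<And>u v. (u, v)\<in>Q2 \<Longrightarrow> t \<le> u \<and> v \<le> b"
        "\<And>G :: real \<Rightarrow> real. (\<Sum>(s, t)\<in>P2. G t - G s) + (\<Sum>(s, t)\<in>Q2. G t - G s) = G b - G t"
        using less.hyps[OF card(2) d1(2) b1(2) \<open>t \<le> b\<close>] by force
      have ltQ: "u < v" if "(u, v) \<in> Q1 \<union> Q2" for u v using that Q1 Q2 by (auto simp: disj_ivls_def)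
      have disQ: "Q1 \<inter> Q2 = {}" using Q1(2) Q2(2) ltQ \<open>s < t\<close> by fastforce
      have finQ: "finite Q1" "finite Q2" using Q1 Q2 by (auto simp: disj_ivls_def)
      have "disj_ivls (Q1 \<union> Q2)"
      proof (rule disj_ivlsI)
        show "finite (Q1 \<union> Q2)" using finQ by simp
        show "u < v" if "(u, v) \<in> Q1 \<union> Q2" for u v using ltQ that .
        show "v' \<le> u \<or> v \<le> u'" if "(u, v) \<in> Q1 \<union> Q2" "(u', v') \<in> Q1 \<union> Q2" "(u, v) \<noteq> (u', v')" for u v u' v'
          using that disj_ivls_separated[OF Q1(1), of u v u' v'] disj_ivls_separated[OF Q2(1), of u v u' v']
            Q1(2)[of u v] Q1(2)[of u' v'] Q2(2)[of u v] Q2(2)[of u' v'] \<open>s < t\<close> by auto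
      qed
      moreover have "\<forall>(u, v)\<in>Q1 \<union> Q2. a \<le> u \<and> v \<le> b"
        using Q1(2) Q2(2) \<open>s < t\<close> \<open>a \<le> s\<close> \<open>t \<le> b\<close> by fastforce
      moreover have "(\<Sum>(s, t)\<in>P. G t - G s) + (\<Sum>(s, t)\<in>Q1 \<union> Q2. G t - G s) = G b - G a" for G :: "real \<Rightarrow> real"
      proof -
        have "(\<Sum>(s, t)\<in>P. G t - G s) = (G t - G s) + ((\<Sum>(s, t)\<in>P1. G t - G s) + (\<Sum>(s, t)\<in>P2. G t - G s))"
          using nin fin dis unfolding Peq by (simp add: sum.union_disjoint)
        moreover have "(\<Sum>(s, t)\<in>Q1 \<union> Q2. G t - G s) = (\<Sum>(s, t)\<in>Q1. G t - G s) + (\<Sum>(s, t)\<in>Q2. G t - G s)"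
          using finQ disQ by (simp add: sum.union_disjoint)
        ultimately show ?thesis using Q1(3)[of G] Q2(3)[of G] by linarith
      qed
      ultimately show ?thesis by blast
    qed
  qed
  then show thesis using that by blast
qed

section \<open>Elementary properties of absolutely continuous functions\<close>

lemma abs_cont_onD:
  assumes "abs_cont_on a b F" "0 < e"
  obtains d where "0 < d"
    "\<And>P. disj_ivls P \<Longrightarrow> (\<And>s t. (s, t) \<in> P \<Longrightarrow> a \<le> s \<and> t \<le> b) \<Longrightarrow> (\<Sum>(s, t)\<in>P. t - s) < d
      \<Longrightarrow> (\<Sum>(s, t)\<in>P. norm (F t - F s)) < e"
proof -
  obtain d where d: "0 < d" "\<And>I. finite I \<and> (\<forall>(s, t)\<in>I. a \<le> s \<and> s < t \<and> t \<le> b) \<and>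
         disjoint_family_on (\<lambda>(s, t). {s<..<t}) I \<and> (\<Sum>(s, t)\<in>I. t - s) < d
       \<longrightarrow> (\<Sum>(s, t)\<in>I. norm (F t - F s)) < e"
    using assms unfolding abs_cont_on_def by blast
  show thesis
  proof (rule that[OF d(1)])
    fix P assume "disj_ivls P" "\<And>s t. (s, t) \<in> P \<Longrightarrow> a \<le> s \<and> t \<le> b" "(\<Sum>(s, t)\<in>P. t - s) < d"
    then show "(\<Sum>(s, t)\<in>P. norm (F t - F s)) < e"
      using d(2)[of P] unfolding disj_ivls_def by fastforce
  qed
qed

lemma abs_cont_onI:
  assumes "\<And>e. 0 < e \<Longrightarrow> \<exists>d>0. \<forall>P. disj_ivls P \<and> (\<forall>(s, t)\<in>P. a \<le> s \<and> t \<le> b) \<and> (\<Sum>(s, t)\<in>P. t - s) < d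
      \<longrightarrow> (\<Sum>(s, t)\<in>P. norm (F t - F s)) < e"
  shows "abs_cont_on a b F"
  unfolding abs_cont_on_def
proof (intro allI impI)
  fix e :: real assume "0 < e"
  from assms[OF this] obtain d where d: "d > 0" "\<And>P. disj_ivls P \<and> (\<forall>(s, t)\<in>P. a \<le> s \<and> t \<le> b) \<and> (\<Sum>(s, t)\<in>P. t - s) < d
      \<Longrightarrow> (\<Sum>(s, t)\<in>P. norm (F t - F s)) < e" by blast
  show "\<exists>\<delta>>0. \<forall>I. finite I \<and> (\<forall>(s, t)\<in>I. a \<le> s \<and> s < t \<and> t \<le> b) \<and>
         disjoint_family_on (\<lambda>(s, t). {s<..<t}) I \<and> (\<Sum>(s, t)\<in>I. t - s) < \<delta>
       \<longrightarrow> (\<Sum>(s, t)\<in>I. norm (F t - F s)) < e"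
    by (rule exI[of _ d]) (auto simp: d(1) disj_ivls_def intro!: d(2))
qed

text \<open>Transfers absolute continuity to real and imaginary parts, and from an indefinite
  integral to any function with the same increments.\<close>

lemma abs_cont_on_dominated:
  fixes F G :: "real \<Rightarrow> complex"
  assumes F: "abs_cont_on a b F"
    and GF: "\<And>s t. a \<le> s \<Longrightarrow> s < t \<Longrightarrow> t \<le> b \<Longrightarrow> norm (G t - G s) \<le> norm (F t - F s)"
  shows "abs_cont_on a b G"
proof (rule abs_cont_onI)
  fix e :: real assume "0 < e"
  from abs_cont_onD[OF F this] obtain d where d: "0 < d"
    "\<And>P. disj_ivls P \<Longrightarrow> (\<And>s t. (s, t) \<in> P \<Longrightarrow> a \<le> s \<and> t \<le> b) \<Longrightarrow> (\<Sum>(s, t)\<in>P. t - s) < d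
      \<Longrightarrow> (\<Sum>(s, t)\<in>P. norm (F t - F s)) < e" by blast
  have "(\<Sum>(s, t)\<in>P. norm (G t - G s)) < e"
    if P: "disj_ivls P" "\<forall>(s, t)\<in>P. a \<le> s \<and> t \<le> b" "(\<Sum>(s, t)\<in>P. t - s) < d" for P
  proof -
    have "(\<Sum>(s, t)\<in>P. norm (G t - G s)) \<le> (\<Sum>(s, t)\<in>P. norm (F t - F s))"
      using P by (intro sum_mono) (auto simp: disj_ivls_def split: prod.splits intro!: GF)
    then show ?thesis using d(2)[of P] P by fastforce
  qed
  then show "\<exists>d>0. \<forall>P. disj_ivls P \<and> (\<forall>(s, t)\<in>P. a \<le> s \<and> t \<le> b) \<and> (\<Sum>(s, t)\<in>P. t - s) < d
      \<longrightarrow> (\<Sum>(s, t)\<in>P. norm (G t - G s)) < e" using d(1) by blast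
qed

lemma abs_cont_on_continuous:
  fixes F :: "real \<Rightarrow> complex"
  assumes "abs_cont_on a b F"
  shows "continuous_on {a..b} F"
  unfolding continuous_on_iff
proof (intro ballI allI impI)
  fix x e :: real assume x: "x \<in> {a..b}" and e: "0 < e"
  obtain d where d: "0 < d"
    "\<And>P. disj_ivls P \<Longrightarrow> (\<And>s t. (s, t) \<in> P \<Longrightarrow> a \<le> s \<and> t \<le> b) \<Longrightarrow> (\<Sum>(s, t)\<in>P. t - s) < d
      \<Longrightarrow> (\<Sum>(s, t)\<in>P. norm (F t - F s)) < e" using abs_cont_onD[OF assms e] by blast
  have *: "norm (F t - F s) < e" if "a \<le> s" "s < t" "t \<le> b" "t - s < d" for s t
    using d(2)[of "{(s, t)}"] that by (simp add: disj_ivls_def disjoint_family_on_def)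
  have "dist (F y) (F x) < e" if "y \<in> {a..b}" "dist y x < d" for y
    using *[of x y] *[of y x] that x e by (cases "x < y"; cases "y < x") (auto simp: dist_norm norm_minus_commute)
  then show "\<exists>d>0. \<forall>y\<in>{a..b}. dist y x < d \<longrightarrow> dist (F y) (F x) < e" using d(1) by blast
qed

lemma abs_cont_on_subset: "abs_cont_on a b F \<Longrightarrow> a \<le> c \<Longrightarrow> d \<le> b \<Longrightarrow> abs_cont_on c d F"
proof (rule abs_cont_onI)
  fix e :: real assume F: "abs_cont_on a b F" and "a \<le> c" "d \<le> b" and "0 < e"
  from abs_cont_onD[OF F \<open>0 < e\<close>] obtain \<delta> where \<delta>: "0 < \<delta>"
    "\<And>P. disj_ivls P \<Longrightarrow> (\<And>s t. (s, t) \<in> P \<Longrightarrow> a \<le> s \<and> t \<le> b) \<Longrightarrow> (\<Sum>(s, t)\<in>P. t - s) < \<delta>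
      \<Longrightarrow> (\<Sum>(s, t)\<in>P. norm (F t - F s)) < e" by blast
  show "\<exists>\<delta>>0. \<forall>P. disj_ivls P \<and> (\<forall>(s, t)\<in>P. c \<le> s \<and> t \<le> d) \<and> (\<Sum>(s, t)\<in>P. t - s) < \<delta>
      \<longrightarrow> (\<Sum>(s, t)\<in>P. norm (F t - F s)) < e"
    using \<open>a \<le> c\<close> \<open>d \<le> b\<close> by (intro exI[of _ \<delta>]) (fastforce simp: \<delta>(1) intro!: \<delta>(2))
qed

text \<open>Both factors are bounded, being continuous on a compact interval. The application is to
  a product with an integrating factor.\<close>

lemma abs_cont_on_mult:
  fixes F G :: "real \<Rightarrow> complex"
  assumes F: "abs_cont_on a b F" and G: "abs_cont_on a b G"
  shows "abs_cont_on a b (\<lambda>x. F x * G x)"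
proof -
  have "bounded (F ` {a..b})" "bounded (G ` {a..b})"
    using compact_continuous_image[OF abs_cont_on_continuous[OF F]]
      compact_continuous_image[OF abs_cont_on_continuous[OF G]] by (auto intro: compact_imp_bounded)
  then obtain A B where A: "\<And>x. x \<in> {a..b} \<Longrightarrow> norm (F x) \<le> A" "0 < A" and B: "\<And>x. x \<in> {a..b} \<Longrightarrow> norm (G x) \<le> B" "0 < B"
    unfolding bounded_pos by (metis imageI)
  show ?thesis
  proof (rule abs_cont_onI)
    fix e :: real assume "0 < e"
    then have e1: "0 < e / (2 * B)" "0 < e / (2 * A)" using A B by auto
    obtain d1 where d1: "0 < d1"
      "\<And>P. disj_ivls P \<Longrightarrow> (\<And>s t. (s, t) \<in> P \<Longrightarrow> a \<le> s \<and> t \<le> b) \<Longrightarrow> (\<Sum>(s, t)\<in>P. t - s) < d1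
      \<Longrightarrow> (\<Sum>(s, t)\<in>P. norm (F t - F s)) < e / (2 * B)" using abs_cont_onD[OF F e1(1)] by blast
    obtain d2 where d2: "0 < d2"
      "\<And>P. disj_ivls P \<Longrightarrow> (\<And>s t. (s, t) \<in> P \<Longrightarrow> a \<le> s \<and> t \<le> b) \<Longrightarrow> (\<Sum>(s, t)\<in>P. t - s) < d2
      \<Longrightarrow> (\<Sum>(s, t)\<in>P. norm (G t - G s)) < e / (2 * A)" using abs_cont_onD[OF G e1(2)] by blast
    have "(\<Sum>(s, t)\<in>P. norm (F t * G t - F s * G s)) < e"
      if P: "disj_ivls P" "\<forall>(s, t)\<in>P. a \<le> s \<and> t \<le> b" "(\<Sum>(s, t)\<in>P. t - s) < min d1 d2" for P
    proof -
      have "(\<Sum>(s, t)\<in>P. norm (F t * G t - F s * G s))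
          \<le> (\<Sum>p\<in>P. B * (case p of (s, t) \<Rightarrow> norm (F t - F s)) + A * (case p of (s, t) \<Rightarrow> norm (G t - G s)))"
      proof (rule sum_mono)
        fix p assume p: "p \<in> P"
        obtain s t where [simp]: "p = (s, t)" by force
        have st: "s \<in> {a..b}" "t \<in> {a..b}" using P p by (force simp: disj_ivls_def)+
        have "norm (F t * G t - F s * G s) = norm ((F t - F s) * G t + F s * (G t - G s))" by (simp add: algebra_simps)
        also have "\<dots> \<le> norm (F t - F s) * norm (G t) + norm (F s) * norm (G t - G s)"
          by (metis norm_mult norm_triangle_ineq)
        also have "\<dots> \<le> norm (F t - F s) * B + A * norm (G t - G s)"
          using A(1)[OF st(1)] B(1)[OF st(2)] by (intro add_mono mult_left_mono mult_right_mono) auto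
        finally show "(case p of (s, t) \<Rightarrow> norm (F t * G t - F s * G s)) \<le> B * (case p of (s, t) \<Rightarrow> norm (F t - F s)) + A * (case p of (s, t) \<Rightarrow> norm (G t - G s))"
          by (simp add: mult.commute)
      qed
      also have "\<dots> = B * (\<Sum>(s, t)\<in>P. norm (F t - F s)) + A * (\<Sum>(s, t)\<in>P. norm (G t - G s))"
        by (simp add: sum.distrib sum_distrib_left)
      also have "\<dots> < B * (e / (2 * B)) + A * (e / (2 * A))"
        using d1(2)[of P] d2(2)[of P] P A(2) B(2) by (intro add_strict_mono mult_strict_left_mono) fastforce+
      also have "\<dots> = e" using A(2) B(2) by simp
      finally show ?thesis .
    qed
    then show "\<exists>d>0. \<forall>P. disj_ivls P \<and> (\<forall>(s, t)\<in>P. a \<le> s \<and> t \<le> b) \<and> (\<Sum>(s, t)\<in>P. t - s) < d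
      \<longrightarrow> (\<Sum>(s, t)\<in>P. norm (F t * G t - F s * G s)) < e" using d1(1) d2(1) by (intro exI[of _ "min d1 d2"]) auto
  qed
qed

section \<open>The fundamental theorem of calculus with a negligible exceptional set\<close>

lemma lmeasurable_outer_open:
  assumes "S \<in> lmeasurable" "0 < (e::real)"
  obtains T where "open T" "S \<subseteq> T" "T \<in> lmeasurable" "measure lebesgue T < measure lebesgue S + e"
proof -
  obtain T where T: "open T" "S \<subseteq> T" "(T - S) \<in> lmeasurable" "emeasure lebesgue (T - S) < ennreal e"
    using sets_lebesgue_outer_open[of S e] assms by blast
  have eq: "T = S \<union> (T - S)" using T by blast
  have "T \<in> lmeasurable" using fmeasurable.Un[OF assms(1) T(3)] eq by simp
  moreover have "measure lebesgue (T - S) < e"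
    using T(3,4) by (simp add: emeasure_eq_measure2 ennreal_less_iff)
  moreover have "measure lebesgue T \<le> measure lebesgue S + measure lebesgue (T - S)"
    using measure_Un_le[of S lebesgue "T - S"] assms(1) T(3) eq by (simp add: fmeasurableD)
  ultimately show thesis using that T by force
qed

text \<open>The gauge sends tags in the exceptional set into an open set of small measure, where absolute
  continuity controls the increments of \<open>F\<close>.\<close>

lemma abs_cont_on_FTC:
  fixes F f :: "real \<Rightarrow> complex"
  assumes F: "abs_cont_on a b F" and ab: "a \<le> b" and N: "negligible N"
    and D: "\<And>x. x \<in> {a..b} - N \<Longrightarrow> (F has_vector_derivative f x) (at x within {a..b})"
  shows "(f has_integral (F b - F a)) {a..b}"
proof -
  \<comment> \<open>Tags in \<open>N\<close> then carry the value 0, and only the increments of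
    \<open>F\<close> over their cells remain to be controlled.\<close>
  define g where "g x = (if x \<in> N then 0 else f x)" for x
  have "(g has_integral (F b - F a)) {a..b}"
    unfolding has_integral_real
  proof (intro allI impI)
    fix e :: real assume e: "0 < e"
    \<comment> \<open>The 1 in the denominator covers the case \<open>a = b\<close>; the cells
      tagged outside \<open>N\<close> then cost at most \<open>e / 2\<close>.\<close>
    define e' where "e' = e / (2 * (b - a + 1))"
    have e': "0 < e'" using e ab by (simp add: e'_def)
    obtain \<delta> where \<delta>: "0 < \<delta>"
      "\<And>P. disj_ivls P \<Longrightarrow> (\<And>s t. (s, t) \<in> P \<Longrightarrow> a \<le> s \<and> t \<le> b) \<Longrightarrow> (\<Sum>(s, t)\<in>P. t - s) < \<delta>
      \<Longrightarrow> (\<Sum>(s, t)\<in>P. norm (F t - F s)) < e / 2" using abs_cont_onD[OF F half_gt_zero[OF e]] by blast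
    have Nm: "N \<in> lmeasurable" "measure lebesgue N = 0"
      using N by (auto simp: negligible_imp_measurable negligible_imp_measure0)
    obtain U where U: "open U" "N \<subseteq> U" "U \<in> lmeasurable" "measure lebesgue U < \<delta>"
      using lmeasurable_outer_open[OF Nm(1) \<delta>(1)] Nm(2) by (metis add_0)
    have "\<forall>x. \<exists>d>0. x \<in> {a..b} - N \<longrightarrow>
         (\<forall>y\<in>{a..b}. norm (y-x) < d \<longrightarrow> norm (F y - F x - (y-x) *\<^sub>R f x) \<le> e' * norm (y-x))"
    proof
      fix x
      show "\<exists>d>0. x \<in> {a..b} - N \<longrightarrow>
         (\<forall>y\<in>{a..b}. norm (y-x) < d \<longrightarrow> norm (F y - F x - (y-x) *\<^sub>R f x) \<le> e' * norm (y-x))"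
      proof (cases "x \<in> {a..b} - N")
        case True
        then show ?thesis using D[OF True, unfolded has_vector_derivative_def has_derivative_within_alt] e' by blast
      next
        case False
        then show ?thesis using zero_less_one by blast
      qed
    qed
    then obtain d where d: "\<And>x. 0 < d x"
      "\<And>x y. \<lbrakk>x \<in> {a..b} - N; y \<in> {a..b}; norm (y-x) < d x\<rbrakk>
                        \<Longrightarrow> norm (F y - F x - (y-x) *\<^sub>R f x) \<le> e' * norm (y-x)" by metis
    define \<gamma> where "\<gamma> x = (if x \<in> N then U else ball x (d x))" for x
    have gauge: "gauge \<gamma>" using U d(1) by (auto simp: gauge_def \<gamma>_def)
    have "norm ((\<Sum>(x, K)\<in>p. measure lborel K *\<^sub>R g x) - (F b - F a)) < e"
      if p: "p tagged_division_of {a..b}" and fine: "\<gamma> fine p" for p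
    proof -
      have finp: "finite p" using p by blast
      have ivl: "\<exists>u v. K = {u..v} \<and> u \<le> x \<and> x \<le> v \<and> a \<le> u \<and> v \<le> b" if "(x, K) \<in> p" for x K
      proof -
        have "x \<in> K" "K \<subseteq> {a..b}" using p that by blast+
        moreover obtain u v where "K = cbox u v" using tagged_division_ofD(4)[OF p \<open>(x, K) \<in> p\<close>] by blast
        ultimately show ?thesis by (intro exI[of _ u] exI[of _ v]) (auto simp: box_real)
      qed
      have sumF: "F b - F a = (\<Sum>(x,K)\<in>p. F(Sup K) - F(Inf K))"
        using additive_tagged_division_1[OF ab p, of F] by simp
      have sumid: "b - a = (\<Sum>(x,K)\<in>p. Sup K - Inf K)"
        using additive_tagged_division_1[OF ab p, of "\<lambda>x. x"] by simp
      define p1 where "p1 = {(x, K)\<in>p. x \<notin> N}"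
      \<comment> \<open>Degenerate cells tagged in \<open>N\<close> contribute nothing and are
        dropped, because \<open>disj_ivls\<close> admits proper intervals only.\<close>
      define p2 where "p2 = {(x, K)\<in>p. x \<in> N \<and> Inf K < Sup K}"
      have fin12: "finite p1" "finite p2" using finp by (auto simp: p1_def p2_def intro: finite_subset[OF _ finp])
      have "(\<Sum>(x, K)\<in>p. measure lborel K *\<^sub>R g x) - (F b - F a)
          = (\<Sum>(x, K)\<in>p. measure lborel K *\<^sub>R g x - (F (Sup K) - F (Inf K)))"
        unfolding sumF by (simp add: sum_subtractf split_def)
      also have "\<dots> = (\<Sum>(x, K)\<in>p1 \<union> p2. measure lborel K *\<^sub>R g x - (F (Sup K) - F (Inf K)))"
      proof (rule sum.mono_neutral_right)
        show "\<forall>i\<in>p - (p1 \<union> p2). (case i of (x, K) \<Rightarrow> measure lborel K *\<^sub>R g x - (F (Sup K) - F (Inf K))) = 0"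
        proof
          fix i assume i: "i \<in> p - (p1 \<union> p2)"
          obtain x K where [simp]: "i = (x, K)" by force
          have xK: "(x, K) \<in> p" "x \<in> N" "\<not> Inf K < Sup K" using i by (auto simp: p1_def p2_def)
          show "(case i of (x, K) \<Rightarrow> measure lborel K *\<^sub>R g x - (F (Sup K) - F (Inf K))) = 0"
          proof -
            obtain u v where uv: "K = {u..v}" "u \<le> x" "x \<le> v" using ivl[OF xK(1)] by blast
            then have "u = v" using xK by simp
            then show ?thesis using uv xK by (simp add: g_def)
          qed
        qed
      qed (auto simp: finp p1_def p2_def)
      also have "\<dots> = (\<Sum>(x, K)\<in>p1. measure lborel K *\<^sub>R g x - (F (Sup K) - F (Inf K)))
          + (\<Sum>(x, K)\<in>p2. measure lborel K *\<^sub>R g x - (F (Sup K) - F (Inf K)))"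
        by (rule sum.union_disjoint) (use fin12 in \<open>auto simp: p1_def p2_def\<close>)
      finally have split: "(\<Sum>(x, K)\<in>p. measure lborel K *\<^sub>R g x) - (F b - F a) =
          (\<Sum>(x, K)\<in>p1. measure lborel K *\<^sub>R g x - (F (Sup K) - F (Inf K)))
          + (\<Sum>(x, K)\<in>p2. measure lborel K *\<^sub>R g x - (F (Sup K) - F (Inf K)))" .
      have n1: "norm (\<Sum>(x, K)\<in>p1. measure lborel K *\<^sub>R g x - (F (Sup K) - F (Inf K))) \<le> e' * (b - a)"
      proof -
        have "norm (\<Sum>(x, K)\<in>p1. measure lborel K *\<^sub>R g x - (F (Sup K) - F (Inf K))) \<le> (\<Sum>q\<in>p1. e' * (case q of (x, K) \<Rightarrow> Sup K - Inf K))"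
        proof (rule sum_norm_le, clarsimp simp: p1_def)
          fix x K assume xK: "(x, K) \<in> p" and x: "x \<notin> N"
          obtain u v where uv: "K = {u..v}" "u \<le> x" "x \<le> v" "a \<le> u" "v \<le> b" using ivl[OF xK] by blast
          have "K \<subseteq> ball x (d x)" using fineD[OF fine xK] x by (simp add: \<gamma>_def)
          moreover have "u \<in> K" "v \<in> K" using uv by auto
          ultimately have "u \<in> ball x (d x)" "v \<in> ball x (d x)" by blast+
          then have "norm (F u - F x - (u-x) *\<^sub>R f x) \<le> e' * norm (u-x)" "norm (F v - F x - (v-x) *\<^sub>R f x) \<le> e' * norm (v-x)"
            using d(2)[of x u] d(2)[of x v] uv x by (auto simp: dist_norm norm_minus_commute)
          then have "norm ((F u - F x - (u-x) *\<^sub>R f x) - (F v - F x - (v-x) *\<^sub>R f x)) \<le> e' * (x - u) + e' * (v - x)"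
            using uv by (intro order_trans[OF norm_triangle_ineq4]) auto
          also have "(F u - F x - (u-x) *\<^sub>R f x) - (F v - F x - (v-x) *\<^sub>R f x) = measure lborel K *\<^sub>R g x - (F (Sup K) - F (Inf K))"
            using uv x by (simp add: g_def algebra_simps)
          finally show "norm (measure lborel K *\<^sub>R g x - (F (Sup K) - F (Inf K))) \<le> e' * (Sup K - Inf K)"
            using uv by (simp add: algebra_simps)
        qed
        also have "\<dots> \<le> (\<Sum>q\<in>p. e' * (case q of (x, K) \<Rightarrow> Sup K - Inf K))"
          using ivl e' by (intro sum_mono2[OF finp]) (fastforce simp: p1_def)+
        also have "\<dots> = e' * (b - a)" unfolding sumid by (simp add: sum_distrib_left)
        finally show ?thesis .
      qed
      have n2: "norm (\<Sum>(x, K)\<in>p2. measure lborel K *\<^sub>R g x - (F (Sup K) - F (Inf K))) < e / 2"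
      proof -
        define \<phi> :: "real \<times> real set \<Rightarrow> real \<times> real" where "\<phi> = (\<lambda>(x, K). (Inf K, Sup K))"
        define P where "P = \<phi> ` p2"
        have disj: "{Inf K<..<Sup K} \<inter> {Inf L<..<Sup L} = {}" if "(x, K) \<in> p2" "(y, L) \<in> p2" "(x, K) \<noteq> (y, L)" for x y K L
        proof -
          have xy: "(x, K) \<in> p" "(y, L) \<in> p" using that by (auto simp: p2_def)
          then have "interior K \<inter> interior L = {}" using tagged_division_ofD(5)[OF p xy that(3)] by simp
          moreover have "interior K = {Inf K<..<Sup K}" "interior L = {Inf L<..<Sup L}"
            using ivl[OF xy(1)] ivl[OF xy(2)] by auto
          ultimately show ?thesis by simp
        qed
        \<comment> \<open>The sum over cells is to become a sum over intervals: two cells with equal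
          end points would share a nonempty interior, against disjointness.\<close>
        have inj: "inj_on \<phi> p2"
        proof (rule inj_onI)
          fix q r assume qr: "q \<in> p2" "r \<in> p2" "\<phi> q = \<phi> r"
          obtain x K y L where [simp]: "q = (x, K)" "r = (y, L)" by force
          have "{Inf K<..<Sup K} \<inter> {Inf L<..<Sup L} \<noteq> {}"
            using qr by (auto simp: \<phi>_def p2_def)
          then show "q = r" using disj[of x K y L] qr by auto
        qed
        have P: "disj_ivls P"
          unfolding disj_ivls_def
        proof (intro conjI)
          show "finite P" using fin12 by (simp add: P_def)
          show "\<forall>(s, t)\<in>P. s < t" by (auto simp: P_def \<phi>_def p2_def)
          show "disjoint_family_on (\<lambda>(s, t). {s<..<t}) P"
            unfolding disjoint_family_on_def P_def
          proof (intro ballI impI)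
            fix m n assume "m \<in> \<phi> ` p2" "n \<in> \<phi> ` p2" "m \<noteq> n"
            then obtain x K y L where "(x, K) \<in> p2" "(y, L) \<in> p2" "(x, K) \<noteq> (y, L)" "m = (Inf K, Sup K)" "n = (Inf L, Sup L)"
              by (auto simp: \<phi>_def)
            then show "(case m of (s, t) \<Rightarrow> {s<..<t}) \<inter> (case n of (s, t) \<Rightarrow> {s<..<t}) = {}" using disj by simp
          qed
        qed
        have Pb: "a \<le> s \<and> t \<le> b \<and> {s<..<t} \<subseteq> U" if "(s, t) \<in> P" for s t
        proof -
          obtain x K where xK: "(x, K) \<in> p" "x \<in> N" "s = Inf K" "t = Sup K" using \<open>(s, t) \<in> P\<close> by (auto simp: P_def \<phi>_def p2_def)
          then have "K \<subseteq> U" using fineD[OF fine xK(1)] xK(2) by (simp add: \<gamma>_def)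
          moreover obtain u v where "K = {u..v}" "u \<le> x" "x \<le> v" "a \<le> u" "v \<le> b" using ivl[OF xK(1)] by blast
          ultimately show ?thesis using xK by auto
        qed
        have "(\<Sum>(s, t)\<in>P. t - s) < \<delta>"
          using disj_ivls_length_le[OF P _ U(3)] Pb U(4) by fastforce
        then have lt: "(\<Sum>(s, t)\<in>P. norm (F t - F s)) < e / 2" using \<delta>(2)[OF P] Pb by blast
        have "norm (\<Sum>(x, K)\<in>p2. measure lborel K *\<^sub>R g x - (F (Sup K) - F (Inf K))) \<le> (\<Sum>(x, K)\<in>p2. norm (F (Sup K) - F (Inf K)))"
          by (rule sum_norm_le) (auto simp: p2_def g_def norm_minus_commute)
        also have "\<dots> = (\<Sum>(s, t)\<in>P. norm (F t - F s))"
          unfolding P_def by (subst sum.reindex[OF inj]) (auto simp: \<phi>_def intro!: sum.cong)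
        finally show ?thesis using lt by simp
      qed
      have "e' * (b - a) \<le> e / 2"
        using e ab by (simp add: e'_def field_simps)
      then show ?thesis unfolding split using n1 n2 by (intro norm_triangle_lt) linarith
    qed
    then show "\<exists>\<gamma>. gauge \<gamma> \<and> (\<forall>\<D>. \<D> tagged_division_of {a..b} \<and> \<gamma> fine \<D> \<longrightarrow>
        norm ((\<Sum>(x, k)\<in>\<D>. measure lborel k *\<^sub>R g x) - (F b - F a)) < e)"
      using gauge by blast
  qed
  then show ?thesis
    by (rule has_integral_spike[OF N, rotated]) (simp add: g_def)
qed

section \<open>Differentiability almost everywhere by Vitali coverings\<close>

text \<open>Closed intervals are balls around their midpoints, so Vitali's theorem gives a countable
  disjoint subfamily covering \<open>S\<close> up to a null set. Continuity of the measure along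
  decreasing sets leaves a finite subfamily, and the passage to open intervals loses finitely many
  points only.\<close>

lemma Vitali_finite_ivls:
  fixes S :: "real set"
  assumes S: "S \<in> lmeasurable" and \<eta>: "0 < \<eta>" and K: "\<And>s t. (s, t) \<in> K \<Longrightarrow> s < t"
    and fine: "\<And>x d. x \<in> S \<Longrightarrow> 0 < d \<Longrightarrow> \<exists>s t. (s, t) \<in> K \<and> s \<le> x \<and> x \<le> t \<and> t - s < d"
  obtains P where "disj_ivls P" "P \<subseteq> K" "measure lebesgue (S - (\<Union>(s, t)\<in>P. {s<..<t})) < \<eta>"
    "measure lebesgue S < (\<Sum>(s, t)\<in>P. t - s) + \<eta>"
proof -
  let ?a = "\<lambda>(s, t). (s + t) / 2 :: real" and ?r = "\<lambda>(s, t). (t - s) / 2 :: real"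
  have cb: "cball (?a p) (?r p) = {fst p..snd p}" for p
    by (cases p) (auto simp: cball_eq_atLeastAtMost field_simps)
  obtain C where C: "countable C" "C \<subseteq> K"
     "pairwise (\<lambda>i j. disjnt (cball (?a i) (?r i)) (cball (?a j) (?r j))) C"
     "negligible (S - (\<Union>i \<in> C. cball (?a i) (?r i)))"
  proof (rule Vitali_covering_theorem_cballs[of K ?r S ?a])
    show "0 < ?r i" if "i \<in> K" for i using K that by (cases i) auto
    show "\<exists>i. i \<in> K \<and> x \<in> cball (?a i) (?r i) \<and> ?r i < d" if "x \<in> S" "0 < d" for x d
    proof -
      obtain s t where "(s, t) \<in> K" "s \<le> x" "x \<le> t" "t - s < d" using fine[OF \<open>x \<in> S\<close> \<open>0 < d\<close>] by blast
      moreover have "s < t" using K calculation by blast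
      ultimately show ?thesis by (intro exI[of _ "(s, t)"]) (simp only: cb, auto)
    qed
  qed blast
  \<comment> \<open>\<open>from_nat_into\<close> returns an arbitrary value if \<open>C\<close> is
    empty; the intersection with \<open>C\<close> guards against it.\<close>
  define A where "A n = S - (\<Union>i\<in>(from_nat_into C ` {..<n}) \<inter> C. {fst i..snd i})" for n
  have A_sets: "A n \<in> lmeasurable" for n
    unfolding A_def using S by (intro fmeasurable_Diff) (auto intro!: sets.finite_UN)
  have dec: "decseq A" unfolding A_def decseq_def by (auto intro!: Diff_mono UN_mono)
  have neg: "negligible (\<Inter>n. A n)"
  proof (rule negligible_subset[OF C(4)])
    show "(\<Inter>n. A n) \<subseteq> S - (\<Union>i \<in> C. cball (?a i) (?r i))"
    proof
      fix x assume x: "x \<in> (\<Inter>n. A n)"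
      have "x \<notin> cball (?a i) (?r i)" if "i \<in> C" for i
      proof -
        obtain n where "from_nat_into C n = i" using \<open>i \<in> C\<close> C(1) by (metis from_nat_into_to_nat_on)
        then have "i \<in> (from_nat_into C ` {..<Suc n}) \<inter> C" using that by auto
        moreover have "x \<in> A (Suc n)" using x by blast
        ultimately show ?thesis unfolding A_def cb by blast
      qed
      moreover have "x \<in> S" using x unfolding A_def by auto
      ultimately show "x \<in> S - (\<Union>i \<in> C. cball (?a i) (?r i))" by blast
    qed
  qed
  have "(\<lambda>n. measure lebesgue (A n)) \<longlonglongrightarrow> measure lebesgue (\<Inter>n. A n)"
  proof (rule Lim_measure_decseq[OF _ dec])
    show "range A \<subseteq> sets lebesgue" using fmeasurableD[OF A_sets] by blast
    show "emeasure lebesgue (A i) \<noteq> \<infinity>" for i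
      unfolding infinity_ennreal_def by (rule fmeasurableD2[OF A_sets])
  qed
  then have "(\<lambda>n. measure lebesgue (A n)) \<longlonglongrightarrow> 0" using neg by (simp add: negligible_imp_measure0)
  then have "eventually (\<lambda>n. measure lebesgue (A n) < \<eta>) sequentially"
    using \<eta> by (rule order_tendstoD)
  then obtain n where n: "measure lebesgue (A n) < \<eta>" by (meson eventually_sequentially order_refl)
  define P where "P = (from_nat_into C ` {..<n}) \<inter> C"
  have PC: "P \<subseteq> C" and finP: "finite P" by (auto simp: P_def)
  have disj: "disj_ivls P"
  proof (rule disj_ivlsI[OF finP])
    show "s < t" if "(s, t) \<in> P" for s t using that PC C(2) K by blast
    show "v \<le> s \<or> t \<le> u" if "(s, t) \<in> P" "(u, v) \<in> P" "(s, t) \<noteq> (u, v)" for s t u v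
    proof -
      have "disjnt {s..t} {u..v}" using pairwiseD[OF C(3), of "(s, t)" "(u, v)"] that PC unfolding cb by auto
      moreover have "s < t" "u < v" using that PC C(2) K by blast+
      ultimately show ?thesis by (auto simp: disjnt_def)
    qed
  qed
  let ?V = "\<Union>(s, t)\<in>P. {s<..<t}"
  have V: "?V \<in> lmeasurable" using finP by (intro fmeasurable.finite_UN) auto
  have fin: "finite (fst ` P \<union> snd ` P)" using finP by simp
  have "measure lebesgue (S - ?V) \<le> measure lebesgue (A n \<union> (fst ` P \<union> snd ` P))"
  proof (rule measure_mono_fmeasurable)
    show "S - ?V \<subseteq> A n \<union> (fst ` P \<union> snd ` P)"
      unfolding A_def P_def[symmetric] by (force simp: less_le)
    show "S - ?V \<in> sets lebesgue" using S V by auto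
    show "A n \<union> (fst ` P \<union> snd ` P) \<in> lmeasurable"
      using A_sets fin by (intro fmeasurable.Un) (auto intro!: negligible_imp_measurable)
  qed
  also have "\<dots> \<le> measure lebesgue (A n) + measure lebesgue (fst ` P \<union> snd ` P)"
    using A_sets[of n] fin by (intro measure_Un_le) (auto intro!: fmeasurableD negligible_imp_measurable)
  also have "\<dots> = measure lebesgue (A n)" using negligible_imp_measure0[OF negligible_finite[OF fin]] by simp
  finally have lt: "measure lebesgue (S - ?V) < \<eta>" using n by simp
  have "measure lebesgue S \<le> measure lebesgue ((S - ?V) \<union> ?V)"
    using S V by (intro measure_mono_fmeasurable fmeasurable.Un) (auto intro: fmeasurable_Diff)
  also have "\<dots> \<le> measure lebesgue (S - ?V) + measure lebesgue ?V"
    using S V by (intro measure_Un_le) auto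
  also have "measure lebesgue ?V \<le> (\<Sum>p\<in>P. measure lebesgue (case p of (s, t) \<Rightarrow> {s<..<t}))"
    using finP by (intro measure_UNION_le) auto
  also have "\<dots> = (\<Sum>(s, t)\<in>P. t - s)"
    proof (rule sum.cong[OF refl])
    fix p assume "p \<in> P"
    then have "fst p < snd p" using K[of "fst p" "snd p"] PC C(2) by auto
    then show "measure lebesgue (case p of (s, t) \<Rightarrow> {s<..<t}) = (case p of (s, t) \<Rightarrow> t - s)"
      by (cases p) simp
  qed
  finally have "measure lebesgue S < (\<Sum>(s, t)\<in>P. t - s) + \<eta>" using lt by linarith
  then show thesis using that disj PC C(2) lt by blast
qed

text \<open>Points strictly inside arbitrarily short intervals with property \<open>Q\<close>. Since
  \<open>x\<close> is interior to the interval, the set is a countable intersection of open sets for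
  every \<open>Q\<close>; with one end point tied to \<open>x\<close>, measurability would depend on
  \<open>Q\<close>.\<close>

definition straddle :: "real \<Rightarrow> real \<Rightarrow> (real \<Rightarrow> real \<Rightarrow> bool) \<Rightarrow> real set" where
  "straddle a b Q = {x. \<forall>d>0. \<exists>s t. a \<le> s \<and> s < x \<and> x < t \<and> t \<le> b \<and> t - s < d \<and> Q s t}"

lemma straddleD:
  "x \<in> straddle a b Q \<Longrightarrow> 0 < d \<Longrightarrow> \<exists>s t. a \<le> s \<and> s < x \<and> x < t \<and> t \<le> b \<and> t - s < d \<and> Q s t"
  by (simp add: straddle_def)

lemma straddle_subset: "straddle a b Q \<subseteq> {a<..<b}"
proof
  fix x assume "x \<in> straddle a b Q"
  then obtain s t where "a \<le> s" "s < x" "x < t" "t \<le> b" unfolding straddle_def using zero_less_one by blast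
  then show "x \<in> {a<..<b}" by simp
qed

lemma bounded_straddle: "bounded (straddle a b Q)"
proof (rule bounded_subset[OF bounded_cbox[of a b]])
  show "straddle a b Q \<subseteq> cbox a b" using straddle_subset[of a b Q] by (auto simp: box_real)
qed

lemma straddle_lmeasurable: "straddle a b Q \<in> lmeasurable"
proof -
  define U where "U n = \<Union>{{s<..<t} |s t. a \<le> s \<and> t \<le> b \<and> t - s < 1 / Suc n \<and> Q s t}" for n :: nat
  have "straddle a b Q = (\<Inter>n. U n)"
  proof (intro equalityI subsetI)
    fix x assume "x \<in> straddle a b Q"
    then have *: "\<exists>s t. a \<le> s \<and> s < x \<and> x < t \<and> t \<le> b \<and> t - s < 1 / Suc n \<and> Q s t" for n :: nat
      unfolding straddle_def by auto
    show "x \<in> (\<Inter>n. U n)"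
    proof
      fix n
      obtain s t where "a \<le> s" "s < x" "x < t" "t \<le> b" "t - s < 1 / Suc n" "Q s t" using *[of n] by blast
      then have "{s<..<t} \<in> {{s<..<t} |s t. a \<le> s \<and> t \<le> b \<and> t - s < 1 / Suc n \<and> Q s t}" "x \<in> {s<..<t}" by auto
      then show "x \<in> U n" unfolding U_def by blast
    qed
  next
    fix x assume x: "x \<in> (\<Inter>n. U n)"
    show "x \<in> straddle a b Q"
      unfolding straddle_def
    proof (intro CollectI allI impI)
      fix d :: real assume "0 < d"
      then obtain n where n: "1 / Suc n < d" using nat_approx_posE by blast
      have "x \<in> U n" using x by blast
      then obtain s t where "a \<le> s" "t \<le> b" "t - s < 1 / Suc n" "Q s t" "s < x" "x < t"
        unfolding U_def by auto
      then show "\<exists>s t. a \<le> s \<and> s < x \<and> x < t \<and> t \<le> b \<and> t - s < d \<and> Q s t" using n less_trans by blast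
    qed
  qed
  moreover have "open (U n)" for n unfolding U_def by (intro open_Union) auto
  then have "(\<Inter>n. U n) \<in> sets lebesgue" by (intro sets.countable_INT) (auto intro!: borel_open)
  ultimately have "straddle a b Q \<in> sets lebesgue" by simp
  then show ?thesis
    using bounded_straddle by (rule bounded_set_imp_lmeasurable[rotated])
qed

text \<open>In a window shorter than \<open>\<delta>\<close> every disjoint family of intervals has
  increments of total size below 1. Intervals of slope above \<open>k + 1\<close> thus have total
  length below \<open>1 / (k + 1)\<close>, and by Vitali the exceptional set in the window has
  measure of the same order. Countably many windows suffice.\<close>

lemma straddle_unbounded_negligible:
  fixes G :: "real \<Rightarrow> real"
  assumes G: "abs_cont_on a b (\<lambda>x. complex_of_real (G x))"
  shows "negligible (\<Inter>k::nat. straddle a b (\<lambda>s t. k * (t - s) < \<bar>G t - G s\<bar>))" (is "negligible ?E")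
proof -
  obtain \<delta> where \<delta>: "0 < \<delta>"
      "\<And>P. disj_ivls P \<Longrightarrow> (\<And>s t. (s, t) \<in> P \<Longrightarrow> a \<le> s \<and> t \<le> b) \<Longrightarrow> (\<Sum>(s, t)\<in>P. t - s) < \<delta>
      \<Longrightarrow> (\<Sum>(s, t)\<in>P. norm (complex_of_real (G t) - complex_of_real (G s))) < 1"
    using abs_cont_onD[OF G zero_less_one] by blast
  have E: "?E \<in> lmeasurable"
  proof (rule bounded_set_imp_lmeasurable)
    show "bounded ?E" by (rule bounded_subset[OF bounded_straddle]) blast
    show "?E \<in> sets lebesgue" using straddle_lmeasurable by (intro sets.countable_INT) auto
  qed
  have loc: "negligible (?E \<inter> {c<..<c + \<delta> / 2})" for c
  proof -
    let ?S = "?E \<inter> {c<..<c + \<delta> / 2}"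
    have S: "?S \<in> lmeasurable" using E by (simp add: fmeasurable_Int_fmeasurable)
    have bd: "measure lebesgue ?S \<le> 2 / Suc k" for k :: nat
    proof -
      define K where "K = {(s, t). a \<le> s \<and> s < t \<and> t \<le> b \<and> c < s \<and> t < c + \<delta> / 2 \<and> real (Suc k) * (t - s) < \<bar>G t - G s\<bar>}"
      have fine: "\<exists>s t. (s, t) \<in> K \<and> s \<le> x \<and> x \<le> t \<and> t - s < d" if "x \<in> ?S" "0 < d" for x d
      proof -
        define d' where "d' = min d (min (x - c) (c + \<delta> / 2 - x))"
        have "0 < d'" using that by (auto simp: d'_def)
        moreover have "x \<in> straddle a b (\<lambda>s t. real (Suc k) * (t - s) < \<bar>G t - G s\<bar>)" using that by blast
        ultimately obtain s t where "a \<le> s" "s < x" "x < t" "t \<le> b" "t - s < d'" "real (Suc k) * (t - s) < \<bar>G t - G s\<bar>"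
          using straddleD by blast
        then show ?thesis by (intro exI[of _ s] exI[of _ t]) (auto simp: K_def d'_def)
      qed
      have ltK: "s < t" if "(s, t) \<in> K" for s t using that by (simp add: K_def)
      have pos: "0 < 1 / real (Suc k)" by simp
      obtain P where P: "disj_ivls P" "P \<subseteq> K" "measure lebesgue ?S < (\<Sum>(s, t)\<in>P. t - s) + 1 / Suc k"
        by (rule Vitali_finite_ivls[OF S pos ltK fine])
      have "(\<Sum>(s, t)\<in>P. t - s) \<le> measure lebesgue {c<..<c + \<delta> / 2}"
        using P by (intro disj_ivls_length_le) (auto simp: K_def)
      also have "\<dots> < \<delta>" using \<delta>(1) by simp
      finally have "(\<Sum>(s, t)\<in>P. norm (complex_of_real (G t) - complex_of_real (G s))) < 1"
        using P(2) by (intro \<delta>(2)[OF P(1)]) (auto simp: K_def)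
      moreover have "real (Suc k) * (\<Sum>(s, t)\<in>P. t - s) \<le> (\<Sum>(s, t)\<in>P. norm (complex_of_real (G t) - complex_of_real (G s)))"
        unfolding sum_distrib_left
      proof (rule sum_mono)
        fix p assume "p \<in> P"
        then obtain s t where st: "p = (s, t)" "(s, t) \<in> K" using P(2) by (cases p) auto
        have "norm (complex_of_real (G t) - complex_of_real (G s)) = \<bar>G t - G s\<bar>"
          by (metis norm_of_real of_real_diff)
        then show "real (Suc k) * (case p of (s, t) \<Rightarrow> t - s) \<le> (case p of (s, t) \<Rightarrow> norm (complex_of_real (G t) - complex_of_real (G s)))"
          using st by (simp add: K_def)
      qed
      ultimately have "real (Suc k) * (\<Sum>(s, t)\<in>P. t - s) < 1" by linarith
      then have "(\<Sum>(s, t)\<in>P. t - s) < 1 / Suc k" by (simp add: field_simps)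
      then show ?thesis using P(3) by (simp add: field_simps)
    qed
    have "measure lebesgue ?S \<le> 0"
    proof (rule field_le_epsilon)
      fix e :: real assume "0 < e"
      then obtain k where "1 / Suc k < e / 2" using nat_approx_posE[of "e/2"] by auto
      moreover have "2 / real (Suc k) = 2 * (1 / Suc k)" by simp
      ultimately show "measure lebesgue ?S \<le> 0 + e" using bd[of k] by linarith
    qed
    then show ?thesis using S measure_nonneg[of lebesgue ?S] by (simp add: negligible_iff_measure)
  qed
  have "?E \<subseteq> (\<Union>c\<in>\<rat>. ?E \<inter> {c<..<c + \<delta> / 2})"
  proof
    fix x assume "x \<in> ?E"
    moreover obtain c where "c \<in> \<rat>" "x - \<delta> / 2 < c" "c < x"
      using Rats_dense_in_real[of "x - \<delta> / 2" x] \<delta>(1) by auto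
    ultimately show "x \<in> (\<Union>c\<in>\<rat>. ?E \<inter> {c<..<c + \<delta> / 2})" by auto
  qed
  moreover have "negligible (\<Union>c\<in>\<rat>. ?E \<inter> {c<..<c + \<delta> / 2})"
    using loc countable_rat by (intro negligible_countable_Union) auto
  ultimately show ?thesis by (rule negligible_subset[rotated])
qed

text \<open>A nearly optimal family of steep intervals is compared with a finer nearly optimal family of
  flat intervals inside it: the gaps have small total length, so absolute continuity makes their
  contribution negligible.\<close>

lemma straddle_gap_negligible:
  fixes G :: "real \<Rightarrow> real"
  assumes G: "abs_cont_on a b (\<lambda>x. complex_of_real (G x))" and ab: "\<alpha> < \<beta>"
  shows "negligible (straddle a b (\<lambda>s t. G t - G s < \<alpha> * (t - s)) \<inter> straddle a b (\<lambda>s t. \<beta> * (t - s) < G t - G s))"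
    (is "negligible ?E")
proof (rule ccontr)
  assume "\<not> negligible ?E"
  have E: "?E \<in> lmeasurable" using straddle_lmeasurable by (simp add: fmeasurable_Int_fmeasurable fmeasurableD)
  define m where "m = measure lebesgue ?E"
  have m: "0 < m" using \<open>\<not> negligible ?E\<close> E by (simp add: m_def negligible_iff_measure zero_less_measure_iff)
  \<comment> \<open>The final estimate reads \<open>(\<beta> - \<alpha>) * m < e + e / 2\<close>,
    which this choice makes absurd.\<close>
  define e where "e = (\<beta> - \<alpha>) * m / 2"
  have e: "0 < e" using m ab by (simp add: e_def)
  obtain \<delta> where \<delta>: "0 < \<delta>"
      "\<And>P. disj_ivls P \<Longrightarrow> (\<And>s t. (s, t) \<in> P \<Longrightarrow> a \<le> s \<and> t \<le> b) \<Longrightarrow> (\<Sum>(s, t)\<in>P. t - s) < \<delta>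
      \<Longrightarrow> (\<Sum>(s, t)\<in>P. norm (complex_of_real (G t) - complex_of_real (G s))) < e"
    using abs_cont_onD[OF G e] by blast
  \<comment> \<open>The total coefficient of \<open>\<eta>\<close> in the lower bound for
    \<open>\<beta> * L1 - \<alpha> * L2\<close>: \<open>\<beta> - \<alpha>\<close> since
    \<open>L1\<close> is only known to exceed \<open>m - \<eta>\<close>, and
    \<open>3 * \<bar>\<alpha>\<bar>\<close> since \<open>L1\<close> and \<open>L2\<close> differ by
    less than \<open>3 * \<eta>\<close>.\<close>
  define M where "M = (\<beta> - \<alpha>) + 3 * \<bar>\<alpha>\<bar>"
  have M: "0 < M" using ab by (simp add: M_def)
  define \<eta> where "\<eta> = min (\<delta> / 4) (e / (2 * M))"
  have \<eta>: "0 < \<eta>" "3 * \<eta> < \<delta>" "M * \<eta> \<le> e / 2" using \<delta> e M by (auto simp: \<eta>_def min_def field_simps)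
  obtain U where U: "open U" "?E \<subseteq> U" "U \<in> lmeasurable" "measure lebesgue U < m + \<eta>"
    using lmeasurable_outer_open[OF E \<eta>(1)] m_def by auto
  define K1 where "K1 = {(s, t). a \<le> s \<and> s < t \<and> t \<le> b \<and> {s..t} \<subseteq> U \<and> \<beta> * (t - s) < G t - G s}"
  have fine1: "\<exists>s t. (s, t) \<in> K1 \<and> s \<le> x \<and> x \<le> t \<and> t - s < d" if x: "x \<in> ?E" and d: "0 < d" for x d
  proof -
    obtain r where r: "0 < r" "ball x r \<subseteq> U" using U x by (meson open_contains_ball subsetD)
    have "0 < min d r" using d r(1) by simp
    then obtain s t where "a \<le> s" "s < x" "x < t" "t \<le> b" "t - s < min d r" "\<beta> * (t - s) < G t - G s"
      using straddleD[OF IntD2[OF x]] by blast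
    moreover have "{s..t} \<subseteq> ball x r" using calculation by (auto simp: dist_real_def)
    ultimately show ?thesis using r by (intro exI[of _ s] exI[of _ t]) (auto simp: K1_def)
  qed
  have ltK1: "s < t" if "(s, t) \<in> K1" for s t using that by (simp add: K1_def)
  obtain P where P: "disj_ivls P" "P \<subseteq> K1" "measure lebesgue (?E - (\<Union>(s, t)\<in>P. {s<..<t})) < \<eta>"
      "measure lebesgue ?E < (\<Sum>(s, t)\<in>P. t - s) + \<eta>"
    by (rule Vitali_finite_ivls[OF E \<eta>(1) ltK1 fine1])
  define V where "V = (\<Union>(s, t)\<in>P. {s<..<t})"
  have finP: "finite P" using P(1) by (simp add: disj_ivls_def)
  have V: "open V" "V \<in> lmeasurable" unfolding V_def using finP by (auto intro!: fmeasurable.finite_UN)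
  have EV: "?E \<inter> V \<in> lmeasurable" using E V(2) by (simp add: fmeasurable_Int_fmeasurable fmeasurableD)
  have "m \<le> measure lebesgue ((?E - V) \<union> (?E \<inter> V))"
    unfolding m_def by (rule eq_refl) (rule arg_cong[where f = "measure lebesgue"], blast)
  also have "\<dots> \<le> measure lebesgue (?E - V) + measure lebesgue (?E \<inter> V)"
    using E V EV by (intro measure_Un_le) auto
  finally have mEV: "m - \<eta> < measure lebesgue (?E \<inter> V)" using P(3) by (simp add: V_def)
  \<comment> \<open>Each flat interval lies inside a single steep one, so the gaps can be formed
    separately in each member of \<open>P\<close>.\<close>
  define K2 where "K2 = {(u, v). u < v \<and> (\<exists>(s, t)\<in>P. s \<le> u \<and> v \<le> t) \<and> G v - G u < \<alpha> * (v - u)}"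
  have fine2: "\<exists>s t. (s, t) \<in> K2 \<and> s \<le> x \<and> x \<le> t \<and> t - s < d" if x: "x \<in> ?E \<inter> V" and d: "0 < d" for x d
  proof -
    obtain s t where st: "(s, t) \<in> P" "s < x" "x < t" using x unfolding V_def by auto
    define d' where "d' = min d (min (x - s) (t - x))"
    have "0 < d'" using st d by (auto simp: d'_def)
    then obtain u v where "a \<le> u" "u < x" "x < v" "v \<le> b" "v - u < d'" "G v - G u < \<alpha> * (v - u)"
      using straddleD[OF IntD1[OF IntD1[OF x]]] by blast
    then show ?thesis using st by (intro exI[of _ u] exI[of _ v]) (auto simp: K2_def d'_def intro!: bexI[of _ "(s, t)"])
  qed
  have ltK2: "s < t" if "(s, t) \<in> K2" for s t using that by (simp add: K2_def)
  obtain R where R: "disj_ivls R" "R \<subseteq> K2" "measure lebesgue (?E \<inter> V) < (\<Sum>(s, t)\<in>R. t - s) + \<eta>"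
    by (rule Vitali_finite_ivls[OF EV \<eta>(1) ltK2 fine2])
  have finR: "finite R" using R(1) by (simp add: disj_ivls_def)
  define L1 where "L1 = (\<Sum>(s, t)\<in>P. t - s)"
  define L2 where "L2 = (\<Sum>(s, t)\<in>R. t - s)"
  have "L1 \<le> measure lebesgue U"
    unfolding L1_def
  proof (rule disj_ivls_length_le[OF P(1) _ U(3)])
    fix s t assume "(s, t) \<in> P"
    then have "{s..t} \<subseteq> U" using P(2) by (auto simp: K1_def)
    then show "{s<..<t} \<subseteq> U" by (meson greaterThanLessThan_subseteq_atLeastAtMost_iff order_refl subset_trans)
  qed
  then have L: "L1 < m + \<eta>" "m - \<eta> < L1" "m - 2 * \<eta> < L2" using U(4) P(4) R(3) mEV by (auto simp: L1_def L2_def m_def)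
  define Rs where "Rs p = {(u, v)\<in>R. fst p \<le> u \<and> v \<le> snd p}" for p
  have ltP: "s < t" if "(s, t) \<in> P" for s t using that P(1) by (auto simp: disj_ivls_def)
  have ltR: "s < t" if "(s, t) \<in> R" for s t using that R(1) by (auto simp: disj_ivls_def)
  have "\<forall>p\<in>P. \<exists>Q. disj_ivls Q \<and> (\<forall>(u, v)\<in>Q. fst p \<le> u \<and> v \<le> snd p) \<and>
      (\<forall>G::real \<Rightarrow> real. (\<Sum>(u, v)\<in>Rs p. G v - G u) + (\<Sum>(u, v)\<in>Q. G v - G u) = G (snd p) - G (fst p))"
  proof
    fix p assume p: "p \<in> P"
    then have "fst p \<le> snd p" using ltP[of "fst p" "snd p"] by simp
    have dR: "disj_ivls (Rs p)" by (rule disj_ivls_subset[OF R(1)]) (auto simp: Rs_def)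
    show "\<exists>Q. disj_ivls Q \<and> (\<forall>(u, v)\<in>Q. fst p \<le> u \<and> v \<le> snd p) \<and>
      (\<forall>G::real \<Rightarrow> real. (\<Sum>(u, v)\<in>Rs p. G v - G u) + (\<Sum>(u, v)\<in>Q. G v - G u) = G (snd p) - G (fst p))"
      by (rule disj_ivls_gaps[OF dR _ \<open>fst p \<le> snd p\<close>]) (auto simp: Rs_def)
  qed
  from bchoice[OF this] obtain Q where Q0: "\<forall>p\<in>P. disj_ivls (Q p) \<and> (\<forall>(u, v)\<in>Q p. fst p \<le> u \<and> v \<le> snd p) \<and>
      (\<forall>G::real \<Rightarrow> real. (\<Sum>(u, v)\<in>Rs p. G v - G u) + (\<Sum>(u, v)\<in>Q p. G v - G u) = G (snd p) - G (fst p))" ..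
  have Q: "disj_ivls (Q p)" "(u, v) \<in> Q p \<Longrightarrow> fst p \<le> u \<and> v \<le> snd p"
    "(\<Sum>(u, v)\<in>Rs p. H v - H u) + (\<Sum>(u, v)\<in>Q p. H v - H u) = H (snd p) - H (fst p)"
    if "p \<in> P" for p u v and H :: "real \<Rightarrow> real"
    using bspec[OF Q0 that] by auto
  have ltQ: "u < v" if "(u, v) \<in> Q p" "p \<in> P" for u v p using Q(1)[OF that(2)] that(1) by (auto simp: disj_ivls_def)
  have finQ: "finite (Q p)" if "p \<in> P" for p using Q(1)[OF that] by (simp add: disj_ivls_def)
  have sep: "snd r \<le> fst p \<or> snd p \<le> fst r" if "p \<in> P" "r \<in> P" "p \<noteq> r" for p r
    using disj_ivls_separated[OF P(1), of "fst p" "snd p" "fst r" "snd r"] that by auto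
  define QQ where "QQ = (\<Union>p\<in>P. Q p)"
  have QQ: "disj_ivls QQ"
  proof (rule disj_ivlsI)
    show "finite QQ" using finP finQ by (auto simp: QQ_def)
    show "s < t" if "(s, t) \<in> QQ" for s t using that ltQ by (auto simp: QQ_def)
    show "v' \<le> u \<or> v \<le> u'" if uv: "(u, v) \<in> QQ" "(u', v') \<in> QQ" "(u, v) \<noteq> (u', v')" for u v u' v'
    proof -
      obtain p r where pr: "p \<in> P" "(u, v) \<in> Q p" "r \<in> P" "(u', v') \<in> Q r" using uv by (auto simp: QQ_def)
      show ?thesis
      proof (cases "p = r")
        case True
        then show ?thesis using disj_ivls_separated[OF Q(1)[OF pr(1)] pr(2), of u' v'] pr uv(3) by simp
      next
        case False
        then show ?thesis using sep[OF pr(1,3)] Q(2)[OF pr(1,2)] Q(2)[OF pr(3,4)] by linarith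
      qed
    qed
  qed
  have sumQQ: "(\<Sum>(u, v)\<in>QQ. H v - H u) = (\<Sum>p\<in>P. \<Sum>(u, v)\<in>Q p. H v - H u)" for H :: "real \<Rightarrow> real"
    unfolding QQ_def
  proof (rule sum.UNION_disjoint[OF finP])
    show "\<forall>p\<in>P. finite (Q p)" using finQ by blast
    show "\<forall>p\<in>P. \<forall>r\<in>P. p \<noteq> r \<longrightarrow> Q p \<inter> Q r = {}"
    proof (intro ballI impI, rule ccontr)
      fix p r assume pr: "p \<in> P" "r \<in> P" "p \<noteq> r" "Q p \<inter> Q r \<noteq> {}"
      then obtain u v where uv: "(u, v) \<in> Q p" "(u, v) \<in> Q r" by auto
      show False using sep[OF pr(1-3)] Q(2)[OF pr(1) uv(1)] Q(2)[OF pr(2) uv(2)] ltQ[OF uv(1) pr(1)] by linarith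
    qed
  qed
  have sumR: "(\<Sum>(u, v)\<in>R. H v - H u) = (\<Sum>p\<in>P. \<Sum>(u, v)\<in>Rs p. H v - H u)" for H :: "real \<Rightarrow> real"
  proof -
    have "q \<in> (\<Union>p\<in>P. Rs p)" if q: "q \<in> R" for q
    proof -
      obtain u v where [simp]: "q = (u, v)" by force
      have "(u, v) \<in> K2" using R(2) q by auto
      then obtain p where "p \<in> P" "fst p \<le> u" "v \<le> snd p" unfolding K2_def by auto
      then show ?thesis using q by (auto simp: Rs_def)
    qed
    then have "R = (\<Union>p\<in>P. Rs p)" by (auto simp: Rs_def)
    moreover have "(\<Sum>(u, v)\<in>(\<Union>p\<in>P. Rs p). H v - H u) = (\<Sum>p\<in>P. \<Sum>(u, v)\<in>Rs p. H v - H u)"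
    proof (rule sum.UNION_disjoint[OF finP])
      have "Rs p \<subseteq> R" for p by (auto simp: Rs_def)
      then show "\<forall>p\<in>P. finite (Rs p)" using finR by (meson finite_subset)
      show "\<forall>p\<in>P. \<forall>r\<in>P. p \<noteq> r \<longrightarrow> Rs p \<inter> Rs r = {}"
      proof (intro ballI impI, rule ccontr)
        fix p r assume pr: "p \<in> P" "r \<in> P" "p \<noteq> r" "Rs p \<inter> Rs r \<noteq> {}"
        then obtain u v where uv: "(u, v) \<in> R" "fst p \<le> u" "v \<le> snd p" "fst r \<le> u" "v \<le> snd r" by (auto simp: Rs_def)
        show False using sep[OF pr(1-3)] uv ltR[OF uv(1)] by linarith
      qed
    qed
    ultimately show ?thesis by simp
  qed
  \<comment> \<open>With \<open>H\<close> the identity this gives the total length of the gaps, with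
    \<open>H = G\<close> it confronts the two families of slopes.\<close>
  have additive: "(\<Sum>(s, t)\<in>P. H t - H s) = (\<Sum>(u, v)\<in>R. H v - H u) + (\<Sum>(u, v)\<in>QQ. H v - H u)" for H :: "real \<Rightarrow> real"
    unfolding sumR sumQQ sum.distrib[symmetric] using Q(3) by (intro sum.cong) (auto simp: split_def)
  have "(\<Sum>(u, v)\<in>QQ. v - u) = L1 - L2" using additive[of "\<lambda>x. x"] by (simp add: L1_def L2_def)
  then have "(\<Sum>(u, v)\<in>QQ. v - u) < \<delta>" using L \<eta>(2) by linarith
  moreover have "a \<le> s \<and> t \<le> b" if "(s, t) \<in> QQ" for s t
  proof -
    obtain p where p: "p \<in> P" "(s, t) \<in> Q p" using \<open>(s, t) \<in> QQ\<close> by (auto simp: QQ_def)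
    then have "p \<in> K1" using P(2) by blast
    then show ?thesis using Q(2)[OF p] by (auto simp: K1_def)
  qed
  ultimately have "(\<Sum>(s, t)\<in>QQ. norm (complex_of_real (G t) - complex_of_real (G s))) < e"
    using \<delta>(2)[OF QQ] by blast
  moreover have "(\<Sum>(u, v)\<in>QQ. G v - G u) \<le> (\<Sum>(s, t)\<in>QQ. norm (complex_of_real (G t) - complex_of_real (G s)))"
    by (rule sum_mono) (auto simp flip: of_real_diff)
  moreover have "(\<Sum>(u, v)\<in>R. G v - G u) \<le> (\<Sum>q\<in>R. \<alpha> * (case q of (u, v) \<Rightarrow> v - u))"
    using R(2) by (intro sum_mono) (auto simp: K2_def)
  moreover have "(\<Sum>q\<in>P. \<beta> * (case q of (u, v) \<Rightarrow> v - u)) \<le> (\<Sum>(u, v)\<in>P. G v - G u)"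
    using P(2) by (intro sum_mono) (auto simp: K1_def)
  ultimately have main: "\<beta> * L1 < \<alpha> * L2 + e"
    using additive[of G] by (simp add: sum_distrib_left[symmetric] L1_def L2_def)
  have "0 \<le> (\<Sum>(u, v)\<in>QQ. v - u)" using QQ by (intro sum_nonneg) (auto simp: disj_ivls_def)
  then have "L2 \<le> L1" using \<open>(\<Sum>(u, v)\<in>QQ. v - u) = L1 - L2\<close> by linarith
  have "\<bar>\<alpha> * (L1 - L2)\<bar> \<le> \<bar>\<alpha>\<bar> * (3 * \<eta>)"
    unfolding abs_mult using L \<open>L2 \<le> L1\<close> by (intro mult_left_mono) auto
  moreover have "(\<beta> - \<alpha>) * (m - \<eta>) \<le> (\<beta> - \<alpha>) * L1" using ab L by (intro mult_left_mono) auto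
  ultimately have "(\<beta> - \<alpha>) * m - M * \<eta> \<le> \<beta> * L1 - \<alpha> * L2" by (simp add: M_def algebra_simps)
  then have "(\<beta> - \<alpha>) * m < e + e / 2" using main \<eta>(3) by linarith
  then show False using m ab e by (simp add: e_def)
qed

text \<open>\<open>L\<close> is the supremum of the eventual lower bounds of the slopes over
  intervals straddling \<open>x\<close>. Slopes do not keep returning both below
  \<open>\<alpha>\<close> and above \<open>\<beta>\<close> for any rationals
  \<open>\<alpha> < \<beta>\<close>, so they converge to \<open>L\<close>. By continuity of
  \<open>G\<close> one end point may then tend to \<open>x\<close>, which turns straddling slopes
  into difference quotients.\<close>

lemma straddle_slopes_converge:
  fixes G :: "real \<Rightarrow> real"
  assumes x: "a < x" "x < b" and cont: "continuous_on {a..b} G"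
    and bdd: "x \<notin> straddle a b (\<lambda>s t. real k * (t - s) < \<bar>G t - G s\<bar>)"
    and gap: "\<And>\<alpha> \<beta>. \<alpha> \<in> \<rat> \<Longrightarrow> \<beta> \<in> \<rat> \<Longrightarrow> \<alpha> < \<beta> \<Longrightarrow>
      x \<notin> straddle a b (\<lambda>s t. G t - G s < \<alpha> * (t - s)) \<inter> straddle a b (\<lambda>s t. \<beta> * (t - s) < G t - G s)"
  shows "\<exists>L. (G has_vector_derivative L) (at x within {a..b})"
proof -
  define str where "str d s t \<longleftrightarrow> a \<le> s \<and> s < x \<and> x < t \<and> t \<le> b \<and> t - s < d" for d s t
  obtain d0 where d0: "d0 > 0" "\<And>s t. str d0 s t \<Longrightarrow> \<bar>G t - G s\<bar> \<le> real k * (t - s)"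
  proof -
    have "\<not> (\<forall>d>0. \<exists>s t. str d s t \<and> real k * (t - s) < \<bar>G t - G s\<bar>)"
      using bdd unfolding straddle_def str_def by simp
    then show ?thesis using that by (meson not_less)
  qed
  define A where "A = {r. \<exists>d>0. \<forall>s t. str d s t \<longrightarrow> r * (t - s) \<le> G t - G s}"
  have str_ex: "\<exists>s t. str d s t" if "0 < d" for d
  proof -
    define h where "h = min (d / 3) (min (x - a) (b - x))"
    have "h > 0" "h \<le> d / 3" "h \<le> x - a" "h \<le> b - x" using x that by (auto simp: h_def min_def)
    then show ?thesis using that by (intro exI[of _ "x - h"] exI[of _ "x + h"]) (auto simp: str_def)
  qed
  have str_mono: "str d s t \<Longrightarrow> d \<le> d' \<Longrightarrow> str d' s t" for d d' s t by (auto simp: str_def)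
  have "- real k \<in> A" unfolding A_def using d0 by (auto intro!: exI[of _ d0]) (smt (verit))
  have Abdd: "r \<le> k" if "r \<in> A" for r
  proof -
    obtain d where d: "d > 0" "\<And>s t. str d s t \<Longrightarrow> r * (t - s) \<le> G t - G s" using \<open>r \<in> A\<close> by (auto simp: A_def)
    obtain s t where st: "str (min d d0) s t" using str_ex d d0 by (metis min_less_iff_conj)
    then have "r * (t - s) \<le> real k * (t - s)" using d(2)[of s t] d0(2)[of s t] str_mono by (smt (verit) min.cobounded1 min.cobounded2)
    moreover have "0 < t - s" using st by (auto simp: str_def)
    ultimately show ?thesis by simp
  qed
  have bddA: "bdd_above A" using Abdd by (auto intro!: bdd_aboveI)
  define L where "L = Sup A"
  have approx: "\<exists>d>0. \<forall>s t. str d s t \<longrightarrow> \<bar>G t - G s - L * (t - s)\<bar> \<le> e * (t - s)" if e: "0 < e" for e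
  proof -
    obtain r where r: "r \<in> A" "L - e < r" using less_cSupD[of A "L - e"] \<open>- real k \<in> A\<close> e by (auto simp: L_def)
    then obtain d1 where d1: "d1 > 0" "\<And>s t. str d1 s t \<Longrightarrow> r * (t - s) \<le> G t - G s" by (auto simp: A_def)
    \<comment> \<open>\<open>\<alpha>\<close> exceeds the supremum, so slopes below
      \<open>\<alpha>\<close> recur on short intervals; the gap hypothesis then excludes slopes
      above \<open>\<beta>\<close> on all sufficiently short ones.\<close>
    obtain \<alpha> where \<alpha>: "\<alpha> \<in> \<rat>" "L < \<alpha>" "\<alpha> < L + e" using Rats_dense_in_real[of L "L + e"] e by auto
    obtain \<beta> where \<beta>: "\<beta> \<in> \<rat>" "\<alpha> < \<beta>" "\<beta> < L + e" using Rats_dense_in_real[of \<alpha> "L + e"] \<alpha> by auto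
    have "\<alpha> \<notin> A" using \<alpha>(2) cSup_upper[OF _ bddA] by (force simp: L_def)
    then have "x \<in> straddle a b (\<lambda>s t. G t - G s < \<alpha> * (t - s))"
    proof -
      have "\<forall>d>0. \<exists>s t. str d s t \<and> G t - G s < \<alpha> * (t - s)"
        using \<open>\<alpha> \<notin> A\<close> unfolding A_def by (simp add: not_le)
      then show ?thesis unfolding straddle_def str_def by simp
    qed
    then have "x \<notin> straddle a b (\<lambda>s t. \<beta> * (t - s) < G t - G s)" using gap[OF \<alpha>(1) \<beta>(1,2)] by blast
    then obtain d2 where d2: "d2 > 0" "\<And>s t. str d2 s t \<Longrightarrow> G t - G s \<le> \<beta> * (t - s)"
    proof -
      have "\<not> (\<forall>d>0. \<exists>s t. str d s t \<and> \<beta> * (t - s) < G t - G s)"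
        using \<open>x \<notin> straddle a b (\<lambda>s t. \<beta> * (t - s) < G t - G s)\<close> unfolding straddle_def str_def by simp
      then show ?thesis using that by (meson not_less)
    qed
    show ?thesis
    proof (intro exI[of _ "min d1 d2"] conjI allI impI)
      show "0 < min d1 d2" using d1 d2 by simp
      fix s t assume st: "str (min d1 d2) s t"
      have "r * (t - s) \<le> G t - G s" "G t - G s \<le> \<beta> * (t - s)"
        using d1(2) d2(2) str_mono[OF st] by simp_all
      moreover have "0 < t - s" using st by (auto simp: str_def)
      then have "(L - e) * (t - s) \<le> r * (t - s)" "\<beta> * (t - s) \<le> (L + e) * (t - s)" using r \<beta> by (auto intro!: mult_right_mono)
      ultimately show "\<bar>G t - G s - L * (t - s)\<bar> \<le> e * (t - s)" by (simp add: algebra_simps abs_le_iff)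
    qed
  qed
  have contx: "(G \<longlongrightarrow> G x) (at x)"
    using continuous_on_interior[OF cont, of x] x by (simp add: isCont_def interior_atLeastAtMost_real)
  have "(G has_derivative (\<lambda>h. h *\<^sub>R L)) (at x within {a..b})"
    unfolding has_derivative_within_alt
  proof (intro conjI allI impI)
    show "bounded_linear (\<lambda>h. h *\<^sub>R L)" by (rule bounded_linear_scaleR_left)
    fix e :: real assume e: "0 < e"
    obtain d where d: "d > 0" "\<And>s t. str d s t \<Longrightarrow> \<bar>G t - G s - L * (t - s)\<bar> \<le> e * (t - s)" using approx[OF e] by blast
    show "\<exists>d>0. \<forall>y\<in>{a..b}. norm (y - x) < d \<longrightarrow> norm (G y - G x - (y - x) *\<^sub>R L) \<le> e * norm (y - x)"
    proof (intro exI[of _ d] conjI ballI impI d(1))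
      fix y assume y: "y \<in> {a..b}" "norm (y - x) < d"
      consider "y = x" | "x < y" | "y < x" by linarith
      then show "norm (G y - G x - (y - x) *\<^sub>R L) \<le> e * norm (y - x)"
      proof cases
        case 2
        have "((\<lambda>s. \<bar>G y - G s - L * (y - s)\<bar>) \<longlongrightarrow> \<bar>G y - G x - L * (y - x)\<bar>) (at_left x)"
          by (intro tendsto_intros tendsto_within_subset[OF contx]) auto
        moreover have "((\<lambda>s. e * (y - s)) \<longlongrightarrow> e * (y - x)) (at_left x)" by (intro tendsto_intros)
        moreover have "eventually (\<lambda>s. s \<in> {max a (y - d)<..<x}) (at_left x)"
          by (rule eventually_at_left_real) (use x y 2 in auto)
        then have "eventually (\<lambda>s. \<bar>G y - G s - L * (y - s)\<bar> \<le> e * (y - s)) (at_left x)"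
          by eventually_elim (rule d(2), use y 2 in \<open>auto simp: str_def\<close>)
        ultimately have "\<bar>G y - G x - L * (y - x)\<bar> \<le> e * (y - x)"
          by (intro tendsto_le[of "at_left x"]) auto
        then show ?thesis using 2 by (simp add: mult.commute)
      next
        case 3
        have "((\<lambda>t. \<bar>G t - G y - L * (t - y)\<bar>) \<longlongrightarrow> \<bar>G x - G y - L * (x - y)\<bar>) (at_right x)"
          by (intro tendsto_intros tendsto_within_subset[OF contx]) auto
        moreover have "((\<lambda>t. e * (t - y)) \<longlongrightarrow> e * (x - y)) (at_right x)" by (intro tendsto_intros)
        moreover have "eventually (\<lambda>t. t \<in> {x<..<min b (y + d)}) (at_right x)"
          by (rule eventually_at_right_real) (use x y 3 in auto)
        then have "eventually (\<lambda>t. \<bar>G t - G y - L * (t - y)\<bar> \<le> e * (t - y)) (at_right x)"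
          by eventually_elim (rule d(2), use y 3 in \<open>auto simp: str_def\<close>)
        ultimately have "\<bar>G x - G y - L * (x - y)\<bar> \<le> e * (x - y)"
          by (intro tendsto_le[of "at_right x"]) auto
        then show ?thesis using 3 by (simp add: algebra_simps abs_if split: if_splits)
      qed auto
    qed
  qed
  then show ?thesis unfolding has_vector_derivative_def by blast
qed

lemma abs_cont_on_real_differentiable_AE:
  fixes G :: "real \<Rightarrow> real"
  assumes G: "abs_cont_on a b (\<lambda>x. complex_of_real (G x))"
  obtains N where "negligible N" "\<And>x. x \<in> {a..b} - N \<Longrightarrow> \<exists>L. (G has_vector_derivative L) (at x within {a..b})"
proof -
  define E1 where "E1 = (\<Inter>k::nat. straddle a b (\<lambda>s t. k * (t - s) < \<bar>G t - G s\<bar>))"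
  define E2 where "E2 p = straddle a b (\<lambda>s t. G t - G s < fst p * (t - s)) \<inter> straddle a b (\<lambda>s t. snd p * (t - s) < G t - G s)" for p
  define I where "I = {p \<in> \<rat> \<times> \<rat>. fst p < (snd p :: real)}"
  have "countable I" unfolding I_def using countable_rat by (auto intro: countable_subset[OF _ countable_SIGMA])
  then have "negligible (\<Union>p\<in>I. E2 p)"
    using straddle_gap_negligible[OF G] by (intro negligible_countable_Union) (auto simp: I_def E2_def)
  \<comment> \<open>The end points join the exceptional set because no interval inside
    \<open>{a..b}\<close> straddles them.\<close>
  then have neg: "negligible (E1 \<union> (\<Union>p\<in>I. E2 p) \<union> {a, b})"
    using straddle_unbounded_negligible[OF G] by (auto simp: E1_def intro!: negligible_Un)
  have cont: "continuous_on {a..b} G"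
    using continuous_on_Re[OF abs_cont_on_continuous[OF G]] by simp
  show thesis
  proof (rule that[OF neg])
    fix x assume x: "x \<in> {a..b} - (E1 \<union> (\<Union>p\<in>I. E2 p) \<union> {a, b})"
    then obtain k :: nat where k: "x \<notin> straddle a b (\<lambda>s t. real k * (t - s) < \<bar>G t - G s\<bar>)" by (auto simp: E1_def)
    show "\<exists>L. (G has_vector_derivative L) (at x within {a..b})"
    proof (rule straddle_slopes_converge[OF _ _ cont k])
      show "a < x" "x < b" using x by auto
      fix \<alpha> \<beta> :: real assume "\<alpha> \<in> \<rat>" "\<beta> \<in> \<rat>" "\<alpha> < \<beta>"
      then have "(\<alpha>, \<beta>) \<in> I" by (simp add: I_def)
      then show "x \<notin> straddle a b (\<lambda>s t. G t - G s < \<alpha> * (t - s)) \<inter> straddle a b (\<lambda>s t. \<beta> * (t - s) < G t - G s)"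
        using x by (auto simp: E2_def)
    qed
  qed
qed

lemma abs_cont_on_differentiable_AE:
  fixes F :: "real \<Rightarrow> complex"
  assumes F: "abs_cont_on a b F"
  obtains N where "negligible N" "\<And>x. x \<in> {a..b} - N \<Longrightarrow> \<exists>L. (F has_vector_derivative L) (at x within {a..b})"
proof -
  have re: "abs_cont_on a b (\<lambda>x. complex_of_real (Re (F x)))"
    by (rule abs_cont_on_dominated[OF F]) (metis abs_Re_le_cmod minus_complex.sel(1) norm_of_real of_real_diff)
  obtain N1 where N1: "negligible N1" "\<And>x. x \<in> {a..b} - N1 \<Longrightarrow> \<exists>L. ((\<lambda>x. Re (F x)) has_vector_derivative L) (at x within {a..b})"
    by (rule abs_cont_on_real_differentiable_AE[OF re]) blast
  have im: "abs_cont_on a b (\<lambda>x. complex_of_real (Im (F x)))"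
    by (rule abs_cont_on_dominated[OF F]) (metis abs_Im_le_cmod minus_complex.sel(2) norm_of_real of_real_diff)
  obtain N2 where N2: "negligible N2" "\<And>x. x \<in> {a..b} - N2 \<Longrightarrow> \<exists>L. ((\<lambda>x. Im (F x)) has_vector_derivative L) (at x within {a..b})"
    by (rule abs_cont_on_real_differentiable_AE[OF im]) blast
  show thesis
  proof (rule that[of "N1 \<union> N2"])
    show "negligible (N1 \<union> N2)" using N1(1) N2(1) by (rule negligible_Un)
    fix x assume "x \<in> {a..b} - (N1 \<union> N2)"
    then obtain p q where "((\<lambda>x. Re (F x)) has_vector_derivative p) (at x within {a..b})" "((\<lambda>x. Im (F x)) has_vector_derivative q) (at x within {a..b})"
      using N1(2)[of x] N2(2)[of x] by blast
    then have "((\<lambda>x. complex_of_real (Re (F x)) + \<i> * complex_of_real (Im (F x))) has_vector_derivative (complex_of_real p + \<i> * complex_of_real q)) (at x within {a..b})"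
      by (intro has_vector_derivative_add has_vector_derivative_mult_right has_vector_derivative_of_real)
        (simp_all add: has_real_derivative_iff_has_vector_derivative)
    then show "\<exists>L. (F has_vector_derivative L) (at x within {a..b})" by (auto simp flip: complex_eq)
  qed
qed

section \<open>Indefinite integrals\<close>

text \<open>The modulus of \<open>f\<close> is at most \<open>n\<close> plus its excess
  \<open>h n\<close> over \<open>n\<close>. The excess has small total integral for large
  \<open>n\<close> by dominated convergence, and the bounded part contributes at most
  \<open>n\<close> times the total length.\<close>

lemma abs_cont_on_integral:
  fixes f :: "real \<Rightarrow> complex"
  assumes f: "f absolutely_integrable_on {a..b}" and ab: "a \<le> b"
  shows "abs_cont_on a b (\<lambda>x. integral {a..x} f)"
proof (rule abs_cont_onI)
  fix e :: real assume e: "0 < e"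
  define h where "h n x = max (norm (f x) - real n) 0" for n x
  have fi: "f integrable_on {a..b}" and nf: "(\<lambda>x. norm (f x)) integrable_on {a..b}"
    using f by (auto simp: absolutely_integrable_on_def)
  have h_int: "h n integrable_on {a..b}" for n
  proof -
    have "(\<lambda>x. norm (f x) - real n) absolutely_integrable_on {a..b}"
      using absolutely_integrable_norm[OF f] by (intro set_integral_diff) (auto simp: o_def intro: absolutely_integrable_continuous_real)
    then have "(\<lambda>x. max (norm (f x) - real n) 0) absolutely_integrable_on {a..b}"
      by (intro absolutely_integrable_max_1) (auto intro: absolutely_integrable_continuous_real)
    then show ?thesis unfolding h_def by (simp add: absolutely_integrable_on_def)
  qed
  have "(\<lambda>n. integral {a..b} (h n)) \<longlonglongrightarrow> integral {a..b} (\<lambda>x. 0::real)"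
  proof (rule dominated_convergence(2)[OF h_int nf])
    show "norm (h n x) \<le> norm (f x)" for n x by (simp add: h_def)
    show "(\<lambda>n. h n x) \<longlonglongrightarrow> 0" for x
    proof (rule tendsto_eventually)
      obtain m where "norm (f x) < real m" using reals_Archimedean2 by blast
      then show "\<forall>\<^sub>F n in sequentially. h n x = 0"
        by (intro eventually_sequentiallyI[of m]) (auto simp: h_def)
    qed
  qed
  then have "eventually (\<lambda>n. integral {a..b} (h n) < e / 2) sequentially"
    using e by (intro order_tendstoD(2)[where y = 0]) auto
  then obtain n where n: "integral {a..b} (h n) < e / 2" by (meson eventually_sequentially order_refl)
  have sub: "g integrable_on {s..t}" if "g integrable_on {a..b}" "a \<le> s" "t \<le> b" for s t and g :: "real \<Rightarrow> 'z::banach"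
    by (rule integrable_on_subinterval[OF that(1)]) (use that in auto)
  have diff: "integral {a..t} g - integral {a..s} g = integral {s..t} g"
    if "g integrable_on {a..b}" "a \<le> s" "s \<le> t" "t \<le> b" for s t and g :: "real \<Rightarrow> 'z::banach"
    using Henstock_Kurzweil_Integration.integral_combine[OF that(2,3) sub[OF that(1) order_refl that(4)]] by (simp add: algebra_simps)
  define d where "d = e / (2 * (real n + 1))"
  have "0 < d" using e by (simp add: d_def)
  have "(\<Sum>(s, t)\<in>P. norm (integral {a..t} f - integral {a..s} f)) < e"
    if P: "disj_ivls P" "\<forall>(s, t)\<in>P. a \<le> s \<and> t \<le> b" "(\<Sum>(s, t)\<in>P. t - s) < d" for P
  proof -
    define H where "H x = integral {a..x} (h n)" for x
    have Pb: "a \<le> s \<and> s < t \<and> t \<le> b" if "(s, t) \<in> P" for s t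
      using P that by (auto simp: disj_ivls_def)
    \<comment> \<open>\<open>H\<close> does not decrease over the gaps either, so its increments
      over \<open>P\<close> cannot exceed the total integral of the excess.\<close>
    obtain Q where Q: "disj_ivls Q" "\<And>s t. (s, t) \<in> Q \<Longrightarrow> a \<le> s \<and> t \<le> b"
      "\<And>G :: real \<Rightarrow> real. (\<Sum>(s, t)\<in>P. G t - G s) + (\<Sum>(s, t)\<in>Q. G t - G s) = G b - G a"
      using disj_ivls_gaps[OF P(1) _ ab] P(2) by blast
    have "0 \<le> (\<Sum>(s, t)\<in>Q. H t - H s)"
    proof (rule sum_nonneg)
      fix q assume q: "q \<in> Q"
      obtain s t where [simp]: "q = (s, t)" by force
      have st: "a \<le> s" "s < t" "t \<le> b" using Q(1) Q(2)[of s t] q by (auto simp: disj_ivls_def)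
      have "0 \<le> integral {s..t} (h n)" using sub[OF h_int] st by (intro integral_nonneg) (auto simp: h_def)
      then show "0 \<le> (case q of (s, t) \<Rightarrow> H t - H s)"
        using diff[OF h_int, of s t] st by (simp add: H_def)
    qed
    moreover have "H b - H a = integral {a..b} (h n)" by (simp add: H_def)
    ultimately have PH: "(\<Sum>(s, t)\<in>P. H t - H s) < e / 2" using Q(3)[of H] n by linarith
    have "(\<Sum>(s, t)\<in>P. norm (integral {a..t} f - integral {a..s} f))
        \<le> (\<Sum>p\<in>P. real n * (case p of (s, t) \<Rightarrow> t - s) + (case p of (s, t) \<Rightarrow> H t - H s))"
    proof (rule sum_mono)
      fix p assume p: "p \<in> P"
      obtain s t where [simp]: "p = (s, t)" by force
      have st: "a \<le> s" "s < t" "t \<le> b" using Pb[of s t] p by auto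
      have "norm (integral {s..t} f) \<le> integral {s..t} (\<lambda>x. real n + h n x)"
      proof (rule integral_norm_bound_integral)
        show "f integrable_on {s..t}" using sub[OF fi st(1,3)] .
        show "(\<lambda>x. real n + h n x) integrable_on {s..t}"
          by (intro integrable_add integrable_const_ivl sub[OF h_int st(1,3)])
        show "norm (f x) \<le> real n + h n x" for x by (simp add: h_def)
      qed
      also have "\<dots> = real n * (t - s) + integral {s..t} (h n)"
        using sub[OF h_int st(1,3), of n] st by (subst integral_add) auto
      finally show "(case p of (s, t) \<Rightarrow> norm (integral {a..t} f - integral {a..s} f))
          \<le> real n * (case p of (s, t) \<Rightarrow> t - s) + (case p of (s, t) \<Rightarrow> H t - H s)"
        using diff[OF fi, of s t] diff[OF h_int, of s t n] st by (simp add: H_def)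
    qed
    also have "\<dots> = real n * (\<Sum>(s, t)\<in>P. t - s) + (\<Sum>(s, t)\<in>P. H t - H s)"
      by (simp add: sum.distrib sum_distrib_left)
    also have "\<dots> < real n * d + e / 2"
      using PH P(3) by (intro add_le_less_mono mult_left_mono) auto
    also have "\<dots> \<le> e" using e by (simp add: d_def field_simps)
    finally show ?thesis .
  qed
  then show "\<exists>d>0. \<forall>P. disj_ivls P \<and> (\<forall>(s, t)\<in>P. a \<le> s \<and> t \<le> b) \<and> (\<Sum>(s, t)\<in>P. t - s) < d
      \<longrightarrow> (\<Sum>(s, t)\<in>P. norm (integral {a..t} f - integral {a..s} f)) < e"
    using \<open>0 < d\<close> by blast
qed

text \<open>Differentiability almost everywhere comes from absolute continuity; the value of the derivative
  is then identified by the one-sided differentiation theorem of the library.\<close>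

lemma integral_has_vector_derivative_AE:
  fixes f :: "real \<Rightarrow> complex"
  assumes f: "f absolutely_integrable_on {a..b}" and ab: "a < b"
  obtains N where "negligible N"
    "\<And>x. x \<in> {a..b} - N \<Longrightarrow> ((\<lambda>x. integral {a..x} f) has_vector_derivative f x) (at x within {a..b})"
proof -
  define F where "F x = integral {a..x} f" for x
  obtain N1 where N1: "negligible N1" "\<And>x. x \<in> {a..b} - N1 \<Longrightarrow> \<exists>L. (F has_vector_derivative L) (at x within {a..b})"
    using abs_cont_on_differentiable_AE[OF abs_cont_on_integral[OF f less_imp_le[OF ab]]] unfolding F_def by blast
  define g where "g x = (if x \<in> {a..b} then f x else 0)" for x
  have fi: "f integrable_on {a..b}" using f by (simp add: absolutely_integrable_on_def)
  have "g integrable_on cbox c d" for c d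
  proof -
    have "g integrable_on UNIV" unfolding g_def using fi by (simp only: integrable_restrict_UNIV)
    then show ?thesis using integrable_on_subcbox by blast
  qed
  then obtain N2 where N2: "negligible N2"
       "\<And>x e. \<lbrakk>x \<notin> N2; 0 < e\<rbrakk> \<Longrightarrow>
               \<exists>d>0. \<forall>h. 0 < h \<and> h < d \<longrightarrow>
                         norm(integral (cbox x (x + h *\<^sub>R One)) g /\<^sub>R h ^ DIM(real) - g x) < e"
    using integrable_ccontinuous_explicit[of g] by metis
  show thesis
  \<comment> \<open>\<open>b\<close> is exceptional because the averages are taken over intervals to
    the right of the point.\<close>
  proof (rule that[of "N1 \<union> N2 \<union> {b}"])
    show "negligible (N1 \<union> N2 \<union> {b})" using N1 N2 by (auto intro!: negligible_Un)
    fix x assume x: "x \<in> {a..b} - (N1 \<union> N2 \<union> {b})"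
    then obtain L where L: "(F has_vector_derivative L) (at x within {a..b})" using N1(2) by blast
    have xb: "a \<le> x" "x < b" "x \<notin> N2" using x by auto
    have diff: "F (x + h) - F x = integral {x..x+h} g" if "0 < h" "x + h \<le> b" for h
    proof -
      have "F (x + h) = F x + integral {x..x+h} f"
        unfolding F_def using xb that
        by (intro Henstock_Kurzweil_Integration.integral_combine[symmetric] integrable_on_subinterval[OF fi]) auto
      moreover have "integral {x..x+h} f = integral {x..x+h} g"
        using xb that by (intro integral_cong) (auto simp: g_def)
      ultimately show ?thesis by simp
    qed
    have "L = f x"
    proof (rule ccontr)
      assume "L \<noteq> f x"
      define e where "e = norm (L - f x) / 2"
      have e: "0 < e" using \<open>L \<noteq> f x\<close> by (simp add: e_def)
      obtain d1 where d1: "d1 > 0" "\<And>y. y \<in> {a..b} \<Longrightarrow> norm (y - x) < d1 \<Longrightarrow> norm (F y - F x - (y - x) *\<^sub>R L) \<le> e * norm (y - x)"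
        using L e unfolding has_vector_derivative_def has_derivative_within_alt by blast
      obtain d2 where d2: "d2 > 0" "\<And>h. 0 < h \<Longrightarrow> h < d2 \<Longrightarrow> norm (integral (cbox x (x + h *\<^sub>R One)) g /\<^sub>R h ^ DIM(real) - g x) < e"
        using N2(2)[OF xb(3) e] by blast
      define h where "h = min (min d1 d2 / 2) (b - x)"
      have h: "0 < h" "h < d1" "h < d2" "x + h \<le> b" using d1 d2 xb by (auto simp: h_def)
      define D where "D = F (x + h) - F x"
      have "norm (D - h *\<^sub>R L) \<le> e * h" using d1(2)[of "x + h"] h xb by (simp add: D_def)
      moreover have "norm (D /\<^sub>R h - f x) < e"
        using d2(2)[OF h(1,3)] diff[OF h(1,4)] xb by (simp add: D_def g_def)
      moreover have "D - h *\<^sub>R f x = h *\<^sub>R (D /\<^sub>R h - f x)" using h by (simp add: scaleR_diff_right)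
      ultimately have "norm (D - h *\<^sub>R L) \<le> e * h" "norm (D - h *\<^sub>R f x) < h * e"
        using h by auto
      then have "norm ((D - h *\<^sub>R f x) - (D - h *\<^sub>R L)) < h * e + e * h"
        using norm_triangle_ineq4[of "D - h *\<^sub>R f x" "D - h *\<^sub>R L"] by linarith
      also have "(D - h *\<^sub>R f x) - (D - h *\<^sub>R L) = h *\<^sub>R (L - f x)" by (simp add: algebra_simps)
      finally show False using h by (simp add: e_def)
    qed
    then show "((\<lambda>x. integral {a..x} f) has_vector_derivative f x) (at x within {a..b})" using L by (simp add: F_def[abs_def])
  qed
qed

section \<open>The spaces of integrable functions\<close>

lemma Lp_fun_1_iff: "f \<in> Lp_fun 1 \<longleftrightarrow> f absolutely_integrable_on {0..pi}"
proof -
  have "(norm \<circ> f) = (\<lambda>x. norm (f x))" by auto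
  then show ?thesis by (subst absolutely_integrable_measurable) (simp_all add: Lp_fun_def)
qed

lemma AE_lebesgue_on_iff_negligible:
  assumes "S \<in> sets lebesgue"
  shows "(AE x in lebesgue_on S. P x) \<longleftrightarrow> (\<exists>N. negligible N \<and> (\<forall>x\<in>S - N. P x))"
proof
  assume "AE x in lebesgue_on S. P x"
  then have "AE x in lebesgue. x \<in> S \<longrightarrow> P x" using assms by (subst (asm) AE_restrict_space_iff) auto
  then obtain N where "N \<in> null_sets lebesgue" "{x. \<not> (x \<in> S \<longrightarrow> P x)} \<subseteq> N"
    by (auto simp: eventually_ae_filter)
  then show "\<exists>N. negligible N \<and> (\<forall>x\<in>S - N. P x)" by (auto simp: negligible_iff_null_sets)
next
  assume "\<exists>N. negligible N \<and> (\<forall>x\<in>S - N. P x)"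
  then obtain N where N: "N \<in> null_sets lebesgue" "\<And>x. x \<in> S - N \<Longrightarrow> P x" by (auto simp: negligible_iff_null_sets)
  have "AE x in lebesgue. x \<in> S \<longrightarrow> P x" by (rule AE_I'[OF N(1)]) (use N(2) in auto)
  then show "AE x in lebesgue_on S. P x" using assms by (subst AE_restrict_space_iff) auto
qed

text \<open>Measurability of \<open>g\<close> is obtained from absolute integrability, which is
  stable under changes on a negligible set.\<close>

lemma Lp_fun_cong_AE:
  assumes a: "1 \<le> a" and f: "f \<in> Lp_fun a" and N: "negligible N" "\<And>x. x \<in> {0..pi} - N \<Longrightarrow> g x = f x"
  shows "g \<in> Lp_fun a"
proof -
  have "f absolutely_integrable_on {0..pi}" using Lp_fun_mono[OF f _ a] by (simp add: Lp_fun_1_iff)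
  then have "g absolutely_integrable_on {0..pi}" by (rule absolutely_integrable_spike[OF _ N])
  then have "g \<in> borel_measurable (lebesgue_on {0..pi})" by (simp add: absolutely_integrable_imp_borel_measurable)
  moreover have "integrable (lebesgue_on {0..pi}) (\<lambda>x. norm (g x) powr a)"
  proof -
    have "(\<lambda>x. norm (f x) powr a) absolutely_integrable_on {0..pi}"
      using f by (simp add: Lp_fun_def set_integrable_def integrable_restrict_space)
    then have "(\<lambda>x. norm (g x) powr a) absolutely_integrable_on {0..pi}"
      by (rule absolutely_integrable_spike[OF _ N(1)]) (simp add: N(2))
    then show ?thesis by (simp add: absolutely_integrable_imp_integrable)
  qed
  ultimately show ?thesis by (simp add: Lp_fun_def)
qed

lemma absolutely_integrable_mult_continuous:
  fixes v y :: "real \<Rightarrow> complex"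
  assumes v: "v absolutely_integrable_on {a..b}" and y: "continuous_on {a..b} y"
  shows "(\<lambda>x. v x * y x) absolutely_integrable_on {a..b}"
proof -
  have "bounded (y ` {a..b})" using compact_continuous_image[OF y] compact_imp_bounded by blast
  then have "(\<lambda>x. y x * v x) absolutely_integrable_on {a..b}"
    using v continuous_imp_measurable_on_sets_lebesgue[OF y]
    by (intro absolutely_integrable_bounded_measurable_product[OF bilinear_times]) auto
  then show ?thesis by (simp add: mult.commute)
qed

section \<open>Second-order equations in integrated form\<close>

text \<open>The equation \<open>y'' = F\<close> with \<open>y1\<close> for the derivative. The
  second derivative enters through its integral, so values on a null set, where
  \<open>vderiv\<close> is arbitrary, have no influence.\<close>

definition ivp :: "(real \<Rightarrow> complex) \<Rightarrow> (real \<Rightarrow> complex) \<Rightarrow> (real \<Rightarrow> complex) \<Rightarrow> bool" where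
  "ivp F y y1 \<longleftrightarrow> F absolutely_integrable_on {0..pi} \<and>
     (\<forall>x\<in>{0..pi}. (y has_vector_derivative y1 x) (at x within {0..pi}) \<and> y1 x = y1 0 + integral {0..x} F)"

text \<open>The two boundary functionals of each condition. Their linearity turns a boundary value
  problem into a 2 by 2 linear system.\<close>

fun bc_vals :: "bc \<Rightarrow> (real \<Rightarrow> complex) \<Rightarrow> (real \<Rightarrow> complex) \<Rightarrow> complex \<times> complex" where
  "bc_vals Per_plus y y1 = (y pi - y 0, y1 pi - y1 0)"
| "bc_vals Per_minus y y1 = (y pi + y 0, y1 pi + y1 0)"
| "bc_vals Dir y y1 = (y 0, y pi)"

lemma
  assumes "ivp F y y1"
  shows ivp_integrable: "F absolutely_integrable_on {0..pi}"
    and ivp_deriv: "x \<in> {0..pi} \<Longrightarrow> (y has_vector_derivative y1 x) (at x within {0..pi})"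
    and ivp_eq: "x \<in> {0..pi} \<Longrightarrow> y1 x = y1 0 + integral {0..x} F"
proof -
  show "F absolutely_integrable_on {0..pi}" using assms unfolding ivp_def by (rule conjunct1)
  have B: "\<forall>x\<in>{0..pi}. (y has_vector_derivative y1 x) (at x within {0..pi}) \<and> y1 x = y1 0 + integral {0..x} F"
    using assms unfolding ivp_def by (rule conjunct2)
  show "x \<in> {0..pi} \<Longrightarrow> (y has_vector_derivative y1 x) (at x within {0..pi})" by (rule conjunct1[OF bspec[OF B]])
  show "x \<in> {0..pi} \<Longrightarrow> y1 x = y1 0 + integral {0..x} F" by (rule conjunct2[OF bspec[OF B]])
qed

lemma ivp_continuous:
  assumes "ivp F y y1"
  shows "continuous_on {0..pi} y" "continuous_on {0..pi} y1"
proof -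
  have F: "F integrable_on {0..pi}"
    using ivp_integrable[OF assms] by (simp add: absolutely_integrable_on_def)
  show "continuous_on {0..pi} y"
    unfolding continuous_on_eq_continuous_within
    using has_vector_derivative_continuous[OF ivp_deriv[OF assms]] by blast
  have "continuous_on {0..pi} (\<lambda>x. y1 0 + integral {0..x} F)"
    using indefinite_integral_continuous_1[OF F] by (intro continuous_intros)
  then show "continuous_on {0..pi} y1" by (rule continuous_on_eq) (rule ivp_eq[OF assms, symmetric])
qed

lemma vderiv_eqI:
  assumes "(y has_vector_derivative D) (at x within {0..pi})" "x \<in> {0..pi}"
  shows "vderiv y x = D"
  unfolding vderiv_def using assms by (intro vector_derivative_within_closed_interval) auto

lemma ivp_vderiv: "ivp F y y1 \<Longrightarrow> x \<in> {0..pi} \<Longrightarrow> vderiv y x = y1 x"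
  by (rule vderiv_eqI[OF ivp_deriv])

lemma satisfies_bc_iff: "satisfies_bc bc y \<longleftrightarrow> bc_vals bc y (vderiv y) = (0, 0)"
  by (cases bc) (auto simp: eq_neg_iff_add_eq_0)

lemma bc_vals_cong:
  assumes "\<And>x. x \<in> {0..pi} \<Longrightarrow> y x = z x" "\<And>x. x \<in> {0..pi} \<Longrightarrow> y1 x = z1 x"
  shows "bc_vals bc y y1 = bc_vals bc z z1"
  by (cases bc) (use assms[of 0] assms[of pi] in auto)

text \<open>By the definition of \<open>hill_expr\<close> the source is
  \<open>vderiv (vderiv y)\<close> at every point. It is integrable because
  \<open>hill_expr v y\<close> and \<open>v * y\<close> are, and absolute continuity of
  \<open>vderiv y\<close> allows integrating it back.\<close>

lemma hill_dom_imp_ivp: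
  assumes y: "y \<in> hill_dom bc v" and v: "v \<in> Lp_fun 1"
  shows "ivp (\<lambda>x. v x * y x - hill_expr v y x) y (vderiv y)" "bc_vals bc y (vderiv y) = (0, 0)"
proof -
  have d: "\<forall>x\<in>{0..pi}. y differentiable (at x within {0..pi})" and ac: "abs_cont_on 0 pi (vderiv y)"
    and h: "hill_expr v y \<in> Lp_fun 2" and bc: "satisfies_bc bc y" using y by (auto simp: hill_dom_def)
  show "bc_vals bc y (vderiv y) = (0, 0)" using bc by (simp add: satisfies_bc_iff)
  have dy: "(y has_vector_derivative vderiv y x) (at x within {0..pi})" if "x \<in> {0..pi}" for x
    using d that unfolding vderiv_def by (simp add: vector_derivative_works)
  then have cy: "continuous_on {0..pi} y"
    unfolding continuous_on_eq_continuous_within using has_vector_derivative_continuous by blast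
  have F: "(\<lambda>x. v x * y x - hill_expr v y x) = vderiv (vderiv y)" by (auto simp: hill_expr_def)
  have "hill_expr v y absolutely_integrable_on {0..pi}"
    using Lp_fun_mono[OF h, of 1] by (simp add: Lp_fun_1_iff)
  then have ai: "(\<lambda>x. v x * y x - hill_expr v y x) absolutely_integrable_on {0..pi}"
    using v absolutely_integrable_mult_continuous[OF _ cy] by (intro set_integral_diff) (auto simp: Lp_fun_1_iff)
  obtain N where N: "negligible N" "\<And>x. x \<in> {0..pi} - N \<Longrightarrow> \<exists>L. (vderiv y has_vector_derivative L) (at x within {0..pi})"
    using abs_cont_on_differentiable_AE[OF ac] by blast
  have D: "(vderiv y has_vector_derivative vderiv (vderiv y) x) (at x within {0..pi})" if "x \<in> {0..pi} - N" for x
    using N(2)[OF that] vderiv_eqI[of "vderiv y" _ x] that by auto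
  have "vderiv y x = vderiv y 0 + integral {0..x} (vderiv (vderiv y))" if x: "x \<in> {0..pi}" for x
  proof -
    have "(vderiv (vderiv y) has_integral (vderiv y x - vderiv y 0)) {0..x}"
    proof (rule abs_cont_on_FTC[OF _ _ N(1)])
      show "abs_cont_on 0 x (vderiv y)" using abs_cont_on_subset[OF ac] x by auto
      show "(vderiv y has_vector_derivative vderiv (vderiv y) t) (at t within {0..x})" if "t \<in> {0..x} - N" for t
        using x that by (intro has_vector_derivative_within_subset[OF D]) auto
    qed (use x in auto)
    then show ?thesis by (simp add: integral_unique)
  qed
  then show "ivp (\<lambda>x. v x * y x - hill_expr v y x) y (vderiv y)"
    using dy ai unfolding ivp_def F by blast
qed

text \<open>Differentiating the integral of \<open>F\<close> recovers \<open>F\<close> only almost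
  everywhere, whence the null set in the second claim; membership of \<open>hill_expr v y\<close> in
  L^2 survives it.\<close>

lemma ivp_imp_hill_dom:
  assumes y: "ivp F y y1" and bc: "bc_vals bc y y1 = (0, 0)" and f: "(\<lambda>x. v x * y x - F x) \<in> Lp_fun 2"
  shows "y \<in> hill_dom bc v" "\<exists>N. negligible N \<and> (\<forall>x\<in>{0..pi} - N. hill_expr v y x = v x * y x - F x)"
proof -
  note F = ivp_integrable[OF y] and dy = ivp_deriv[OF y] and y1 = ivp_eq[OF y]
  note cont = ivp_continuous[OF y]
  have vd: "vderiv y x = y1 x" if "x \<in> {0..pi}" for x using ivp_vderiv[OF y that] .
  have yint: "(y1 has_integral (y t - y s)) {s..t}" if "0 \<le> s" "s \<le> t" "t \<le> pi" for s t
    using that by (intro fundamental_theorem_of_calculus has_vector_derivative_within_subset[OF dy]) auto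
  obtain N where N: "negligible N"
    "\<And>x. x \<in> {0..pi} - N \<Longrightarrow> ((\<lambda>x. integral {0..x} F) has_vector_derivative F x) (at x within {0..pi})"
    using integral_has_vector_derivative_AE[OF F pi_gt_zero] by blast
  have "vderiv (vderiv y) x = F x" if x: "x \<in> {0..pi} - N" for x
  proof (rule vderiv_eqI)
    have "((\<lambda>x. y1 0 + integral {0..x} F) has_vector_derivative 0 + F x) (at x within {0..pi})"
      by (intro has_vector_derivative_add has_vector_derivative_const N(2) x)
    then have "((\<lambda>x. y1 0 + integral {0..x} F) has_vector_derivative F x) (at x within {0..pi})" by simp
    then show "(vderiv y has_vector_derivative F x) (at x within {0..pi})"
    proof (rule has_vector_derivative_transform[rotated 2])
      show "x \<in> {0..pi}" using x by blast
      show "vderiv y t = y1 0 + integral {0..t} F" if "t \<in> {0..pi}" for t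
        using vd[OF that] y1[OF that] by (rule trans)
    qed
  qed (use x in auto)
  then have he: "hill_expr v y x = v x * y x - F x" if "x \<in> {0..pi} - N" for x
    using that by (simp add: hill_expr_def)
  then show "\<exists>N. negligible N \<and> (\<forall>x\<in>{0..pi} - N. hill_expr v y x = v x * y x - F x)" using N(1) by blast
  have "hill_expr v y \<in> Lp_fun 2" using he by (intro Lp_fun_cong_AE[OF _ f N(1)]) auto
  moreover have "abs_cont_on 0 pi (vderiv y)"
  proof (rule abs_cont_on_dominated[OF abs_cont_on_integral[OF F]])
    show "norm (vderiv y t - vderiv y s) \<le> norm (integral {0..t} F - integral {0..s} F)" if "0 \<le> s" "s < t" "t \<le> pi" for s t
    proof -
      have "vderiv y t = y1 0 + integral {0..t} F" "vderiv y s = y1 0 + integral {0..s} F"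
        using vd[of t] vd[of s] y1[of t] y1[of s] that by auto
      then show ?thesis by simp
    qed
  qed simp
  moreover have "abs_cont_on 0 pi y"
  proof (rule abs_cont_on_dominated[OF abs_cont_on_integral])
    show "y1 absolutely_integrable_on {0..pi}" using cont(2) by (rule absolutely_integrable_continuous_real)
    show "norm (y t - y s) \<le> norm (integral {0..t} y1 - integral {0..s} y1)" if "0 \<le> s" "s < t" "t \<le> pi" for s t
      using integral_unique[OF yint[of 0 s]] integral_unique[OF yint[of 0 t]] that by simp
  qed simp
  moreover have "satisfies_bc bc y" unfolding satisfies_bc_iff using bc bc_vals_cong[of y y "vderiv y" y1] vd by auto
  moreover have "\<forall>x\<in>{0..pi}. y differentiable (at x within {0..pi})"
    using dy unfolding has_vector_derivative_def differentiable_def by blast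
  ultimately show "y \<in> hill_dom bc v" by (simp add: hill_dom_def)
qed

lemma ivp_cong:
  assumes "ivp F y y1" "negligible N" "\<And>x. x \<in> {0..pi} - N \<Longrightarrow> G x = F x" "\<And>x. x \<in> {0..pi} \<Longrightarrow> z x = y x"
  shows "ivp G z y1"
  unfolding ivp_def
proof (intro conjI ballI)
  show "G absolutely_integrable_on {0..pi}"
    by (rule absolutely_integrable_spike[OF ivp_integrable[OF assms(1)] assms(2,3)])
  fix x assume x: "x \<in> {0..pi}"
  show "(z has_vector_derivative y1 x) (at x within {0..pi})"
    by (rule has_vector_derivative_transform[of _ _ z y]) (use ivp_deriv[OF assms(1) x] assms(4) x in auto)
  have "integral {0..x} G = integral {0..x} F"
    by (rule integral_spike[OF assms(2)]) (use assms(3) x in auto)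
  then show "y1 x = y1 0 + integral {0..x} G" using ivp_eq[OF assms(1) x] by simp
qed

lemma ivp_lincomb:
  assumes "ivp F y y1" "ivp G z z1"
  shows "ivp (\<lambda>x. c * F x + d * G x) (\<lambda>x. c * y x + d * z x) (\<lambda>x. c * y1 x + d * z1 x)"
  unfolding ivp_def
proof (intro conjI ballI)
  have F: "F absolutely_integrable_on {0..pi}" "G absolutely_integrable_on {0..pi}" using assms ivp_integrable by blast+
  show "(\<lambda>x. c * F x + d * G x) absolutely_integrable_on {0..pi}"
    using F by (intro set_integral_add set_integrable_mult_right) auto
  fix x assume x: "x \<in> {0..pi}"
  show "((\<lambda>x. c * y x + d * z x) has_vector_derivative c * y1 x + d * z1 x) (at x within {0..pi})"
    using x by (intro has_vector_derivative_add has_vector_derivative_mult_right ivp_deriv[OF assms(1)] ivp_deriv[OF assms(2)])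
  have "F absolutely_integrable_on {0..x}" "G absolutely_integrable_on {0..x}"
    using x by (auto intro!: absolutely_integrable_on_subinterval[OF F(1)] absolutely_integrable_on_subinterval[OF F(2)])
  then have i: "F integrable_on {0..x}" "G integrable_on {0..x}" by (auto simp: absolutely_integrable_on_def)
  have "integral {0..x} (\<lambda>x. c * F x + d * G x) = c * integral {0..x} F + d * integral {0..x} G"
    using i by (subst integral_add) (auto intro: integrable_on_mult_right)
  then show "c * y1 x + d * z1 x = c * y1 0 + d * z1 0 + integral {0..x} (\<lambda>x. c * F x + d * G x)"
    unfolding ivp_eq[OF assms(1) x] ivp_eq[OF assms(2) x] by (simp add: algebra_simps)
qed

lemma bc_vals_lincomb:
  "bc_vals bc (\<lambda>x. c * y x + d * z x) (\<lambda>x. c * y1 x + d * z1 x)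
     = (c * fst (bc_vals bc y y1) + d * fst (bc_vals bc z z1), c * snd (bc_vals bc y y1) + d * snd (bc_vals bc z z1))"
  by (cases bc) (auto simp: algebra_simps)

section \<open>Volterra equations\<close>

text \<open>The solution of \<open>y'' = F\<close> with zero initial data. The inner integral is
  continuous, so one derivative exists at every point.\<close>

definition dbl_integral :: "(real \<Rightarrow> complex) \<Rightarrow> real \<Rightarrow> complex" where
  "dbl_integral F x = integral {0..x} (\<lambda>s. integral {0..s} F)"

abbreviation L1_norm :: "(real \<Rightarrow> complex) \<Rightarrow> real" where
  "L1_norm f \<equiv> integral {0..pi} (\<lambda>x. norm (f x))"

lemma L1_norm_nonneg: "0 \<le> L1_norm f"
proof (cases "(\<lambda>x. norm (f x)) integrable_on {0..pi}")
  case True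
  then show ?thesis by (rule integral_nonneg) simp
qed (simp add: not_integrable_integral)

lemma abs_integrable_sub:
  fixes f :: "real \<Rightarrow> complex"
  assumes "f absolutely_integrable_on {0..pi}" "0 \<le> s" "t \<le> pi"
  shows "f integrable_on {s..t}" "(\<lambda>x. norm (f x)) integrable_on {s..t}"
proof -
  have "f absolutely_integrable_on {s..t}"
    by (rule absolutely_integrable_on_subinterval[OF assms(1)]) (use assms in auto)
  then show "f integrable_on {s..t}" "(\<lambda>x. norm (f x)) integrable_on {s..t}"
    by (auto simp: absolutely_integrable_on_def)
qed

lemma norm_integral_le_L1_norm:
  assumes f: "f absolutely_integrable_on {0..pi}" and s: "0 \<le> s" "s \<le> t" "t \<le> pi"
  shows "norm (integral {s..t} f) \<le> L1_norm f"
proof -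
  have "norm (integral {s..t} f) \<le> integral {s..t} (\<lambda>x. norm (f x))"
    using abs_integrable_sub[OF f s(1,3)] by (intro integral_norm_bound_integral) auto
  also have "\<dots> \<le> L1_norm f"
    using abs_integrable_sub[OF f s(1,3)] abs_integrable_sub[OF f, of 0 pi] s by (intro integral_subset_le) auto
  finally show ?thesis .
qed

lemma continuous_indefinite:
  assumes "F absolutely_integrable_on {0..pi}"
  shows "continuous_on {0..pi} (\<lambda>s. integral {0..s} F :: complex)"
  using abs_integrable_sub(1)[OF assms, of 0 pi] by (intro indefinite_integral_continuous_1) auto

lemma dbl_integral_has_vector_derivative:
  assumes "F absolutely_integrable_on {0..pi}" "x \<in> {0..pi}"
  shows "(dbl_integral F has_vector_derivative integral {0..x} F) (at x within {0..pi})"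
  unfolding dbl_integral_def[abs_def]
  by (rule integral_has_vector_derivative[OF continuous_indefinite[OF assms(1)] assms(2)])

lemma ivp_dbl_integralI:
  assumes F: "F absolutely_integrable_on {0..pi}"
    and y: "\<And>x. x \<in> {0..pi} \<Longrightarrow> y x = a + b * of_real x + dbl_integral F x"
  shows "ivp F y (\<lambda>x. b + integral {0..x} F)"
  unfolding ivp_def
proof (intro conjI ballI F)
  fix x assume x: "x \<in> {0..pi}"
  have "((\<lambda>x. b * complex_of_real x) has_vector_derivative b * complex_of_real 1) (at x within {0..pi})"
    by (intro has_vector_derivative_mult_right has_vector_derivative_of_real) auto
  then have "((\<lambda>x. a + b * of_real x + dbl_integral F x) has_vector_derivative 0 + b * complex_of_real 1 + integral {0..x} F) (at x within {0..pi})"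
    by (intro has_vector_derivative_add has_vector_derivative_const dbl_integral_has_vector_derivative[OF F x])
  then have "((\<lambda>x. a + b * of_real x + dbl_integral F x) has_vector_derivative b + integral {0..x} F) (at x within {0..pi})"
    by simp
  then show "(y has_vector_derivative b + integral {0..x} F) (at x within {0..pi})"
    by (rule has_vector_derivative_transform[rotated 2]) (use x y in auto)
qed simp

lemma norm_dbl_integral_le:
  assumes F: "F absolutely_integrable_on {0..pi}" and x: "x \<in> {0..pi}"
  shows "norm (dbl_integral F x) \<le> pi * L1_norm F"
proof -
  have "norm (dbl_integral F x) \<le> integral {0..x} (\<lambda>s. L1_norm F)"
    unfolding dbl_integral_def
  proof (rule integral_norm_bound_integral)
    show "(\<lambda>s. integral {0..s} F) integrable_on {0..x}"
      using x continuous_on_subset[OF continuous_indefinite[OF F]] by (intro integrable_continuous_real) auto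
    show "norm (integral {0..s} F) \<le> L1_norm F" if "s \<in> {0..x}" for s
      using norm_integral_le_L1_norm[OF F] that x by auto
  qed auto
  also have "\<dots> = x * L1_norm F" using x by simp
  also have "\<dots> \<le> pi * L1_norm F" using x L1_norm_nonneg by (intro mult_right_mono) auto
  finally show ?thesis .
qed

text \<open>Integrating \<open>exp (k * s)\<close> gains a factor \<open>1 / k\<close>: in the norm
  weighted by \<open>exp (- k * x)\<close> the Volterra operator has size at most
  \<open>L1_norm w / k\<close>.\<close>

lemma norm_dbl_integral_exp_le:
  assumes w: "w absolutely_integrable_on {0..pi}" and y: "continuous_on {0..pi} y"
    and k: "0 < k" and m: "\<And>t. t \<in> {0..pi} \<Longrightarrow> norm (y t) \<le> m * exp (k * t)" and x: "x \<in> {0..pi}"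
  shows "norm (dbl_integral (\<lambda>t. w t * y t) x) \<le> L1_norm w / k * m * exp (k * x)"
proof -
  have wy: "(\<lambda>t. w t * y t) absolutely_integrable_on {0..pi}" by (rule absolutely_integrable_mult_continuous[OF w y])
  have m0: "0 \<le> m" using order_trans[OF norm_ge_zero m[of 0]] by simp
  have inner: "norm (integral {0..s} (\<lambda>t. w t * y t)) \<le> L1_norm w * m * exp (k * s)" if s: "s \<in> {0..pi}" for s
  proof -
    have "norm (integral {0..s} (\<lambda>t. w t * y t)) \<le> integral {0..s} (\<lambda>t. norm (w t) * (m * exp (k * s)))"
    proof (rule integral_norm_bound_integral)
      show "(\<lambda>t. w t * y t) integrable_on {0..s}" using abs_integrable_sub[OF wy] s by auto
      show "(\<lambda>t. norm (w t) * (m * exp (k * s))) integrable_on {0..s}"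
        using abs_integrable_sub[OF w] s by (intro integrable_on_mult_left) auto
      show "norm (w t * y t) \<le> norm (w t) * (m * exp (k * s))" if t: "t \<in> {0..s}" for t
      proof -
        have "norm (y t) \<le> m * exp (k * t)" using m t s by auto
        also have "\<dots> \<le> m * exp (k * s)" using t k m0 by (intro mult_left_mono) auto
        finally show ?thesis unfolding norm_mult by (intro mult_left_mono) auto
      qed
    qed
    also have "\<dots> = integral {0..s} (\<lambda>t. norm (w t)) * (m * exp (k * s))" by simp
    also have "\<dots> \<le> L1_norm w * (m * exp (k * s))"
      using abs_integrable_sub[OF w] s m0 by (intro mult_right_mono integral_subset_le) auto
    finally show ?thesis by (simp add: mult.assoc)
  qed
  have expint: "((\<lambda>s. exp (k * s)) has_integral (exp (k * x) / k - exp (k * 0) / k)) {0..x}"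
    using k x by (intro fundamental_theorem_of_calculus)
      (auto intro!: derivative_eq_intros simp: has_real_derivative_iff_has_vector_derivative[symmetric])
  have "norm (dbl_integral (\<lambda>t. w t * y t) x) \<le> integral {0..x} (\<lambda>s. L1_norm w * m * exp (k * s))"
    unfolding dbl_integral_def
  proof (rule integral_norm_bound_integral)
    show "(\<lambda>s. integral {0..s} (\<lambda>t. w t * y t)) integrable_on {0..x}"
      using x continuous_on_subset[OF continuous_indefinite[OF wy]] by (intro integrable_continuous_real) auto
    show "(\<lambda>s. L1_norm w * m * exp (k * s)) integrable_on {0..x}"
      using expint by (intro integrable_on_mult_right) auto
    show "norm (integral {0..s} (\<lambda>t. w t * y t)) \<le> L1_norm w * m * exp (k * s)" if "s \<in> {0..x}" for s
      using inner that x by auto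
  qed
  also have "\<dots> = L1_norm w * m * (exp (k * x) / k - 1 / k)"
    using integral_unique[OF expint] by simp
  also have "\<dots> \<le> L1_norm w * m * (exp (k * x) / k)"
    using k m0 L1_norm_nonneg[of w] by (intro mult_left_mono) auto
  finally show ?thesis by (simp add: mult_ac)
qed

text \<open>At a maximum of the weighted modulus the integral term is at most half of that maximum,
  up to the weight, and is absorbed on the left. The exponential in the constant is the price for
  removing the weight.\<close>

lemma volterra_bound:
  assumes w: "w absolutely_integrable_on {0..pi}" and y: "continuous_on {0..pi} y"
    and eq: "\<And>x. x \<in> {0..pi} \<Longrightarrow> y x = g x + dbl_integral (\<lambda>t. w t * y t) x"
    and G: "\<And>x. x \<in> {0..pi} \<Longrightarrow> norm (g x) \<le> G" and x: "x \<in> {0..pi}"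
  shows "norm (y x) \<le> 2 * exp ((2 * L1_norm w + 1) * pi) * G"
proof -
  \<comment> \<open>Makes the contraction factor at most \<open>1 / 2\<close>; the summand 1 keeps
    \<open>k\<close> positive when \<open>w\<close> vanishes.\<close>
  define k where "k = 2 * L1_norm w + 1"
  have k: "0 < k" "L1_norm w / k \<le> 1 / 2" using L1_norm_nonneg[of w] by (auto simp: k_def field_simps)
  define e where "e t = norm (y t) * exp (- (k * t))" for t
  have "continuous_on {0..pi} e" unfolding e_def by (intro continuous_intros y)
  then obtain t0 where t0: "t0 \<in> {0..pi}" "\<And>t. t \<in> {0..pi} \<Longrightarrow> e t \<le> e t0"
    using continuous_attains_sup[of "{0..pi}" e] by auto
  define m where "m = e t0"
  have m: "norm (y t) \<le> m * exp (k * t)" if "t \<in> {0..pi}" for t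
  proof -
    have "norm (y t) = e t * exp (k * t)" by (simp add: e_def exp_minus)
    also have "\<dots> \<le> m * exp (k * t)" using t0(2)[OF that] by (simp add: m_def)
    finally show ?thesis .
  qed
  have m0: "0 \<le> m" by (simp add: m_def e_def)
  have G0: "0 \<le> G" using order_trans[OF norm_ge_zero G[OF x]] .
  have "norm (y t0) \<le> norm (g t0) + norm (dbl_integral (\<lambda>t. w t * y t) t0)"
    using eq[OF t0(1)] norm_triangle_ineq by metis
  also have "\<dots> \<le> G + L1_norm w / k * m * exp (k * t0)"
    by (intro add_mono G t0 norm_dbl_integral_exp_le w y k m) auto
  also have "\<dots> \<le> G + 1 / 2 * m * exp (k * t0)"
    using k m0 by (intro add_mono mult_right_mono) auto
  finally have "norm (y t0) * exp (- (k * t0)) \<le> (G + 1 / 2 * m * exp (k * t0)) * exp (- (k * t0))"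
    by (intro mult_right_mono) auto
  also have "\<dots> = G * exp (- (k * t0)) + m / 2" by (simp add: distrib_right exp_minus)
  also have "\<dots> \<le> G * 1 + m / 2" using G0 k t0(1) by (intro add_mono mult_left_mono) auto
  finally have "m \<le> 2 * G" by (simp add: m_def e_def)
  have "norm (y x) \<le> m * exp (k * x)" by (rule m[OF x])
  also have "\<dots> \<le> (2 * G) * exp (k * pi)" using \<open>m \<le> 2 * G\<close> k x m0 G0 by (intro mult_mono) auto
  finally show ?thesis by (simp add: k_def mult_ac)
qed

section \<open>Continuous functions on the interval\<close>

text \<open>Zero off the interval, so that it is the same representative that \<open>C_to_L2\<close>
  uses.\<close>

definition Cfun :: "Cspace \<Rightarrow> real \<Rightarrow> complex" where
  "Cfun u x = (if x \<in> {0..pi} then apply_bcontfun u (Abs_intv x) else 0)"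

definition mkC :: "(real \<Rightarrow> complex) \<Rightarrow> Cspace" where
  "mkC g = Bcontfun (\<lambda>x. g (Rep_intv x))"

lemma continuous_on_Rep_intv: "continuous_on UNIV Rep_intv"
  unfolding continuous_on_iff by (auto simp: dist_intv.rep_eq)

lemma continuous_on_Abs_intv: "continuous_on {0..pi} Abs_intv"
  unfolding continuous_on_iff by (auto simp: dist_intv.rep_eq Abs_intv_inverse)

lemma continuous_on_Cfun: "continuous_on {0..pi} (Cfun u)"
proof -
  have "continuous_on {0..pi} (\<lambda>x. apply_bcontfun u (Abs_intv x))"
    by (rule continuous_on_compose2[OF continuous_on_apply_bcontfun continuous_on_Abs_intv]) auto
  then show ?thesis by (rule continuous_on_eq) (simp add: Cfun_def)
qed

lemma norm_Cfun_le: "norm (Cfun u x) \<le> norm u"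
  by (simp add: Cfun_def norm_bounded)

lemma Cfun_eqI:
  assumes "\<And>x. x \<in> {0..pi} \<Longrightarrow> Cfun u x = Cfun w x"
  shows "u = w"
proof (rule bcontfun_eqI)
  fix x
  have "Rep_intv x \<in> {0..pi}" by (rule Rep_intv)
  then show "apply_bcontfun u x = apply_bcontfun w x"
    using assms[of "Rep_intv x"] by (simp add: Cfun_def Rep_intv_inverse)
qed

lemma norm_Cspace_le:
  assumes "\<And>x. x \<in> {0..pi} \<Longrightarrow> norm (Cfun u x) \<le> B"
  shows "norm u \<le> B"
proof (rule norm_bound)
  fix x
  have "Rep_intv x \<in> {0..pi}" by (rule Rep_intv)
  then show "norm (apply_bcontfun u x) \<le> B"
    using assms[of "Rep_intv x"] by (simp add: Cfun_def Rep_intv_inverse)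
qed

lemma Cfun_mkC:
  assumes g: "continuous_on {0..pi} g" and x: "x \<in> {0..pi}"
  shows "Cfun (mkC g) x = g x"
proof -
  have "(\<lambda>x. g (Rep_intv x)) \<in> bcontfun"
    unfolding bcontfun_def
  proof (intro CollectI conjI)
    show "continuous_on UNIV (\<lambda>x. g (Rep_intv x))"
      by (rule continuous_on_compose2[OF g continuous_on_Rep_intv]) (use Rep_intv in auto)
    have "bounded (g ` {0..pi})" using compact_continuous_image[OF g] compact_imp_bounded by blast
    then show "bounded (range (\<lambda>x. g (Rep_intv x)))"
      by (rule bounded_subset) (use Rep_intv in auto)
  qed
  then show ?thesis using x by (simp add: mkC_def Cfun_def Bcontfun_inverse Abs_intv_inverse)
qed

lemma Cfun_add [simp]: "Cfun (u + w) x = Cfun u x + Cfun w x"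
  by (simp add: Cfun_def)

lemma Cfun_diff [simp]: "Cfun (u - w) x = Cfun u x - Cfun w x"
  by (simp add: Cfun_def)

lemma Cfun_scaleR [simp]: "Cfun (r *\<^sub>R u) x = r *\<^sub>R Cfun u x"
  by (simp add: Cfun_def)

text \<open>Contraction in the weighted norm \<open>sup exp (- k x) |y x|\<close>.\<close>

lemma volterra_exists:
  assumes w: "w absolutely_integrable_on {0..pi}" and g: "continuous_on {0..pi} g"
  obtains y where "continuous_on {0..pi} y" "\<And>x. x \<in> {0..pi} \<Longrightarrow> y x = g x + dbl_integral (\<lambda>t. w t * y t) x"
proof -
  define k where "k = 2 * L1_norm w + 1"
  have k: "0 < k" "L1_norm w / k \<le> 1 / 2" using L1_norm_nonneg[of w] by (auto simp: k_def field_simps)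
  define E where "E \<eta> t = of_real (exp (k * t)) * Cfun \<eta> t" for \<eta> t
  \<comment> \<open>The unknown is \<open>\<eta> x = exp (- (k * x)) * y x\<close>, so the weighted
    norm of \<open>y\<close> is the plain norm of \<open>Cspace\<close>, a complete space.\<close>
  define \<Phi>0 where "\<Phi>0 \<eta> x = of_real (exp (- (k * x))) * (g x + dbl_integral (\<lambda>t. w t * E \<eta> t) x)" for \<eta> x
  define \<Phi> where "\<Phi> \<eta> = mkC (\<Phi>0 \<eta>)" for \<eta>
  have contE: "continuous_on {0..pi} (E \<eta>)" for \<eta>
    unfolding E_def by (intro continuous_intros continuous_on_Cfun)
  have wE: "(\<lambda>t. w t * E \<eta> t) absolutely_integrable_on {0..pi}" for \<eta>
    by (rule absolutely_integrable_mult_continuous[OF w contE])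
  have contJ: "continuous_on {0..pi} (dbl_integral F)" if "F absolutely_integrable_on {0..pi}" for F
    unfolding continuous_on_eq_continuous_within
    using has_vector_derivative_continuous[OF dbl_integral_has_vector_derivative[OF that]] by blast
  have cont\<Phi>: "continuous_on {0..pi} (\<Phi>0 \<eta>)" for \<eta>
    unfolding \<Phi>0_def by (intro continuous_intros g contJ wE)
  have lip: "dist (\<Phi> \<eta>) (\<Phi> \<theta>) \<le> 1 / 2 * dist \<eta> \<theta>" for \<eta> \<theta>
    unfolding dist_norm
  proof (rule norm_Cspace_le)
    fix x assume x: "x \<in> {0..pi}"
    define d where "d t = E \<eta> t - E \<theta> t" for t
    have d: "norm (d t) \<le> norm (\<eta> - \<theta>) * exp (k * t)" for t
    proof -
      have "d t = of_real (exp (k * t)) * Cfun (\<eta> - \<theta>) t" by (simp add: d_def E_def algebra_simps)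
      then show ?thesis using norm_Cfun_le[of "\<eta> - \<theta>" t] by (simp add: norm_mult mult.commute)
    qed
    have "dbl_integral (\<lambda>t. w t * E \<eta> t) x - dbl_integral (\<lambda>t. w t * E \<theta> t) x = dbl_integral (\<lambda>t. w t * d t) x"
    proof -
      have inner: "integral {0..s} (\<lambda>t. w t * d t) = integral {0..s} (\<lambda>t. w t * E \<eta> t) - integral {0..s} (\<lambda>t. w t * E \<theta> t)" if "s \<in> {0..x}" for s
        using abs_integrable_sub(1)[OF wE[of \<eta>], of 0 s] abs_integrable_sub(1)[OF wE[of \<theta>], of 0 s] that x
        by (simp add: d_def right_diff_distrib Henstock_Kurzweil_Integration.integral_diff)
      have c: "(\<lambda>s. integral {0..s} (\<lambda>t. w t * E \<eta> t)) integrable_on {0..x}" for \<eta>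
        using x continuous_on_subset[OF continuous_indefinite[OF wE]] by (intro integrable_continuous_real) auto
      have "dbl_integral (\<lambda>t. w t * d t) x = integral {0..x} (\<lambda>s. integral {0..s} (\<lambda>t. w t * E \<eta> t) - integral {0..s} (\<lambda>t. w t * E \<theta> t))"
        unfolding dbl_integral_def by (rule Henstock_Kurzweil_Integration.integral_cong) (rule inner)
      then show ?thesis using c[of \<eta>] c[of \<theta>] by (simp add: dbl_integral_def Henstock_Kurzweil_Integration.integral_diff)
    qed
    then have "Cfun (\<Phi> \<eta> - \<Phi> \<theta>) x = of_real (exp (- (k * x))) * dbl_integral (\<lambda>t. w t * d t) x"
      unfolding \<Phi>_def Cfun_diff Cfun_mkC[OF cont\<Phi> x] by (simp add: \<Phi>0_def algebra_simps)
    then have "norm (Cfun (\<Phi> \<eta> - \<Phi> \<theta>) x) = exp (- (k * x)) * norm (dbl_integral (\<lambda>t. w t * d t) x)"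
      by (simp add: norm_mult)
    also have "\<dots> \<le> exp (- (k * x)) * (L1_norm w / k * norm (\<eta> - \<theta>) * exp (k * x))"
      by (intro mult_left_mono norm_dbl_integral_exp_le w k d x) (auto simp: d_def intro!: continuous_intros contE)
    also have "\<dots> = L1_norm w / k * norm (\<eta> - \<theta>)" by (simp add: exp_minus)
    also have "\<dots> \<le> 1 / 2 * norm (\<eta> - \<theta>)" using k by (intro mult_right_mono) auto
    finally show "norm (Cfun (\<Phi> \<eta> - \<Phi> \<theta>) x) \<le> 1 / 2 * norm (\<eta> - \<theta>)" .
  qed
  have "\<exists>!\<eta>. \<eta> \<in> UNIV \<and> \<Phi> \<eta> = \<eta>"
    using Banach_fix[OF complete_UNIV, of "1 / 2" \<Phi>] lip by auto
  then obtain \<eta> where \<eta>: "\<Phi> \<eta> = \<eta>" by blast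
  show thesis
  proof (rule that[OF contE[of \<eta>]])
    fix x assume x: "x \<in> {0..pi}"
    have "Cfun \<eta> x = \<Phi>0 \<eta> x" using Cfun_mkC[OF cont\<Phi> x, of \<eta>] \<eta> by (simp add: \<Phi>_def)
    moreover have "complex_of_real (exp (k * x)) * of_real (exp (- (k * x))) = 1"
      by (simp add: exp_minus flip: of_real_mult)
    ultimately show "E \<eta> x = g x + dbl_integral (\<lambda>t. w t * E \<eta> t) x"
      unfolding E_def[of \<eta> x] \<Phi>0_def by (simp flip: mult.assoc)
  qed
qed

section \<open>Boundary value problems\<close>

text \<open>The equation \<open>y'' = (v - z) * y + f\<close> is \<open>z * y - L y = f\<close>, so
  the solution map is the resolvent at \<open>z\<close> with the sign convention of
  \<open>is_resolvent\<close>.\<close>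

definition bvp :: "bc \<Rightarrow> (real \<Rightarrow> complex) \<Rightarrow> complex \<Rightarrow> (real \<Rightarrow> complex) \<Rightarrow> (real \<Rightarrow> complex) \<Rightarrow> bool" where
  "bvp bc v z f y \<longleftrightarrow> (\<exists>y1. ivp (\<lambda>x. (v x - z) * y x + f x) y y1 \<and> bc_vals bc y y1 = (0, 0))"

lemma bvp_continuous: "bvp bc v z f y \<Longrightarrow> continuous_on {0..pi} y"
  unfolding bvp_def using ivp_continuous by blast

lemma bvp_cong:
  assumes y: "bvp bc v z f y" and N: "negligible N" "\<And>x. x \<in> {0..pi} - N \<Longrightarrow> f x = g x"
    and u: "\<And>x. x \<in> {0..pi} \<Longrightarrow> y x = u x"
  shows "bvp bc v z g u"
proof -
  obtain y1 where y1: "ivp (\<lambda>x. (v x - z) * y x + f x) y y1" "bc_vals bc y y1 = (0, 0)" using y by (auto simp: bvp_def)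
  have "ivp (\<lambda>x. (v x - z) * u x + g x) u y1"
    by (rule ivp_cong[OF y1(1) N(1)]) (use N(2) u in auto)
  moreover have "bc_vals bc u y1 = (0, 0)" using y1(2) bc_vals_cong[of y u y1 y1 bc] u by simp
  ultimately show ?thesis by (auto simp: bvp_def)
qed

lemma bvp_lincomb:
  assumes "bvp bc v z f y" "bvp bc v z g u"
  shows "bvp bc v z (\<lambda>x. c * f x + d * g x) (\<lambda>x. c * y x + d * u x)"
proof -
  obtain y1 where y1: "ivp (\<lambda>x. (v x - z) * y x + f x) y y1" "bc_vals bc y y1 = (0, 0)" using assms by (auto simp: bvp_def)
  obtain u1 where u1: "ivp (\<lambda>x. (v x - z) * u x + g x) u u1" "bc_vals bc u u1 = (0, 0)" using assms by (auto simp: bvp_def)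
  have "ivp (\<lambda>x. c * ((v x - z) * y x + f x) + d * ((v x - z) * u x + g x)) (\<lambda>x. c * y x + d * u x) (\<lambda>x. c * y1 x + d * u1 x)"
    by (rule ivp_lincomb[OF y1(1) u1(1)])
  then have "ivp (\<lambda>x. (v x - z) * (c * y x + d * u x) + (c * f x + d * g x)) (\<lambda>x. c * y x + d * u x) (\<lambda>x. c * y1 x + d * u1 x)"
    by (simp add: algebra_simps)
  then show ?thesis unfolding bvp_def using y1(2) u1(2) by (intro exI[of _ "\<lambda>x. c * y1 x + d * u1 x"]) (simp add: bc_vals_lincomb)
qed

text \<open>Terms may move between potential, spectral parameter and source as long as the
  right-hand side is unchanged; the perturbation and resolvent identities below are
  instances.\<close>

lemma bvp_shift:
  assumes "bvp bc v z f y" "\<And>x. x \<in> {0..pi} \<Longrightarrow> (v x - z) * y x + f x = (v' x - z') * y x + f' x"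
  shows "bvp bc v' z' f' y"
proof -
  obtain y1 where y1: "ivp (\<lambda>x. (v x - z) * y x + f x) y y1" "bc_vals bc y y1 = (0, 0)" using assms by (auto simp: bvp_def)
  have "ivp (\<lambda>x. (v' x - z') * y x + f' x) y y1"
    by (rule ivp_cong[OF y1(1) negligible_empty]) (use assms(2) in auto)
  then show ?thesis using y1(2) by (auto simp: bvp_def)
qed

section \<open>Initial value problems and solvability off the spectrum\<close>

text \<open>Two integrations give a Volterra equation with weight \<open>w\<close>; its free term
  collects the initial data and the twice integrated source, whence the form of the bound.\<close>

lemma initial_value_exists:
  assumes w: "w absolutely_integrable_on {0..pi}" and f: "f absolutely_integrable_on {0..pi}"
  obtains y y1 where "ivp (\<lambda>x. w x * y x + f x) y y1" "y 0 = a" "y1 0 = b"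
    "\<And>x. x \<in> {0..pi} \<Longrightarrow> norm (y x) \<le> 2 * exp ((2 * L1_norm w + 1) * pi) * (norm a + pi * norm b + pi * L1_norm f)"
proof -
  define g where "g x = a + b * of_real x + dbl_integral f x" for x
  have g: "continuous_on {0..pi} g"
    using ivp_continuous(1)[OF ivp_dbl_integralI[OF f, of g a b]] by (simp add: g_def)
  obtain y where y: "continuous_on {0..pi} y" "\<And>x. x \<in> {0..pi} \<Longrightarrow> y x = g x + dbl_integral (\<lambda>t. w t * y t) x"
    using volterra_exists[OF w g] by blast
  have wy: "(\<lambda>t. w t * y t) absolutely_integrable_on {0..pi}" by (rule absolutely_integrable_mult_continuous[OF w y(1)])
  have F: "(\<lambda>t. w t * y t + f t) absolutely_integrable_on {0..pi}" using wy f by (rule set_integral_add)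
  have J: "dbl_integral (\<lambda>t. w t * y t + f t) x = dbl_integral (\<lambda>t. w t * y t) x + dbl_integral f x" if x: "x \<in> {0..pi}" for x
  proof -
    have inner: "integral {0..s} (\<lambda>t. w t * y t + f t) = integral {0..s} (\<lambda>t. w t * y t) + integral {0..s} f" if "s \<in> {0..x}" for s
      using abs_integrable_sub(1)[OF wy, of 0 s] abs_integrable_sub(1)[OF f, of 0 s] that x
      by (simp add: Henstock_Kurzweil_Integration.integral_add)
    have c: "(\<lambda>s. integral {0..s} F) integrable_on {0..x}" if "F absolutely_integrable_on {0..pi}" for F :: "real \<Rightarrow> complex"
      using x continuous_on_subset[OF continuous_indefinite[OF that]] by (intro integrable_continuous_real) auto
    have "dbl_integral (\<lambda>t. w t * y t + f t) x = integral {0..x} (\<lambda>s. integral {0..s} (\<lambda>t. w t * y t) + integral {0..s} f)"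
      unfolding dbl_integral_def by (rule Henstock_Kurzweil_Integration.integral_cong) (rule inner)
    then show ?thesis using c[OF wy] c[OF f] by (simp add: dbl_integral_def Henstock_Kurzweil_Integration.integral_add)
  qed
  have eq: "y x = a + b * of_real x + dbl_integral (\<lambda>t. w t * y t + f t) x" if "x \<in> {0..pi}" for x
    using y(2)[OF that] J[OF that] by (simp add: g_def)
  show thesis
  proof (rule that)
    show "ivp (\<lambda>x. w x * y x + f x) y (\<lambda>x. b + integral {0..x} (\<lambda>x. w x * y x + f x))"
      by (rule ivp_dbl_integralI[OF F eq])
    show "y 0 = a" using eq[of 0] by (simp add: dbl_integral_def)
    show "b + integral {0..0} (\<lambda>x. w x * y x + f x) = b" by simp
    show "norm (y x) \<le> 2 * exp ((2 * L1_norm w + 1) * pi) * (norm a + pi * norm b + pi * L1_norm f)" if x: "x \<in> {0..pi}" for x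
    proof (rule volterra_bound[OF w y _ x])
      fix t assume t: "t \<in> {0..pi}"
      have "norm (b * of_real t) \<le> pi * norm b" using t by (simp add: norm_mult mult.commute mult_right_mono)
      then show "norm (g t) \<le> norm a + pi * norm b + pi * L1_norm f"
        unfolding g_def using norm_dbl_integral_le[OF f t] by (intro order_trans[OF norm_triangle_ineq] add_mono order_refl) auto
    qed
  qed
qed

lemma singular_2x2:
  fixes a b c d :: complex
  assumes "a * d - b * c = 0"
  obtains s t where "(s, t) \<noteq> (0, 0)" "a * s + b * t = 0" "c * s + d * t = 0"
proof (cases "(a, b) = (0, 0)")
  case True
  show ?thesis
  proof (cases "(c, d) = (0, 0)")
    case True
    then show ?thesis using \<open>(a, b) = (0, 0)\<close> that[of 1 0] by simp
  next
    case False
    then show ?thesis using \<open>(a, b) = (0, 0)\<close> that[of d "- c"] by auto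
  qed
next
  case False
  then show ?thesis using assms that[of b "- a"] by (auto simp: algebra_simps)
qed

lemma bc_vals_bound:
  assumes "\<And>x. x \<in> {0..pi} \<Longrightarrow> norm (y x) \<le> B" "\<And>x. x \<in> {0..pi} \<Longrightarrow> norm (y1 x) \<le> B"
  shows "norm (fst (bc_vals bc y y1)) \<le> 2 * B" "norm (snd (bc_vals bc y y1)) \<le> 2 * B"
proof -
  have B: "norm (y 0) \<le> B" "norm (y pi) \<le> B" "norm (y1 0) \<le> B" "norm (y1 pi) \<le> B" using assms by auto
  moreover have "0 \<le> B" using B norm_ge_zero order_trans by blast
  ultimately show "norm (fst (bc_vals bc y y1)) \<le> 2 * B" "norm (snd (bc_vals bc y y1)) \<le> 2 * B"
    using norm_triangle_ineq4[of "y pi" "y 0"] norm_triangle_ineq[of "y pi" "y 0"]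
      norm_triangle_ineq4[of "y1 pi" "y1 0"] norm_triangle_ineq[of "y1 pi" "y1 0"]
    by (cases bc; simp)+
qed

text \<open>The Fredholm alternative in elementary form. A fundamental system \<open>c\<close>,
  \<open>s\<close> has boundary matrix with determinant \<open>\<Delta>\<close>; a kernel vector
  would give a nontrivial homogeneous solution, so \<open>\<Delta>\<close> is nonzero and a
  particular solution with zero initial data can be corrected. All bounds are linear in
  \<open>L1_norm f\<close>, which later makes the solution operator bounded.\<close>

lemma bvp_solvable:
  assumes v: "v absolutely_integrable_on {0..pi}"
    and triv: "\<And>y x. bvp bc v z (\<lambda>_. 0) y \<Longrightarrow> x \<in> {0..pi} \<Longrightarrow> y x = 0"
  obtains C where "0 \<le> C" "\<And>f. f absolutely_integrable_on {0..pi} \<Longrightarrow>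
    \<exists>y. bvp bc v z f y \<and> (\<forall>x\<in>{0..pi}. norm (y x) \<le> C * L1_norm f)"
proof -
  define w where "w x = v x - z" for x
  have w: "w absolutely_integrable_on {0..pi}"
    unfolding w_def using v by (intro set_integral_diff) (auto intro: absolutely_integrable_continuous_real)
  define K where "K = 2 * exp ((2 * L1_norm w + 1) * pi)"
  have K: "0 < K" by (simp add: K_def)
  have zero: "(\<lambda>_. 0 :: complex) absolutely_integrable_on {0..pi}" by (intro absolutely_integrable_continuous_real) auto
  obtain c c1 where c: "ivp (\<lambda>x. w x * c x + 0) c c1" "c 0 = 1" "c1 0 = 0"
    "\<And>x. x \<in> {0..pi} \<Longrightarrow> norm (c x) \<le> K * (norm (1::complex) + pi * norm (0::complex) + pi * L1_norm (\<lambda>_. 0))"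
    using initial_value_exists[OF w zero, of 1 0] unfolding K_def by blast
  obtain s s1 where s: "ivp (\<lambda>x. w x * s x + 0) s s1" "s 0 = 0" "s1 0 = 1"
    "\<And>x. x \<in> {0..pi} \<Longrightarrow> norm (s x) \<le> K * (norm (0::complex) + pi * norm (1::complex) + pi * L1_norm (\<lambda>_. 0))"
    using initial_value_exists[OF w zero, of 0 1] unfolding K_def by blast
  have cs_bd: "norm (c x) \<le> K" "norm (s x) \<le> K * pi" if "x \<in> {0..pi}" for x
    using c(4)[OF that] s(4)[OF that] by simp_all
  obtain m11 m21 where M1: "bc_vals bc c c1 = (m11, m21)" by force
  obtain m12 m22 where M2: "bc_vals bc s s1 = (m12, m22)" by force
  define \<Delta> where "\<Delta> = m11 * m22 - m12 * m21"
  have "\<Delta> \<noteq> 0"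
  proof
    assume "\<Delta> = 0"
    then obtain p q where pq: "(p, q) \<noteq> (0, 0)" "m11 * p + m12 * q = 0" "m21 * p + m22 * q = 0"
      using singular_2x2[of m11 m22 m12 m21] by (auto simp: \<Delta>_def)
    let ?y = "\<lambda>x. p * c x + q * s x" and ?y1 = "\<lambda>x. p * c1 x + q * s1 x"
    have i: "ivp (\<lambda>x. p * (w x * c x + 0) + q * (w x * s x + 0)) ?y ?y1" by (rule ivp_lincomb[OF c(1) s(1)])
    then have "ivp (\<lambda>x. (v x - z) * ?y x + 0) ?y ?y1" by (simp add: w_def algebra_simps)
    moreover have "bc_vals bc ?y ?y1 = (0, 0)" using pq M1 M2 by (simp add: bc_vals_lincomb mult.commute)
    ultimately have "bvp bc v z (\<lambda>_. 0) ?y" by (auto simp: bvp_def)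
    then have y0: "?y x = 0" if "x \<in> {0..pi}" for x using triv that by blast
    then have "p = 0" using y0[of 0] c(2) s(2) by simp
    \<comment> \<open>\<open>?y\<close> vanishes on the interval, hence so does its one-sided
      derivative at 0, which is \<open>q\<close>.\<close>
    moreover have "?y1 0 = 0"
    proof -
      have "vderiv ?y 0 = 0"
        by (rule vderiv_eqI) (auto intro!: has_vector_derivative_transform[of _ _ ?y "\<lambda>_. 0"] simp: y0)
      then show ?thesis using ivp_vderiv[OF i, of 0] by simp
    qed
    ultimately show False using pq c(3) s(3) by simp
  qed
  define Q where "Q = max (norm m11) (max (norm m12) (max (norm m21) (norm m22))) / norm \<Delta>"
  have Q: "norm (m11 / \<Delta>) \<le> Q" "norm (m12 / \<Delta>) \<le> Q" "norm (m21 / \<Delta>) \<le> Q" "norm (m22 / \<Delta>) \<le> Q"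
    unfolding Q_def norm_divide by (intro divide_right_mono; simp)+
  have Q0: "0 \<le> Q" using Q(1) norm_ge_zero order_trans by blast
  define A where "A = K * pi + L1_norm w * (K * pi) + 1"
  have A0: "0 \<le> A" using K L1_norm_nonneg[of w] by (simp add: A_def)
  define C where "C = K * pi + 4 * Q * A * K + 4 * Q * A * (K * pi)"
  show thesis
  proof (rule that[of C])
    show "0 \<le> C" using K Q0 A0 by (simp add: C_def)
    fix f :: "real \<Rightarrow> complex" assume f: "f absolutely_integrable_on {0..pi}"
    obtain y y1 where y: "ivp (\<lambda>x. w x * y x + f x) y y1" "y 0 = 0" "y1 0 = 0"
      "\<And>x. x \<in> {0..pi} \<Longrightarrow> norm (y x) \<le> K * (norm (0::complex) + pi * norm (0::complex) + pi * L1_norm f)"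
      using initial_value_exists[OF w f, of 0 0] unfolding K_def by blast
    have f0: "0 \<le> L1_norm f" by (rule L1_norm_nonneg)
    have ybd: "norm (y x) \<le> K * pi * L1_norm f" if "x \<in> {0..pi}" for x using y(4)[OF that] by simp
    have y1bd: "norm (y1 x) \<le> (L1_norm w * (K * pi) + 1) * L1_norm f" if x: "x \<in> {0..pi}" for x
    proof -
      note cy = ivp_continuous(1)[OF y(1)]
      have wy: "(\<lambda>t. w t * y t) absolutely_integrable_on {0..pi}" by (rule absolutely_integrable_mult_continuous[OF w cy])
      have "y1 x = integral {0..x} (\<lambda>t. w t * y t + f t)" using ivp_eq[OF y(1) x] y(3) by simp
      also have "\<dots> = integral {0..x} (\<lambda>t. w t * y t) + integral {0..x} f"
        using abs_integrable_sub(1)[OF wy, of 0 x] abs_integrable_sub(1)[OF f, of 0 x] x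
        by (simp add: Henstock_Kurzweil_Integration.integral_add)
      finally have "norm (y1 x) \<le> norm (integral {0..x} (\<lambda>t. w t * y t)) + norm (integral {0..x} f)"
        using norm_triangle_ineq by metis
      also have "\<dots> \<le> L1_norm (\<lambda>t. w t * y t) + L1_norm f"
        using x by (intro add_mono norm_integral_le_L1_norm wy f) auto
      also have "L1_norm (\<lambda>t. w t * y t) \<le> integral {0..pi} (\<lambda>t. norm (w t) * (K * pi * L1_norm f))"
      proof (rule integral_le)
        show "(\<lambda>t. norm (w t * y t)) integrable_on {0..pi}" using abs_integrable_sub[OF wy] by simp
        show "(\<lambda>t. norm (w t) * (K * pi * L1_norm f)) integrable_on {0..pi}"
          using abs_integrable_sub[OF w] by (intro integrable_on_mult_left) auto
        show "norm (w t * y t) \<le> norm (w t) * (K * pi * L1_norm f)" if "t \<in> {0..pi}" for t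
          unfolding norm_mult using ybd[OF that] by (intro mult_left_mono) auto
      qed
      also have "\<dots> = L1_norm w * (K * pi * L1_norm f)" by simp
      finally show ?thesis by (simp add: algebra_simps)
    qed
    have Abd: "norm (y x) \<le> A * L1_norm f" "norm (y1 x) \<le> A * L1_norm f" if "x \<in> {0..pi}" for x
    proof -
      have "K * pi * L1_norm f \<le> A * L1_norm f" "(L1_norm w * (K * pi) + 1) * L1_norm f \<le> A * L1_norm f"
        using f0 K L1_norm_nonneg[of w] by (auto intro!: mult_right_mono simp: A_def)
      then show "norm (y x) \<le> A * L1_norm f" "norm (y1 x) \<le> A * L1_norm f"
        using ybd[OF that] y1bd[OF that] by linarith+
    qed
    obtain p q where pq: "bc_vals bc y y1 = (p, q)" by force
    have pqbd: "norm p \<le> 2 * (A * L1_norm f)" "norm q \<le> 2 * (A * L1_norm f)"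
      using bc_vals_bound[of y "A * L1_norm f" y1 bc] Abd pq by auto
    \<comment> \<open>Cramer's rule for the coefficients that cancel the boundary values
      \<open>(p, q)\<close> of the particular solution.\<close>
    define a where "a = m12 / \<Delta> * q - m22 / \<Delta> * p"
    define b where "b = m21 / \<Delta> * p - m11 / \<Delta> * q"
    have ab: "norm a \<le> 4 * Q * A * L1_norm f" "norm b \<le> 4 * Q * A * L1_norm f"
    proof -
      have "norm a \<le> Q * (2 * (A * L1_norm f)) + Q * (2 * (A * L1_norm f))"
        unfolding a_def by (rule order_trans[OF norm_triangle_ineq4])
          (unfold norm_mult, intro add_mono mult_mono Q pqbd Q0 norm_ge_zero)
      then show "norm a \<le> 4 * Q * A * L1_norm f" by (simp add: algebra_simps)
      have "norm b \<le> Q * (2 * (A * L1_norm f)) + Q * (2 * (A * L1_norm f))"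
        unfolding b_def by (rule order_trans[OF norm_triangle_ineq4])
          (unfold norm_mult, intro add_mono mult_mono Q pqbd Q0 norm_ge_zero)
      then show "norm b \<le> 4 * Q * A * L1_norm f" by (simp add: algebra_simps)
    qed
    let ?h = "\<lambda>x. a * c x + b * s x" and ?h1 = "\<lambda>x. a * c1 x + b * s1 x"
    let ?u = "\<lambda>x. 1 * y x + 1 * ?h x" and ?u1 = "\<lambda>x. 1 * y1 x + 1 * ?h1 x"
    have "ivp (\<lambda>x. 1 * (w x * y x + f x) + 1 * (a * (w x * c x + 0) + b * (w x * s x + 0))) ?u ?u1"
      by (rule ivp_lincomb[OF y(1) ivp_lincomb[OF c(1) s(1)]])
    then have "ivp (\<lambda>x. (v x - z) * ?u x + f x) ?u ?u1" by (simp add: w_def algebra_simps)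
    moreover have "bc_vals bc ?u ?u1 = (0, 0)"
    proof -
      have "p + (a * m11 + b * m12) = 0" "q + (a * m21 + b * m22) = 0"
      proof -
        have "\<Delta> * (p + (a * m11 + b * m12)) = 0" "\<Delta> * (q + (a * m21 + b * m22)) = 0"
          using \<open>\<Delta> \<noteq> 0\<close> unfolding a_def b_def
          by (simp_all add: distrib_left right_diff_distrib left_diff_distrib) (simp_all add: \<Delta>_def algebra_simps)
        then show "p + (a * m11 + b * m12) = 0" "q + (a * m21 + b * m22) = 0" using \<open>\<Delta> \<noteq> 0\<close> by simp_all
      qed
      then show ?thesis unfolding bc_vals_lincomb using pq M1 M2 by simp
    qed
    ultimately have "bvp bc v z f ?u" by (auto simp: bvp_def)
    moreover have "norm (?u x) \<le> C * L1_norm f" if x: "x \<in> {0..pi}" for x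
    proof -
      have "norm (?u x) \<le> norm (y x) + (norm a * norm (c x) + norm b * norm (s x))"
        by (metis mult_1 norm_mult norm_triangle_le norm_triangle_ineq add_left_mono)
      also have "\<dots> \<le> K * pi * L1_norm f + ((4 * Q * A * L1_norm f) * K + (4 * Q * A * L1_norm f) * (K * pi))"
        using ab cs_bd[OF x] ybd[OF x] K Q0 A0 f0 by (intro add_mono mult_mono) auto
      also have "\<dots> = C * L1_norm f" by (simp add: C_def algebra_simps)
      finally show ?thesis .
    qed
    ultimately show "\<exists>y. bvp bc v z f y \<and> (\<forall>x\<in>{0..pi}. norm (y x) \<le> C * L1_norm f)" by blast
  qed
qed

section \<open>A priori estimates\<close>

lemma abs_cont_on_exp: "abs_cont_on 0 pi (\<lambda>t. exp (\<kappa> * of_real t))"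
proof -
  have c: "continuous_on {0..pi} (\<lambda>t. \<kappa> * exp (\<kappa> * complex_of_real t))" by (intro continuous_intros)
  have ftc: "((\<lambda>t. \<kappa> * exp (\<kappa> * complex_of_real t)) has_integral (exp (\<kappa> * of_real t) - exp (\<kappa> * of_real 0))) {0..t}"
    if "0 \<le> t" for t
    using that by (intro fundamental_theorem_of_calculus)
      (auto intro!: derivative_eq_intros has_vector_derivative_real_field)
  show ?thesis
  proof (rule abs_cont_on_dominated[OF abs_cont_on_integral[OF absolutely_integrable_continuous_real[OF c]]])
    show "norm (exp (\<kappa> * complex_of_real t) - exp (\<kappa> * complex_of_real s))
      \<le> norm (integral {0..t} (\<lambda>t. \<kappa> * exp (\<kappa> * complex_of_real t)) - integral {0..s} (\<lambda>t. \<kappa> * exp (\<kappa> * complex_of_real t)))"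
      if "0 \<le> s" "s < t" for s t
      using that integral_unique[OF ftc[of s]] integral_unique[OF ftc[of t]] by simp
  qed simp
qed

text \<open>The integrating factor: \<open>(e\<^bsup>-\<kappa>t\<^esup> (y' + \<kappa> y))' = e\<^bsup>-\<kappa>t\<^esup> (y'' - \<kappa>\<^sup>2 y)\<close>.\<close>

lemma ivp_integrating_factor:
  assumes y: "ivp (\<lambda>x. G x + \<kappa>\<^sup>2 * y x) y y1" and st: "0 \<le> s" "s \<le> t" "t \<le> pi"
  shows "((\<lambda>r. exp (- \<kappa> * of_real r) * G r) has_integral
    (exp (- \<kappa> * of_real t) * (y1 t + \<kappa> * y t) - exp (- \<kappa> * of_real s) * (y1 s + \<kappa> * y s))) {s..t}"
proof -
  let ?F = "\<lambda>x. G x + \<kappa>\<^sup>2 * y x"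
  \<comment> \<open>Reduction of order: almost everywhere \<open>q' = \<kappa> * q + G\<close>, and
    multiplication by the decaying or growing exponential removes \<open>q\<close> from the
    right-hand side.\<close>
  define q where "q x = y1 x + \<kappa> * y x" for x
  define P where "P x = ?F x + \<kappa> * y1 x" for x
  note F = ivp_integrable[OF y] and cont = ivp_continuous[OF y]
  have P: "P absolutely_integrable_on {0..pi}"
    unfolding P_def by (intro set_integral_add(1)[OF F] absolutely_integrable_continuous_real continuous_intros cont)
  have q: "q x = q 0 + integral {0..x} P" if x: "x \<in> {0..pi}" for x
  proof -
    have y1int: "(y1 has_integral (y x - y 0)) {0..x}"
      using x by (intro fundamental_theorem_of_calculus has_vector_derivative_within_subset[OF ivp_deriv[OF y]]) auto
    have "integral {0..x} P = integral {0..x} ?F + integral {0..x} (\<lambda>x. \<kappa> * y1 x)"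
      unfolding P_def using abs_integrable_sub(1)[OF F, of 0 x] y1int x
      by (intro Henstock_Kurzweil_Integration.integral_add) (auto intro!: integrable_on_mult_right)
    also have "\<dots> = integral {0..x} ?F + \<kappa> * (y x - y 0)" using integral_unique[OF y1int] by simp
    finally show ?thesis using ivp_eq[OF y x] by (simp add: q_def algebra_simps)
  qed
  obtain N where N: "negligible N"
    "\<And>x. x \<in> {0..pi} - N \<Longrightarrow> ((\<lambda>x. integral {0..x} P) has_vector_derivative P x) (at x within {0..pi})"
    using integral_has_vector_derivative_AE[OF P pi_gt_zero] by blast
  have qd: "(q has_vector_derivative P x) (at x within {0..pi})" if x: "x \<in> {0..pi} - N" for x
  proof -
    have "((\<lambda>x. q 0 + integral {0..x} P) has_vector_derivative 0 + P x) (at x within {0..pi})"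
      by (intro has_vector_derivative_add has_vector_derivative_const N(2) x)
    then have "((\<lambda>x. q 0 + integral {0..x} P) has_vector_derivative P x) (at x within {0..pi})" by simp
    then show ?thesis
    proof (rule has_vector_derivative_transform[rotated 2])
      show "x \<in> {0..pi}" using x by blast
      show "q t = q 0 + integral {0..t} P" if "t \<in> {0..pi}" for t using q[OF that] .
    qed
  qed
  have qac: "abs_cont_on 0 pi q"
  proof (rule abs_cont_on_dominated[OF abs_cont_on_integral[OF P]])
    show "norm (q t - q s) \<le> norm (integral {0..t} P - integral {0..s} P)" if "0 \<le> s" "s < t" "t \<le> pi" for s t
    proof -
      have "q t = q 0 + integral {0..t} P" by (rule q) (use that in auto)
      moreover have "q s = q 0 + integral {0..s} P" by (rule q) (use that in auto)
      ultimately have "q t - q s = integral {0..t} P - integral {0..s} P" by (metis add_diff_cancel_left)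
      then show ?thesis by simp
    qed
  qed simp
  have ac: "abs_cont_on 0 pi (\<lambda>r. exp (- \<kappa> * of_real r) * q r)"
    by (intro abs_cont_on_mult abs_cont_on_exp qac)
  have "((\<lambda>r. exp (- \<kappa> * of_real r) * G r) has_integral
      (exp (- \<kappa> * of_real t) * q t - exp (- \<kappa> * of_real s) * q s)) {s..t}"
  proof (rule abs_cont_on_FTC[OF abs_cont_on_subset[OF ac] st(2) N(1)])
    fix x assume x: "x \<in> {s..t} - N"
    then have x': "x \<in> {0..pi} - N" using st by auto
    have e: "((\<lambda>r. exp (- \<kappa> * complex_of_real r)) has_vector_derivative - \<kappa> * exp (- \<kappa> * of_real x)) (at x within {s..t})"
      by (auto intro!: derivative_eq_intros has_vector_derivative_real_field)
    have "((\<lambda>r. exp (- \<kappa> * complex_of_real r) * q r) has_vector_derivative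
        exp (- \<kappa> * of_real x) * P x + - \<kappa> * exp (- \<kappa> * of_real x) * q x) (at x within {s..t})"
      using st by (intro has_vector_derivative_mult e has_vector_derivative_within_subset[OF qd[OF x']]) auto
    also have "exp (- \<kappa> * complex_of_real x) * P x + - \<kappa> * exp (- \<kappa> * of_real x) * q x = exp (- \<kappa> * complex_of_real x) * G x"
      by (simp add: P_def q_def algebra_simps power2_eq_square)
    finally show "((\<lambda>r. exp (- \<kappa> * complex_of_real r) * q r) has_vector_derivative exp (- \<kappa> * complex_of_real x) * G x) (at x within {s..t})" .
  qed (use st in auto)
  then show ?thesis by (simp add: q_def)
qed

text \<open>The kernel \<open>e\<^bsup>-\<sigma>|x-t|\<^esup>\<close> bounds the Green function of the free problem, up to its reflections
  at the endpoints.\<close>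

definition kernel_bound :: "real \<Rightarrow> (real \<Rightarrow> complex) \<Rightarrow> real \<Rightarrow> bool" where
  "kernel_bound \<sigma> G H \<longleftrightarrow> G absolutely_integrable_on {0..pi} \<and>
     (\<forall>x\<in>{0..pi}. integral {0..pi} (\<lambda>t. exp (- (\<sigma> * \<bar>x - t\<bar>)) * norm (G t)) \<le> H)"

lemma integrable_kernel:
  fixes G :: "real \<Rightarrow> complex"
  assumes "G absolutely_integrable_on {0..pi}" "0 \<le> s" "t \<le> pi"
  shows "(\<lambda>t. exp (- (\<sigma> * \<bar>x - t\<bar>)) * norm (G t)) integrable_on {s..t}"
proof -
  have "continuous_on {0..pi} (\<lambda>t. complex_of_real (exp (- (\<sigma> * \<bar>x - t\<bar>))))" by (intro continuous_intros)
  then have "(\<lambda>t. G t * complex_of_real (exp (- (\<sigma> * \<bar>x - t\<bar>)))) absolutely_integrable_on {0..pi}"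
    by (rule absolutely_integrable_mult_continuous[OF assms(1)])
  from abs_integrable_sub(2)[OF this assms(2,3)] show ?thesis by (simp add: norm_mult mult.commute)
qed

text \<open>The product of the two factors is \<open>1 - E\<^sup>2\<close>, and each has modulus at
  most 2. One condition on \<open>\<mu>\<close> thereby covers the periodic, antiperiodic and
  Dirichlet problems, whose denominators are \<open>1 - E\<close>, \<open>1 + E\<close> and
  \<open>1 - E\<^sup>2\<close>.\<close>

lemma one_minus_square_lower:
  fixes E :: complex
  assumes "norm E \<le> 1" "1 / 2 \<le> norm (1 - E\<^sup>2)"
  shows "1 / 4 \<le> norm (1 - E)" "1 / 4 \<le> norm (1 + E)"
proof -
  have eq: "norm (1 - E\<^sup>2) = norm (1 - E) * norm (1 + E)"
    by (simp add: norm_mult[symmetric] power2_eq_square algebra_simps)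
  have le: "norm (1 - E) \<le> 2" "norm (1 + E) \<le> 2"
    using norm_triangle_ineq4[of 1 E] norm_triangle_ineq[of 1 E] assms(1) by auto
  have "norm (1 - E) * norm (1 + E) \<le> norm (1 - E) * 2" "norm (1 - E) * norm (1 + E) \<le> 2 * norm (1 + E)"
    using le by (auto intro!: mult_left_mono mult_right_mono)
  then show "1 / 4 \<le> norm (1 - E)" "1 / 4 \<le> norm (1 + E)" using assms(2) eq by linarith+
qed

lemma quotient_bound:
  fixes a d :: complex
  assumes "d * a = b" "r \<le> norm d" "0 < r" "norm b \<le> B"
  shows "norm a \<le> B / r"
proof -
  have "r * norm a \<le> norm d * norm a" using assms by (intro mult_right_mono) auto
  also have "\<dots> = norm b" using assms(1) by (metis norm_mult)
  finally show ?thesis using assms by (simp add: field_simps)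
qed

text \<open>The integrating factor for one sign of \<open>\<i> * \<mu>\<close> is applied to the
  left of the point, for the other sign to the right, so that no growing exponential occurs; the sum
  of the two relations eliminates \<open>y1\<close>. The constant 5 rounds up
  \<open>(1 + 4 + 4) / 2\<close>: one source term and two boundary amplitudes of size at most
  \<open>4 * H\<close>.\<close>

lemma free_a_priori:
  assumes y: "ivp (\<lambda>x. G x - \<mu>\<^sup>2 * y x) y y1" and bc: "bc_vals bc y y1 = (0, 0)"
    and \<mu>: "0 \<le> Im \<mu>" "\<mu> \<noteq> 0" "1 / 2 \<le> norm (1 - (exp (\<i> * \<mu> * of_real pi))\<^sup>2)"
    and H: "kernel_bound (Im \<mu>) G H" and x: "x \<in> {0..pi}"
  shows "norm (y x) \<le> 5 * H / norm \<mu>"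
proof -
  define \<sigma> where "\<sigma> = Im \<mu>"
  define e where "e t = exp (\<i> * \<mu> * complex_of_real t)" for t
  have e_add: "e (s + t) = e s * e t" for s t by (simp add: e_def exp_add[symmetric] algebra_simps)
  have e0: "e 0 = 1" by (simp add: e_def)
  have ne: "norm (e t) = exp (- (\<sigma> * t))" for t by (simp add: e_def \<sigma>_def)
  define E where "E = e pi"
  have E: "norm E \<le> 1" unfolding E_def ne using \<mu>(1) by (simp add: \<sigma>_def)
  have E2: "1 / 2 \<le> norm (1 - E\<^sup>2)" using \<mu>(3) by (simp add: E_def e_def)
  have G: "G absolutely_integrable_on {0..pi}" using H by (simp add: kernel_bound_def)
  have HH: "integral {0..pi} (\<lambda>t. exp (- (\<sigma> * \<bar>r - t\<bar>)) * norm (G t)) \<le> H" if "r \<in> {0..pi}" for r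
    using H that by (simp add: kernel_bound_def \<sigma>_def)
  have H0: "0 \<le> H"
  proof -
    have "0 \<le> integral {0..pi} (\<lambda>t. exp (- (\<sigma> * \<bar>x - t\<bar>)) * norm (G t))"
      by (intro integral_nonneg integrable_kernel G) auto
    then show ?thesis using HH[OF x] by linarith
  qed
  have ya: "ivp (\<lambda>x. G x + (\<i> * \<mu>)\<^sup>2 * y x) y y1" using y by (simp add: power_mult_distrib)
  have yb: "ivp (\<lambda>x. G x + (- (\<i> * \<mu>))\<^sup>2 * y x) y y1" using y by (simp add: power_mult_distrib)
  define I1 where "I1 r = integral {0..r} (\<lambda>t. e (r - t) * G t)" for r
  define I2 where "I2 r = integral {r..pi} (\<lambda>t. e (t - r) * G t)" for r
  \<comment> \<open>The amplitudes of the waves emitted at the two end points; the equation leaves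
    them free and the boundary conditions determine them.\<close>
  define \<alpha> where "\<alpha> = y1 0 + \<i> * \<mu> * y 0"
  define \<beta> where "\<beta> = - (y1 pi - \<i> * \<mu> * y pi)"
  have I1: "((\<lambda>t. e (r - t) * G t) has_integral (y1 r + \<i> * \<mu> * y r - e r * \<alpha>)) {0..r}" if r: "r \<in> {0..pi}" for r
  proof -
    have "((\<lambda>t. e r * (exp (- (\<i> * \<mu>) * of_real t) * G t)) has_integral
       e r * (exp (- (\<i> * \<mu>) * of_real r) * (y1 r + \<i> * \<mu> * y r) - exp (- (\<i> * \<mu>) * of_real 0) * (y1 0 + \<i> * \<mu> * y 0))) {0..r}"
      using r by (intro has_integral_mult_right ivp_integrating_factor[OF ya]) auto
    moreover have key: "e r * (exp (- (\<i> * \<mu>) * complex_of_real t) * c) = e (r - t) * c" for t c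
    proof -
      have "e r * exp (- (\<i> * \<mu>) * complex_of_real t) = e (r - t)"
        unfolding e_def exp_add[symmetric] by (simp add: algebra_simps)
      then show ?thesis by (metis mult.assoc)
    qed
    ultimately have "((\<lambda>t. e (r - t) * G t) has_integral
        (e (r - r) * (y1 r + \<i> * \<mu> * y r) - e (r - 0) * (y1 0 + \<i> * \<mu> * y 0))) {0..r}"
      unfolding right_diff_distrib key by simp
    then show ?thesis using e0 by (simp add: \<alpha>_def)
  qed
  have I2: "((\<lambda>t. e (t - r) * G t) has_integral (- (e (pi - r) * \<beta>) - (y1 r - \<i> * \<mu> * y r))) {r..pi}" if r: "r \<in> {0..pi}" for r
  proof -
    have "((\<lambda>t. e (- r) * (exp (- (- (\<i> * \<mu>)) * of_real t) * G t)) has_integral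
       e (- r) * (exp (- (- (\<i> * \<mu>)) * of_real pi) * (y1 pi + - (\<i> * \<mu>) * y pi) - exp (- (- (\<i> * \<mu>)) * of_real r) * (y1 r + - (\<i> * \<mu>) * y r))) {r..pi}"
      using r by (intro has_integral_mult_right ivp_integrating_factor[OF yb]) auto
    moreover have key: "e (- r) * (exp (- (- (\<i> * \<mu>)) * complex_of_real t) * c) = e (t - r) * c" for t c
    proof -
      have "e (- r) * exp (- (- (\<i> * \<mu>)) * complex_of_real t) = e (t - r)"
        unfolding e_def exp_add[symmetric] by (simp add: algebra_simps)
      then show ?thesis by (metis mult.assoc)
    qed
    ultimately have "((\<lambda>t. e (t - r) * G t) has_integral
        (e (pi - r) * (y1 pi + - (\<i> * \<mu>) * y pi) - e (r - r) * (y1 r + - (\<i> * \<mu>) * y r))) {r..pi}"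
      unfolding right_diff_distrib key by simp
    moreover have "- (e (pi - r) * \<beta>) = e (pi - r) * (y1 pi - \<i> * \<mu> * y pi)"
      by (simp add: \<beta>_def algebra_simps)
    ultimately show ?thesis using e0 by simp
  qed
  \<comment> \<open>The two integrals cover complementary parts of \<open>{0..pi}\<close> with the
    same kernel, so together they cost \<open>H\<close> once.\<close>
  have Isum: "norm (I1 r) + norm (I2 r) \<le> H" if r: "r \<in> {0..pi}" for r
  proof -
    have "norm (I1 r) \<le> integral {0..r} (\<lambda>t. exp (- (\<sigma> * \<bar>r - t\<bar>)) * norm (G t))"
      unfolding I1_def using I1[OF r] r G
      by (intro integral_norm_bound_integral integrable_kernel) (auto simp: norm_mult ne)
    moreover have "norm (I2 r) \<le> integral {r..pi} (\<lambda>t. exp (- (\<sigma> * \<bar>r - t\<bar>)) * norm (G t))"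
      unfolding I2_def using I2[OF r] r G
      by (intro integral_norm_bound_integral integrable_kernel) (auto simp: norm_mult ne)
    moreover have "integral {0..r} (\<lambda>t. exp (- (\<sigma> * \<bar>r - t\<bar>)) * norm (G t)) + integral {r..pi} (\<lambda>t. exp (- (\<sigma> * \<bar>r - t\<bar>)) * norm (G t))
        = integral {0..pi} (\<lambda>t. exp (- (\<sigma> * \<bar>r - t\<bar>)) * norm (G t))"
      using r by (intro Henstock_Kurzweil_Integration.integral_combine integrable_kernel G) auto
    ultimately show ?thesis using HH[OF r] by linarith
  qed
  have i1: "I1 r = y1 r + \<i> * \<mu> * y r - e r * \<alpha>" and i2: "I2 r = - (e (pi - r) * \<beta>) - (y1 r - \<i> * \<mu> * y r)"
    if "r \<in> {0..pi}" for r
    using integral_unique[OF I1[OF that]] integral_unique[OF I2[OF that]] by (simp_all add: I1_def I2_def)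
  define A where "A = I2 0"
  define B where "B = I1 pi"
  have nA: "norm A \<le> H" using Isum[of 0] norm_ge_zero[of "I1 0"] pi_ge_zero unfolding A_def atLeastAtMost_iff by linarith
  have nB: "norm B \<le> H" using Isum[of pi] norm_ge_zero[of "I2 pi"] pi_ge_zero unfolding B_def atLeastAtMost_iff by linarith
  have eqB: "B = y1 pi + \<i> * \<mu> * y pi - E * \<alpha>" using i1[of pi] by (simp add: B_def E_def)
  have eqA: "A = - (E * \<beta>) - (y1 0 - \<i> * \<mu> * y 0)" using i2[of 0] by (simp add: A_def E_def)
  have r14: "0 < (1 / 4 :: real)" "0 < (1 / 2 :: real)" by simp_all
  \<comment> \<open>A wave crosses the interval with factor \<open>E\<close>. Inserted into the
    boundary conditions this leaves linear equations for the amplitudes, with denominators at least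
    \<open>1 / 4\<close> in the periodic and antiperiodic cases and at least \<open>1 / 2\<close> in
    the Dirichlet case.\<close>
  have \<alpha>\<beta>: "norm \<alpha> \<le> 4 * H \<and> norm \<beta> \<le> 4 * H"
  proof (cases bc)
    case Per_plus
    then have p: "y pi = y 0" "y1 pi = y1 0" using bc by auto
    have "(1 - E) * \<alpha> = B" "(1 - E) * \<beta> = A" using eqA eqB p by (simp_all add: \<alpha>_def \<beta>_def algebra_simps)
    then have "norm \<alpha> \<le> H / (1 / 4)" "norm \<beta> \<le> H / (1 / 4)"
      using one_minus_square_lower[OF E E2] nA nB r14 by (blast intro: quotient_bound)+
    then show ?thesis by simp
  next
    case Per_minus
    then have p: "y pi = - y 0" "y1 pi = - y1 0" using bc by (auto simp: add_eq_0_iff2)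
    have "(1 + E) * \<alpha> = - B" "(1 + E) * \<beta> = - A" unfolding eqA eqB \<alpha>_def \<beta>_def p by (simp_all add: algebra_simps)
    moreover have "norm (- A) \<le> H" "norm (- B) \<le> H" using nA nB by simp_all
    ultimately have "norm \<alpha> \<le> H / (1 / 4)" "norm \<beta> \<le> H / (1 / 4)"
      using one_minus_square_lower[OF E E2] r14 by (blast intro: quotient_bound)+
    then show ?thesis by simp
  next
    case Dir
    then have p: "y pi = 0" "y 0 = 0" using bc by auto
    have "(1 - E\<^sup>2) * \<alpha> = E * B - A" "(1 - E\<^sup>2) * \<beta> = E * A - B"
      unfolding eqA eqB \<alpha>_def \<beta>_def p by (simp_all add: algebra_simps power2_eq_square)
    moreover have "norm (E * B - A) \<le> 2 * H" "norm (E * A - B) \<le> 2 * H"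
    proof -
      have "norm (E * B) \<le> 1 * H" "norm (E * A) \<le> 1 * H" unfolding norm_mult using E nA nB H0 by (intro mult_mono; simp)+
      then show "norm (E * B - A) \<le> 2 * H" "norm (E * A - B) \<le> 2 * H"
        using norm_triangle_ineq4[of "E * B" A] norm_triangle_ineq4[of "E * A" B] nA nB by linarith+
    qed
    ultimately have "norm \<alpha> \<le> (2 * H) / (1 / 2)" "norm \<beta> \<le> (2 * H) / (1 / 2)"
      using E2 r14 by (blast intro: quotient_bound)+
    then show ?thesis by simp
  qed
  have "2 * \<i> * \<mu> * y x = I1 x + I2 x + (e x * \<alpha> + e (pi - x) * \<beta>)"
    unfolding i1[OF x] i2[OF x] by (simp add: algebra_simps)
  then have "norm (2 * \<i> * \<mu> * y x) \<le> norm (I1 x + I2 x) + norm (e x * \<alpha> + e (pi - x) * \<beta>)"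
    using norm_triangle_ineq by metis
  also have "\<dots> \<le> (norm (I1 x) + norm (I2 x)) + (norm (e x * \<alpha>) + norm (e (pi - x) * \<beta>))"
    by (intro add_mono norm_triangle_ineq)
  also have "norm (e x * \<alpha>) \<le> 1 * (4 * H)"
    unfolding norm_mult ne using \<alpha>\<beta> \<mu>(1) x by (intro mult_mono) (auto simp: \<sigma>_def)
  also have "norm (e (pi - x) * \<beta>) \<le> 1 * (4 * H)"
    unfolding norm_mult ne using \<alpha>\<beta> \<mu>(1) x by (intro mult_mono) (auto simp: \<sigma>_def)
  finally have "2 * norm \<mu> * norm (y x) \<le> 9 * H" using Isum[OF x] by (simp add: norm_mult)
  then have "norm \<mu> * norm (y x) \<le> 5 * H" using H0 by linarith
  then show ?thesis using \<mu>(2) by (simp add: field_simps)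
qed

text \<open>The squared exponential is \<open>exp (2 * pi * \<i> * \<mu>)\<close>, so the condition
  keeps \<open>\<mu>\<close> away from the integers, whose squares contain the free eigenvalues for
  all three boundary conditions.\<close>

definition good :: "complex \<Rightarrow> bool" where
  "good \<mu> \<longleftrightarrow> 0 \<le> Im \<mu> \<and> \<mu> \<noteq> 0 \<and> 1 / 2 \<le> norm (1 - (exp (\<i> * \<mu> * of_real pi))\<^sup>2)"

lemma free_bvp_a_priori:
  assumes y: "bvp bc (\<lambda>_. 0) (\<mu>\<^sup>2) f y" and \<mu>: "good \<mu>" and H: "kernel_bound (Im \<mu>) f H" and x: "x \<in> {0..pi}"
  shows "norm (y x) \<le> 5 * H / norm \<mu>"
proof -
  obtain y1 where y1: "ivp (\<lambda>x. (0 - \<mu>\<^sup>2) * y x + f x) y y1" "bc_vals bc y y1 = (0, 0)" using y by (auto simp: bvp_def)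
  have "ivp (\<lambda>x. f x - \<mu>\<^sup>2 * y x) y y1" using y1(1) by (simp add: algebra_simps)
  from free_a_priori[OF this y1(2) _ _ _ H x] \<mu> show ?thesis by (simp add: good_def)
qed

section \<open>Perturbation by the potential\<close>

lemma kernel_bound_L1:
  assumes f: "f absolutely_integrable_on {0..pi}" and \<sigma>: "0 \<le> \<sigma>"
  shows "kernel_bound \<sigma> f (L1_norm f)"
  unfolding kernel_bound_def
proof (intro conjI ballI f)
  fix x :: real
  show "integral {0..pi} (\<lambda>t. exp (- (\<sigma> * \<bar>x - t\<bar>)) * norm (f t)) \<le> L1_norm f"
    using f \<sigma> abs_integrable_sub(2)[OF f, of 0 pi]
    by (intro integral_le integrable_kernel) (auto intro!: mult_left_le_one_le)
qed

lemma bvp_to_free: "bvp bc v z f y \<Longrightarrow> bvp bc (\<lambda>_. 0) z (\<lambda>x. v x * y x + f x) y"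
  by (erule bvp_shift) (simp add: algebra_simps)

lemma L1_norm_mult_le:
  assumes v: "v absolutely_integrable_on {0..pi}" and y: "continuous_on {0..pi} y"
    and m: "\<And>x. x \<in> {0..pi} \<Longrightarrow> norm (y x) \<le> m"
  shows "L1_norm (\<lambda>x. v x * y x) \<le> L1_norm v * m"
proof -
  have "L1_norm (\<lambda>x. v x * y x) \<le> integral {0..pi} (\<lambda>x. norm (v x) * m)"
  proof (rule integral_le)
    show "(\<lambda>x. norm (v x * y x)) integrable_on {0..pi}"
      using abs_integrable_sub(2)[OF absolutely_integrable_mult_continuous[OF v y], of 0 pi] by simp
    show "(\<lambda>x. norm (v x) * m) integrable_on {0..pi}"
      using abs_integrable_sub(2)[OF v, of 0 pi] by (intro integrable_on_mult_left) auto
    show "norm (v x * y x) \<le> norm (v x) * m" if "x \<in> {0..pi}" for x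
      unfolding norm_mult using m[OF that] by (intro mult_left_mono) auto
  qed
  then show ?thesis by simp
qed

text \<open>The potential term is treated as a source of L^1 size at most \<open>L1_norm v\<close>
  times the maximum of \<open>norm y\<close>; at a maximum point the size of \<open>\<mu>\<close>
  lets half of the left-hand side absorb it. As this holds for any solution, \<open>f = 0\<close>
  excludes eigenvalues.\<close>

lemma bvp_a_priori:
  assumes y: "bvp bc v (\<mu>\<^sup>2) f y" and \<mu>: "good \<mu>" and v: "v absolutely_integrable_on {0..pi}"
    and f: "f absolutely_integrable_on {0..pi}" and big: "10 * L1_norm v \<le> norm \<mu>" and x: "x \<in> {0..pi}"
  shows "norm (y x) \<le> 10 * L1_norm f / norm \<mu>"
proof -
  note cy = bvp_continuous[OF y]
  have "continuous_on {0..pi} (\<lambda>x. norm (y x))" by (intro continuous_intros cy)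
  then obtain t where t: "t \<in> {0..pi}" "\<And>x. x \<in> {0..pi} \<Longrightarrow> norm (y x) \<le> norm (y t)"
    using continuous_attains_sup[of "{0..pi}" "\<lambda>x. norm (y x)"] by auto
  define m where "m = norm (y t)"
  have vy: "(\<lambda>x. v x * y x) absolutely_integrable_on {0..pi}" by (rule absolutely_integrable_mult_continuous[OF v cy])
  have g: "(\<lambda>x. v x * y x + f x) absolutely_integrable_on {0..pi}" using vy f by (rule set_integral_add)
  have \<mu>0: "0 < norm \<mu>" "0 \<le> Im \<mu>" using \<mu> by (auto simp: good_def)
  have "L1_norm (\<lambda>x. v x * y x + f x) \<le> integral {0..pi} (\<lambda>x. norm (v x * y x) + norm (f x))"
    using abs_integrable_sub(2)[OF g, of 0 pi] abs_integrable_sub(2)[OF vy, of 0 pi] abs_integrable_sub(2)[OF f, of 0 pi]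
    by (intro integral_le integrable_add norm_triangle_ineq) auto
  also have "\<dots> = L1_norm (\<lambda>x. v x * y x) + L1_norm f"
    using abs_integrable_sub(2)[OF vy, of 0 pi] abs_integrable_sub(2)[OF f, of 0 pi]
    by (intro Henstock_Kurzweil_Integration.integral_add) auto
  also have "\<dots> \<le> L1_norm v * m + L1_norm f"
    using L1_norm_mult_le[OF v cy, of m] t(2) by (simp add: m_def)
  finally have g_le: "L1_norm (\<lambda>x. v x * y x + f x) \<le> L1_norm v * m + L1_norm f" .
  have "m \<le> 5 * L1_norm (\<lambda>x. v x * y x + f x) / norm \<mu>"
    unfolding m_def by (rule free_bvp_a_priori[OF bvp_to_free[OF y] \<mu> kernel_bound_L1[OF g \<mu>0(2)] t(1)])
  also have "\<dots> \<le> 5 * (L1_norm v * m + L1_norm f) / norm \<mu>"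
    using g_le \<mu>0 by (intro divide_right_mono mult_left_mono) auto
  finally have "m * norm \<mu> \<le> 5 * (L1_norm v * m + L1_norm f)" using \<mu>0 by (simp add: field_simps)
  moreover have "10 * L1_norm v * m \<le> norm \<mu> * m" using big by (intro mult_right_mono) (auto simp: m_def)
  ultimately have "m * norm \<mu> \<le> 10 * L1_norm f" by (simp add: algebra_simps)
  then have "m \<le> 10 * L1_norm f / norm \<mu>" using \<mu>0 by (simp add: field_simps)
  then show ?thesis using t(2)[OF x] by (simp add: m_def)
qed

lemma kernel_bound_mult:
  assumes v: "kernel_bound \<sigma> v H" and y: "continuous_on {0..pi} y" "\<And>x. x \<in> {0..pi} \<Longrightarrow> norm (y x) \<le> m"
  shows "kernel_bound \<sigma> (\<lambda>x. v x * y x) (H * m)"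
  unfolding kernel_bound_def
proof (intro conjI ballI)
  have va: "v absolutely_integrable_on {0..pi}" using v by (simp add: kernel_bound_def)
  show vy: "(\<lambda>x. v x * y x) absolutely_integrable_on {0..pi}" by (rule absolutely_integrable_mult_continuous[OF va y(1)])
  fix x assume x: "x \<in> {0..pi}"
  have m0: "0 \<le> m" using y(2)[OF x] norm_ge_zero order_trans by blast
  have "integral {0..pi} (\<lambda>t. exp (- (\<sigma> * \<bar>x - t\<bar>)) * norm (v t * y t))
      \<le> integral {0..pi} (\<lambda>t. exp (- (\<sigma> * \<bar>x - t\<bar>)) * norm (v t) * m)"
  proof (rule integral_le)
    show "(\<lambda>t. exp (- (\<sigma> * \<bar>x - t\<bar>)) * norm (v t * y t)) integrable_on {0..pi}" by (rule integrable_kernel[OF vy]) auto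
    show "(\<lambda>t. exp (- (\<sigma> * \<bar>x - t\<bar>)) * norm (v t) * m) integrable_on {0..pi}"
      by (intro integrable_on_mult_left integrable_kernel[OF va]) auto
    show "exp (- (\<sigma> * \<bar>x - t\<bar>)) * norm (v t * y t) \<le> exp (- (\<sigma> * \<bar>x - t\<bar>)) * norm (v t) * m" if "t \<in> {0..pi}" for t
      unfolding norm_mult mult.assoc using y(2)[OF that] by (intro mult_left_mono) auto
  qed
  also have "\<dots> = integral {0..pi} (\<lambda>t. exp (- (\<sigma> * \<bar>x - t\<bar>)) * norm (v t)) * m" by simp
  also have "\<dots> \<le> H * m" using v x m0 by (intro mult_right_mono) (auto simp: kernel_bound_def)
  finally show "integral {0..pi} (\<lambda>t. exp (- (\<sigma> * \<bar>x - t\<bar>)) * norm (v t * y t)) \<le> H * m" .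
qed

text \<open>One step of the perturbation series: \<open>y - u\<close> solves the free problem with source \<open>v y\<close>.\<close>

lemma bvp_difference_a_priori:
  assumes y: "bvp bc v (\<mu>\<^sup>2) f y" and u: "bvp bc (\<lambda>_. 0) (\<mu>\<^sup>2) f u" and \<mu>: "good \<mu>"
    and v: "v absolutely_integrable_on {0..pi}" and f: "f absolutely_integrable_on {0..pi}"
    and big: "10 * L1_norm v \<le> norm \<mu>" and H: "kernel_bound (Im \<mu>) v H" and x: "x \<in> {0..pi}"
  shows "norm (y x - u x) \<le> 50 * H * L1_norm f / (norm \<mu>)\<^sup>2"
proof -
  have "bvp bc (\<lambda>_. 0) (\<mu>\<^sup>2) (\<lambda>x. 1 * (v x * y x + f x) + (- 1) * f x) (\<lambda>x. 1 * y x + (- 1) * u x)"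
    by (rule bvp_lincomb[OF bvp_to_free[OF y] u])
  then have d: "bvp bc (\<lambda>_. 0) (\<mu>\<^sup>2) (\<lambda>x. v x * y x) (\<lambda>x. y x - u x)" by simp
  have "norm (y x - u x) \<le> 5 * (H * (10 * L1_norm f / norm \<mu>)) / norm \<mu>"
    by (intro free_bvp_a_priori[OF d \<mu> _ x] kernel_bound_mult[OF H bvp_continuous[OF y]] bvp_a_priori[OF y \<mu> v f big])
  then show ?thesis by (simp add: power2_eq_square)
qed

text \<open>Young's inequality is applied pointwise instead of Hoelder's to the integral. The power
  of \<open>\<sigma>\<close> is the same, and the constant is not homogeneous in \<open>v\<close>,
  which is harmless because the final constant may depend on \<open>v\<close>.\<close>

lemma kernel_bound_Lp:
  fixes p q :: real
  assumes p: "1 < p" "1 / p + 1 / q = 1" and v: "v \<in> Lp_fun p" and \<sigma>: "0 < \<sigma>"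
  shows "kernel_bound \<sigma> v (\<sigma> powr (- 1 / q) * (2 + integral {0..pi} (\<lambda>t. norm (v t) powr p)))"
  unfolding kernel_bound_def
proof (intro conjI ballI)
  have q: "1 < q"
  proof -
    have "1 / q = 1 - 1 / p" "0 < 1 / p" "1 / p < 1" using p by auto
    then have "0 < 1 / q" "1 / q < 1" by linarith+
    then show ?thesis by (metis divide_less_eq_1_pos zero_less_divide_1_iff)
  qed
  show va: "v absolutely_integrable_on {0..pi}"
    using Lp_fun_mono[OF v, of 1] p by (simp add: Lp_fun_1_iff)
  have vp: "(\<lambda>t. norm (v t) powr p) integrable_on {0..pi}"
  proof -
    have "(\<lambda>t. norm (v t) powr p) absolutely_integrable_on {0..pi}"
      using Lp_fun_int[OF v] by (simp add: set_integrable_def integrable_restrict_space)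
    then show ?thesis by (simp add: absolutely_integrable_on_def)
  qed
  fix x assume x: "x \<in> {0..pi}"
  have e1: "((\<lambda>t. \<sigma> * exp (- (\<sigma> * (x - t)))) has_integral (exp (- (\<sigma> * (x - x))) - exp (- (\<sigma> * (x - 0))))) {0..x}"
    using x by (intro fundamental_theorem_of_calculus)
      (auto intro!: derivative_eq_intros simp: has_real_derivative_iff_has_vector_derivative[symmetric])
  have e2: "((\<lambda>t. \<sigma> * exp (- (\<sigma> * (t - x)))) has_integral (- exp (- (\<sigma> * (pi - x))) - - exp (- (\<sigma> * (x - x))))) {x..pi}"
    using x by (intro fundamental_theorem_of_calculus)
      (auto intro!: derivative_eq_intros simp: has_real_derivative_iff_has_vector_derivative[symmetric])
  have e1': "((\<lambda>t. \<sigma> * exp (- (\<sigma> * \<bar>x - t\<bar>))) has_integral (1 - exp (- (\<sigma> * x)))) {0..x}"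
    by (rule has_integral_eq[OF _ e1[simplified]]) auto
  have e2': "((\<lambda>t. \<sigma> * exp (- (\<sigma> * \<bar>x - t\<bar>))) has_integral (1 - exp (- (\<sigma> * (pi - x))))) {x..pi}"
    by (rule has_integral_eq[OF _ e2[simplified]]) auto
  have e: "((\<lambda>t. \<sigma> * exp (- (\<sigma> * \<bar>x - t\<bar>))) has_integral ((1 - exp (- (\<sigma> * x))) + (1 - exp (- (\<sigma> * (pi - x)))))) {0..pi}"
    using x by (intro has_integral_combine[OF _ _ e1' e2']) auto
  have young: "exp (- (\<sigma> * \<bar>x - t\<bar>)) * norm (v t) \<le> \<sigma> powr (- 1 / q) * (\<sigma> * exp (- (\<sigma> * \<bar>x - t\<bar>)) + norm (v t) powr p)" for t
  proof -
    \<comment> \<open>The factor \<open>\<sigma> powr (1 / q)\<close> is chosen so that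
      \<open>a powr q\<close> is dominated by
      \<open>\<sigma> * exp (- (\<sigma> * \<bar>x - t\<bar>))\<close>, whose integral is at most 2
      for every \<open>\<sigma>\<close>.\<close>
    define a where "a = \<sigma> powr (1 / q) * exp (- (\<sigma> * \<bar>x - t\<bar>))"
    have a0: "0 \<le> a" by (simp add: a_def)
    have "a powr q = \<sigma> * exp (- (\<sigma> * \<bar>x - t\<bar>)) powr q"
      using \<sigma> q by (simp add: a_def powr_mult powr_powr)
    also have "exp (- (\<sigma> * \<bar>x - t\<bar>)) powr q \<le> exp (- (\<sigma> * \<bar>x - t\<bar>))"
    proof -
      have "exp (- (\<sigma> * \<bar>x - t\<bar>)) powr q \<le> exp (- (\<sigma> * \<bar>x - t\<bar>)) powr 1"
        using q \<sigma> by (intro powr_mono') auto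
      then show ?thesis by simp
    qed
    finally have aq: "a powr q \<le> \<sigma> * exp (- (\<sigma> * \<bar>x - t\<bar>))" using \<sigma> by simp
    have "norm (v t) * a \<le> norm (v t) powr p / p + a powr q / q"
      using p q a0 by (intro Youngs_inequality) auto
    also have "\<dots> \<le> norm (v t) powr p / 1 + a powr q / 1"
      using p q by (intro add_mono divide_left_mono) auto
    finally have *: "norm (v t) * a \<le> \<sigma> * exp (- (\<sigma> * \<bar>x - t\<bar>)) + norm (v t) powr p" using aq by simp
    have "exp (- (\<sigma> * \<bar>x - t\<bar>)) * norm (v t) = \<sigma> powr (- 1 / q) * (norm (v t) * a)"
      using \<sigma> by (simp add: a_def powr_minus field_simps)
    also have "\<dots> \<le> \<sigma> powr (- 1 / q) * (\<sigma> * exp (- (\<sigma> * \<bar>x - t\<bar>)) + norm (v t) powr p)"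
      using * by (intro mult_left_mono) auto
    finally show ?thesis .
  qed
  have "integral {0..pi} (\<lambda>t. exp (- (\<sigma> * \<bar>x - t\<bar>)) * norm (v t))
      \<le> integral {0..pi} (\<lambda>t. \<sigma> powr (- 1 / q) * (\<sigma> * exp (- (\<sigma> * \<bar>x - t\<bar>)) + norm (v t) powr p))"
    by (intro integral_le integrable_kernel[OF va] young integrable_on_mult_right integrable_add vp has_integral_integrable[OF e]) auto
  also have "\<dots> = \<sigma> powr (- 1 / q) * (integral {0..pi} (\<lambda>t. \<sigma> * exp (- (\<sigma> * \<bar>x - t\<bar>))) + integral {0..pi} (\<lambda>t. norm (v t) powr p))"
    using Henstock_Kurzweil_Integration.integral_add[OF has_integral_integrable[OF e] vp]
    unfolding Henstock_Kurzweil_Integration.integral_mult_right by simp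
  also have "\<dots> \<le> \<sigma> powr (- 1 / q) * (2 + integral {0..pi} (\<lambda>t. norm (v t) powr p))"
    unfolding integral_unique[OF e]
    using exp_ge_zero[of "- (\<sigma> * x)"] exp_ge_zero[of "- (\<sigma> * (pi - x))"]
    by (intro mult_left_mono add_right_mono; (linarith | simp))
  finally show "integral {0..pi} (\<lambda>t. exp (- (\<sigma> * \<bar>x - t\<bar>)) * norm (v t))
      \<le> \<sigma> powr (- 1 / q) * (2 + integral {0..pi} (\<lambda>t. norm (v t) powr p))" .
qed

section \<open>Classes of functions\<close>

lemma Lp_exp_1_2 [simp]: "Lp_exp TYPE(1) = 1" "Lp_exp TYPE(2) = 2"
  by (simp_all add: Lp_exp_def)

lemma Lp_exp_nonneg [simp]: "0 \<le> Lp_exp TYPE('n::finite)" and Lp_exp_neq_0 [simp]: "Lp_exp TYPE('n::finite) \<noteq> 0"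
  using Lp_exp_ge_1[where 'n = 'n] by linarith+

lemma Lp_rel_refl: "f \<in> Lp_fun (Lp_exp TYPE('n::finite)) \<Longrightarrow> Lp_rel (phantom f :: 'n Lp_raw) (phantom f)"
  by (simp add: Lp_rel_def)

lemma Lp_class_eq_iff:
  assumes "f \<in> Lp_fun (Lp_exp TYPE('n::finite))" "g \<in> Lp_fun (Lp_exp TYPE('n))"
  shows "(Lp_class f :: 'n Lp) = Lp_class g \<longleftrightarrow> (\<exists>N. negligible N \<and> (\<forall>x\<in>{0..pi} - N. f x = g x))"
proof -
  have "(Lp_class f :: 'n Lp) = Lp_class g \<longleftrightarrow> Lp_rel (phantom f :: 'n Lp_raw) (phantom g)"
    using Quotient3_rel[OF Quotient3_Lp, of "phantom f :: 'n Lp_raw" "phantom g"] Lp_rel_refl[OF assms(1)] Lp_rel_refl[OF assms(2)]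
    by (simp add: Lp_class_def)
  then show ?thesis using assms by (simp add: Lp_rel_def AE_lebesgue_on_iff_negligible)
qed

lemma Lp_class_exhaust:
  fixes \<phi> :: "'n::finite Lp"
  obtains f where "f \<in> Lp_fun (Lp_exp TYPE('n))" "\<phi> = Lp_class f"
proof -
  have "Lp_rel (rep_Lp \<phi>) (rep_Lp \<phi>)" by (rule Quotient3_rep_reflp[OF Quotient3_Lp])
  then have "of_phantom (rep_Lp \<phi>) \<in> Lp_fun (Lp_exp TYPE('n))" by (simp add: Lp_rel_def)
  moreover have "\<phi> = Lp_class (of_phantom (rep_Lp \<phi>))"
    by (simp add: Lp_class_def Quotient3_abs_rep[OF Quotient3_Lp])
  ultimately show thesis using that by blast
qed

lemma
  assumes f: "f \<in> Lp_fun (Lp_exp TYPE('n::finite))"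
  shows Lp_class_scaleR: "r *\<^sub>R (Lp_class f :: 'n Lp) = Lp_class (\<lambda>x. of_real r * f x)"
    and Lp_class_scaleC: "scaleC_Lp c (Lp_class f :: 'n Lp) = Lp_class (\<lambda>x. c * f x)"
    and norm_Lp_class: "norm (Lp_class f :: 'n Lp) = Lp_norm (Lp_exp TYPE('n)) f"
  using Lp_rel_refl[OF f] unfolding Lp_class_def
  by (simp_all add: scaleR_Lp.abs_eq scaleC_Lp.abs_eq norm_Lp.abs_eq scaleR_conv_of_real)

lemma
  assumes f: "f \<in> Lp_fun (Lp_exp TYPE('n::finite))" and g: "g \<in> Lp_fun (Lp_exp TYPE('n))"
  shows Lp_class_plus: "(Lp_class f :: 'n Lp) + Lp_class g = Lp_class (\<lambda>x. f x + g x)"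
    and Lp_class_minus: "(Lp_class f :: 'n Lp) - Lp_class g = Lp_class (\<lambda>x. f x - g x)"
  using Lp_rel_refl[OF f] Lp_rel_refl[OF g] unfolding Lp_class_def
  by (simp_all add: plus_Lp.abs_eq minus_Lp.abs_eq)

lemmas Lp_class_ops = Lp_class_plus Lp_class_minus Lp_class_scaleR Lp_class_scaleC

lemma zero_Lp_class: "(0 :: 'n::finite Lp) = Lp_class (\<lambda>_. 0)"
  by (simp add: zero_Lp_def Lp_class_def)

lemma L2_to_L1_class: "f \<in> Lp_fun 2 \<Longrightarrow> L2_to_L1 (Lp_class f) = Lp_class f"
  unfolding Lp_class_def using Lp_rel_refl[where 'n = 2, of f] by (simp add: L2_to_L1.abs_eq)

lemma Lp_fun_2_imp_1: "f \<in> Lp_fun 2 \<Longrightarrow> f \<in> Lp_fun 1"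
  by (erule Lp_fun_mono) auto

lemma Lp_fun_continuous:
  assumes "continuous_on {0..pi} y" "1 \<le> a"
  shows "y \<in> Lp_fun a"
proof -
  have m: "y \<in> borel_measurable (lebesgue_on {0..pi})"
    using assms(1) by (intro continuous_imp_measurable_on_sets_lebesgue) auto
  have "bounded (y ` {0..pi})" using compact_continuous_image[OF assms(1)] compact_imp_bounded by blast
  then obtain B where B: "\<And>x. x \<in> {0..pi} \<Longrightarrow> norm (y x) \<le> B" unfolding bounded_iff by blast
  define u where "u x = (if x \<in> {0..pi} then y x else 0)" for x
  have "u \<in> borel_measurable (lebesgue_on {0..pi})"
    by (subst measurable_cong[where g = y]) (auto simp: u_def m)
  then have "u \<in> Lp_fun a"
    by (rule Lp_fun_bounded[where B = "max B 0"]) (use B assms(2) in \<open>auto simp: u_def le_max_iff_disj\<close>)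
  then show ?thesis by (rule Lp_fun_cong_AE[OF assms(2) _ negligible_empty]) (simp add: u_def)
qed

lemma norm_L1_class:
  assumes "f \<in> Lp_fun 1"
  shows "norm (Lp_class f :: L1) = L1_norm f / pi"
proof -
  have "integrable (lebesgue_on {0..pi}) (\<lambda>x. norm (f x))" using Lp_fun_int[OF assms] by simp
  then have "(\<integral>x. norm (f x) \<partial>lebesgue_on {0..pi}) = L1_norm f"
    by (rule lebesgue_integral_eq_integral) auto
  then show ?thesis using assms norm_Lp_class[where 'n = 1, of f] L1_norm_nonneg[of f] by (simp add: Lp_norm_def)
qed

text \<open>Pointwise \<open>norm (f x)\<close> is at most half of
  \<open>s + (norm (f x))\<^sup>2 / s\<close>; integrating and letting \<open>s\<close> decrease to
  \<open>norm \<phi>\<close> replaces the Cauchy-Schwarz inequality. Taking \<open>s\<close>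
  strictly larger avoids division by zero, and the normalised measure makes the constant 1.\<close>

lemma norm_L2_to_L1_le: "norm (L2_to_L1 \<phi>) \<le> norm \<phi>"
proof -
  obtain f where f: "f \<in> Lp_fun 2" "\<phi> = Lp_class f" using Lp_class_exhaust[of \<phi>] by auto
  have f1: "f \<in> Lp_fun 1" by (rule Lp_fun_2_imp_1[OF f(1)])
  let ?M = "lebesgue_on {0..pi}"
  have n1: "norm (L2_to_L1 \<phi>) = 1 / pi * (\<integral>x. norm (f x) \<partial>?M)"
    using f f1 norm_Lp_class[where 'n = 1, of f] by (simp add: L2_to_L1_class Lp_norm_def)
  have n2: "(norm \<phi>)\<^sup>2 = 1 / pi * (\<integral>x. norm (f x) powr 2 \<partial>?M)"
    using f Lp_norm_powr[of 2 f] norm_Lp_class[where 'n = 2, of f] by (simp add: Lp_norm_nonneg)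
  have i1: "integrable ?M (\<lambda>x. norm (f x))" using Lp_fun_int[OF f1] by simp
  have i2: "integrable ?M (\<lambda>x. norm (f x) powr 2)" using Lp_fun_int[OF f(1)] .
  show ?thesis
  proof (rule dense_ge)
    fix s assume s: "norm \<phi> < s"
    then have s0: "0 < s" using norm_ge_zero order_le_less_trans by blast
    have "(\<integral>x. norm (f x) \<partial>?M) \<le> (\<integral>x. (s + norm (f x) powr 2 / s) / 2 \<partial>?M)"
    proof (rule integral_mono)
      show "integrable ?M (\<lambda>x. (s + norm (f x) powr 2 / s) / 2)" using i2 by (auto simp: emeasure_restrict_space)
      fix x
      have "0 \<le> (norm (f x) - s)\<^sup>2" by simp
      then have "norm (f x) * (2 * s) \<le> s * s + norm (f x) ^ 2" by (simp add: power2_eq_square algebra_simps)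
      then show "norm (f x) \<le> (s + norm (f x) powr 2 / s) / 2" using s0 by (simp add: field_simps power2_eq_square)
    qed (rule i1)
    also have "\<dots> = (s * pi + (\<integral>x. norm (f x) powr 2 \<partial>?M) / s) / 2"
      using i2 by (simp add: emeasure_restrict_space measure_restrict_space)
    finally have "norm (L2_to_L1 \<phi>) \<le> (s + (norm \<phi>)\<^sup>2 / s) / 2"
      unfolding n1 n2 using s0 by (simp add: field_simps)
    also have "(norm \<phi>)\<^sup>2 / s \<le> s\<^sup>2 / s" using s s0 by (intro divide_right_mono power_mono) auto
    finally show "norm (L2_to_L1 \<phi>) \<le> s" using s0 by (simp add: power2_eq_square)
  qed
qed

lemma bounded_linear_L2_to_L1: "bounded_linear L2_to_L1"
proof (rule bounded_linear_intro[where K = 1])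
  fix \<phi> \<psi> :: L2 and r :: real
  obtain f where f: "f \<in> Lp_fun 2" "\<phi> = Lp_class f" using Lp_class_exhaust[of \<phi>] by auto
  obtain g where g: "g \<in> Lp_fun 2" "\<psi> = Lp_class g" using Lp_class_exhaust[of \<psi>] by auto
  note f1 = Lp_fun_2_imp_1[OF f(1)] and g1 = Lp_fun_2_imp_1[OF g(1)]
  show "L2_to_L1 (\<phi> + \<psi>) = L2_to_L1 \<phi> + L2_to_L1 \<psi>"
    using f g f1 g1 Lp_fun_add[OF _ f(1) g(1)] by (simp add: Lp_class_ops L2_to_L1_class)
  show "L2_to_L1 (r *\<^sub>R \<phi>) = r *\<^sub>R L2_to_L1 \<phi>"
    using f f1 Lp_fun_scale[OF f(1)] by (simp add: Lp_class_scaleR L2_to_L1_class)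
  show "norm (L2_to_L1 \<phi>) \<le> norm \<phi> * 1" using norm_L2_to_L1_le by simp
qed

lemma Cfun_Lp: "1 \<le> a \<Longrightarrow> Cfun u \<in> Lp_fun a"
  using continuous_on_Cfun by (rule Lp_fun_continuous)

text \<open>Generic in the exponent: into \<open>L2\<close> it embeds the values of an operator,
  into \<open>L1\<close> it allows the solution operator to be applied a second time.\<close>

definition C_to_Lp :: "Cspace \<Rightarrow> 'n::finite Lp" where
  "C_to_Lp u = Lp_class (Cfun u)"

lemma C_to_L2_eq: "C_to_L2 u = Lp_class (Cfun u)"
  unfolding C_to_L2_def Cfun_def[abs_def] ..

lemma norm_C_to_Lp_le: "norm (C_to_Lp u :: 'n::finite Lp) \<le> norm u"
proof -
  let ?M = "lebesgue_on {0..pi}" and ?a = "Lp_exp TYPE('n)"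
  note u = Cfun_Lp[OF Lp_exp_ge_1[where 'n = 'n], of u]
  have "(\<integral>x. norm (Cfun u x) powr ?a \<partial>?M) \<le> (\<integral>x. norm u powr ?a \<partial>?M)"
    using Lp_fun_int[OF u] norm_Cfun_le[of u] Lp_exp_ge_1[where 'n = 'n]
    by (intro integral_mono) (auto simp: emeasure_restrict_space intro!: powr_mono2)
  also have "\<dots> = pi * norm u powr ?a" by (simp add: measure_restrict_space)
  finally have "1 / pi * (\<integral>x. norm (Cfun u x) powr ?a \<partial>?M) \<le> norm u powr ?a" by (simp add: field_simps)
  then have "Lp_norm ?a (Cfun u) \<le> (norm u powr ?a) powr (1 / ?a)"
    unfolding Lp_norm_def using Lp_exp_ge_1[where 'n = 'n] by (intro powr_mono2) auto
  also have "\<dots> = norm u" using Lp_exp_ge_1[where 'n = 'n] by (simp add: powr_powr)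
  finally show ?thesis by (simp add: C_to_Lp_def norm_Lp_class[OF u])
qed

lemma bounded_linear_C_to_Lp: "bounded_linear (C_to_Lp :: Cspace \<Rightarrow> 'n::finite Lp)"
proof (rule bounded_linear_intro[where K = 1])
  fix u w :: Cspace and r :: real
  note c = Cfun_Lp[OF Lp_exp_ge_1[where 'n = 'n]]
  show "(C_to_Lp (u + w) :: 'n Lp) = C_to_Lp u + C_to_Lp w"
  proof -
    have "Cfun (u + w) = (\<lambda>x. Cfun u x + Cfun w x)" by (rule ext) simp
    then show ?thesis by (simp add: C_to_Lp_def Lp_class_plus[OF c c])
  qed
  show "(C_to_Lp (r *\<^sub>R u) :: 'n Lp) = r *\<^sub>R C_to_Lp u"
  proof -
    have "Cfun (r *\<^sub>R u) = (\<lambda>x. of_real r * Cfun u x)" by (rule ext) (simp add: scaleR_conv_of_real)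
    then show ?thesis by (simp add: C_to_Lp_def Lp_class_scaleR[OF c])
  qed
  show "norm (C_to_Lp u :: 'n Lp) \<le> norm u * 1" using norm_C_to_Lp_le by simp
qed

section \<open>The operator and the boundary value problem\<close>

text \<open>Eigenvalues and resolvents of the graph reduce to \<open>bvp\<close> through this
  equivalence. Equality of classes holds only almost everywhere, which the integrated equation does
  not see; conversely a solution lies in the domain because \<open>f\<close> is square
  integrable.\<close>

lemma hill_graph_iff_bvp:
  assumes v: "v \<in> Lp_fun 1" and f: "f \<in> Lp_fun 2"
  shows "(\<exists>g. (u, g) \<in> hill_op bc v \<and> scaleC_Lp z u - g = Lp_class f) \<longleftrightarrow> (\<exists>y. u = Lp_class y \<and> bvp bc v z f y)"
proof
  assume "\<exists>g. (u, g) \<in> hill_op bc v \<and> scaleC_Lp z u - g = Lp_class f"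
  then obtain y where y: "y \<in> hill_dom bc v" "u = Lp_class y" and eq: "scaleC_Lp z u - Lp_class (hill_expr v y) = Lp_class f"
    by (auto simp: hill_op_def)
  note i = hill_dom_imp_ivp[OF y(1) v]
  have h: "hill_expr v y \<in> Lp_fun 2" using y(1) by (simp add: hill_dom_def)
  have y2: "y \<in> Lp_fun 2" using ivp_continuous(1)[OF i(1)] by (rule Lp_fun_continuous) simp
  have zy: "(\<lambda>x. z * y x) \<in> Lp_fun 2" using y2 by (rule Lp_fun_scale)
  have "(Lp_class (\<lambda>x. z * y x - hill_expr v y x) :: L2) = Lp_class f"
    using eq y2 zy h unfolding y(2) by (simp add: Lp_class_ops)
  then obtain N where N: "negligible N" "\<And>x. x \<in> {0..pi} - N \<Longrightarrow> z * y x - hill_expr v y x = f x"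
    using Lp_class_eq_iff[where 'n = 2, of "\<lambda>x. z * y x - hill_expr v y x" f] Lp_fun_diff[OF _ zy h] f by auto
  have "ivp (\<lambda>x. (v x - z) * y x + f x) y (vderiv y)"
    by (rule ivp_cong[OF i(1) N(1)]) (auto simp: N(2)[symmetric] algebra_simps)
  then show "\<exists>y. u = Lp_class y \<and> bvp bc v z f y" using y(2) i(2) unfolding bvp_def by blast
next
  assume "\<exists>y. u = Lp_class y \<and> bvp bc v z f y"
  then obtain y y1 where u: "u = Lp_class y" and y: "ivp (\<lambda>x. (v x - z) * y x + f x) y y1" "bc_vals bc y y1 = (0, 0)"
    by (auto simp: bvp_def)
  have y2: "y \<in> Lp_fun 2" using ivp_continuous(1)[OF y(1)] by (rule Lp_fun_continuous) simp
  have zy: "(\<lambda>x. z * y x) \<in> Lp_fun 2" using y2 by (rule Lp_fun_scale)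
  have zyf: "(\<lambda>x. z * y x - f x) \<in> Lp_fun 2" using zy f by (intro Lp_fun_diff) auto
  have eq: "(\<lambda>x. v x * y x - ((v x - z) * y x + f x)) = (\<lambda>x. z * y x - f x)" by (auto simp: algebra_simps)
  have "(\<lambda>x. v x * y x - ((v x - z) * y x + f x)) \<in> Lp_fun 2" unfolding eq by (rule zyf)
  note d = ivp_imp_hill_dom[OF y this]
  then obtain N where N: "negligible N" "\<And>x. x \<in> {0..pi} - N \<Longrightarrow> hill_expr v y x = z * y x - f x"
    by (auto simp: algebra_simps)
  have h: "hill_expr v y \<in> Lp_fun 2" using d(1) by (simp add: hill_dom_def)
  have "scaleC_Lp z u - Lp_class (hill_expr v y) = Lp_class (\<lambda>x. z * y x - hill_expr v y x)"
    unfolding u using y2 zy h by (simp add: Lp_class_ops)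
  also have "\<dots> = Lp_class f"
    using Lp_class_eq_iff[where 'n = 2, of "\<lambda>x. z * y x - hill_expr v y x" f] Lp_fun_diff[OF _ zy h] f N by auto
  finally show "\<exists>g. (u, g) \<in> hill_op bc v \<and> scaleC_Lp z u - g = Lp_class f"
    using d(1) u unfolding hill_op_def by blast
qed

text \<open>The interior points with nonzero value form an open negligible set, which is empty; the
  end points follow by density.\<close>

lemma continuous_AE_zero:
  fixes y :: "real \<Rightarrow> complex"
  assumes y: "continuous_on {0..pi} y" and N: "negligible N" "\<And>x. x \<in> {0..pi} - N \<Longrightarrow> y x = 0" and x: "x \<in> {0..pi}"
  shows "y x = 0"
proof -
  let ?S = "{x \<in> {0<..<pi}. y x \<in> - {0}}"
  have "continuous_on {0<..<pi} y" using y by (rule continuous_on_subset) auto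
  then have "open ({0<..<pi} \<inter> y -` (- {0}))" by (intro continuous_open_preimage) auto
  moreover have "?S = {0<..<pi} \<inter> y -` (- {0})" by auto
  ultimately have "open ?S" by simp
  moreover have "negligible ?S" by (rule negligible_subset[OF N(1)]) (use N(2) in force)
  ultimately have "?S = {}" using open_not_negligible by blast
  then have z: "\<And>x. x \<in> {0<..<pi} \<Longrightarrow> y x = 0" by blast
  have cl: "closure {0<..<pi} = {0..pi}" by (simp add: closure_greaterThanLessThan)
  show ?thesis
    by (rule continuous_constant_on_closure[of "{0<..<pi}" y 0 x]) (use y z x cl in auto)
qed

lemma is_eigenvalue_iff_bvp:
  assumes v: "v \<in> Lp_fun 1"
  shows "is_eigenvalue (hill_op bc v) z \<longleftrightarrow> (\<exists>y. bvp bc v z (\<lambda>_. 0) y \<and> (\<exists>x\<in>{0..pi}. y x \<noteq> 0))"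
proof -
  have g: "((u, scaleC_Lp z u) \<in> hill_op bc v) \<longleftrightarrow> (\<exists>y. u = Lp_class y \<and> bvp bc v z (\<lambda>_. 0) y)" for u
    using hill_graph_iff_bvp[OF v Lp_fun_zero, of u bc z] by (simp add: zero_Lp_class[symmetric])
  have z: "(Lp_class y :: L2) = 0 \<longleftrightarrow> (\<forall>x\<in>{0..pi}. y x = 0)" if "bvp bc v z (\<lambda>_. 0) y" for y
  proof -
    have c: "continuous_on {0..pi} y" using bvp_continuous[OF that] .
    then have "y \<in> Lp_fun 2" by (rule Lp_fun_continuous) simp
    then have "(Lp_class y :: L2) = 0 \<longleftrightarrow> (\<exists>N. negligible N \<and> (\<forall>x\<in>{0..pi} - N. y x = 0))"
      using Lp_class_eq_iff[where 'n = 2, of y "\<lambda>_. 0"] by (simp add: zero_Lp_class Lp_fun_zero)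
    also have "\<dots> \<longleftrightarrow> (\<forall>x\<in>{0..pi}. y x = 0)"
      using continuous_AE_zero[OF c] negligible_empty by blast
    finally show ?thesis .
  qed
  show ?thesis
  proof
    assume "is_eigenvalue (hill_op bc v) z"
    then obtain u where u: "u \<noteq> 0" "(u, scaleC_Lp z u) \<in> hill_op bc v" unfolding is_eigenvalue_def by blast
    then obtain y where y: "u = Lp_class y" "bvp bc v z (\<lambda>_. 0) y" using g[of u] by blast
    then show "\<exists>y. bvp bc v z (\<lambda>_. 0) y \<and> (\<exists>x\<in>{0..pi}. y x \<noteq> 0)" using z[OF y(2)] u(1) by blast
  next
    assume "\<exists>y. bvp bc v z (\<lambda>_. 0) y \<and> (\<exists>x\<in>{0..pi}. y x \<noteq> 0)"
    then obtain y where y: "bvp bc v z (\<lambda>_. 0) y" "\<exists>x\<in>{0..pi}. y x \<noteq> 0" by blast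
    then have "(Lp_class y :: L2) \<noteq> 0" using z[OF y(1)] by blast
    moreover have "(Lp_class y :: L2, scaleC_Lp z (Lp_class y)) \<in> hill_op bc v" using g[of "Lp_class y"] y(1) by blast
    ultimately show "is_eigenvalue (hill_op bc v) z" unfolding is_eigenvalue_def by blast
  qed
qed

section \<open>The resolvent as an operator from \<open>L\<^sup>1\<close> to \<open>C\<close>\<close>

text \<open>Both the representative of the class and the solution are chosen. Off the spectrum the
  solution exists and is unique, so neither choice has an effect and the map is bounded linear, as
  \<open>Blinfun\<close> requires.\<close>

definition sol_op :: "bc \<Rightarrow> (real \<Rightarrow> complex) \<Rightarrow> complex \<Rightarrow> L1 \<Rightarrow>\<^sub>L Cspace" where
  "sol_op bc v z = Blinfun (\<lambda>\<phi>. mkC (SOME y. bvp bc v z (of_phantom (rep_Lp \<phi>)) y))"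

lemma bvp_unique:
  assumes v: "v \<in> Lp_fun 1" and z: "\<not> is_eigenvalue (hill_op bc v) z"
    and "bvp bc v z f y" "bvp bc v z f u" and x: "x \<in> {0..pi}"
  shows "y x = u x"
proof -
  have "bvp bc v z (\<lambda>x. 1 * f x + (- 1) * f x) (\<lambda>x. 1 * y x + (- 1) * u x)"
    by (rule bvp_lincomb[OF assms(3,4)])
  then have "bvp bc v z (\<lambda>_. 0) (\<lambda>x. y x - u x)" by simp
  then show ?thesis using z x unfolding is_eigenvalue_iff_bvp[OF v] by fastforce
qed

text \<open>Additivity and homogeneity come from uniqueness, since both sides solve the same
  problem; the norm bound comes from \<open>bvp_solvable\<close>.\<close>

lemma sol_op_bvp:
  assumes v: "v \<in> Lp_fun 1" and z: "\<not> is_eigenvalue (hill_op bc v) z" and f: "f \<in> Lp_fun 1"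
  shows "bvp bc v z f (Cfun (blinfun_apply (sol_op bc v z) (Lp_class f)))"
proof -
  define S where "S \<phi> = mkC (SOME y. bvp bc v z (of_phantom (rep_Lp \<phi>)) y)" for \<phi> :: L1
  have triv: "y x = 0" if "bvp bc v z (\<lambda>_. 0) y" "x \<in> {0..pi}" for y x
    using z that unfolding is_eigenvalue_iff_bvp[OF v] by blast
  obtain C where C: "0 \<le> C" "\<And>f. f absolutely_integrable_on {0..pi} \<Longrightarrow>
    \<exists>y. bvp bc v z f y \<and> (\<forall>x\<in>{0..pi}. norm (y x) \<le> C * L1_norm f)"
    using bvp_solvable[OF v[unfolded Lp_fun_1_iff], of bc z] triv by blast
  have S: "bvp bc v z g (Cfun (S (Lp_class g)))" if g: "g \<in> Lp_fun 1" for g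
  proof -
    define r where "r = of_phantom (rep_Lp (Lp_class g :: L1))"
    have "Lp_rel (rep_Lp (Lp_class g :: L1)) (rep_Lp (Lp_class g :: L1))" by (rule Quotient3_rep_reflp[OF Quotient3_Lp])
    then have r1: "r \<in> Lp_fun 1" by (simp add: Lp_rel_def r_def)
    have "(Lp_class r :: L1) = Lp_class g"
      by (simp add: Lp_class_def r_def Quotient3_abs_rep[OF Quotient3_Lp])
    then obtain N where N: "negligible N" "\<And>x. x \<in> {0..pi} - N \<Longrightarrow> r x = g x"
      using Lp_class_eq_iff[where 'n = 1, of r g] r1 g by auto
    obtain y where "bvp bc v z r y" using C(2) r1 by (auto simp: Lp_fun_1_iff)
    then have some: "bvp bc v z r (SOME y. bvp bc v z r y)" by (rule someI[of "bvp bc v z r"])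
    show ?thesis
    proof (rule bvp_cong[OF some N])
      show "(SOME y. bvp bc v z r y) x = Cfun (S (Lp_class g)) x" if "x \<in> {0..pi}" for x
        unfolding S_def r_def[symmetric] by (rule Cfun_mkC[OF bvp_continuous[OF some] that, symmetric])
    qed
  qed
  have uniq: "Cfun (S (Lp_class g)) x = y x" if "g \<in> Lp_fun 1" "bvp bc v z g y" "x \<in> {0..pi}" for g y x
    by (rule bvp_unique[OF v z S[OF that(1)] that(2,3)])
  have "bounded_linear S"
  proof (rule bounded_linear_intro[where K = "C * pi"])
    fix \<phi> \<psi> :: L1 and r :: real
    obtain f where f: "f \<in> Lp_fun 1" "\<phi> = Lp_class f" using Lp_class_exhaust[of \<phi>] by auto
    obtain g where g: "g \<in> Lp_fun 1" "\<psi> = Lp_class g" using Lp_class_exhaust[of \<psi>] by auto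
    have fg: "(\<lambda>x. f x + g x) \<in> Lp_fun 1" using f g by (intro Lp_fun_add) auto
    show "S (\<phi> + \<psi>) = S \<phi> + S \<psi>"
    proof (rule Cfun_eqI)
      fix x assume x: "x \<in> {0..pi}"
      have "bvp bc v z (\<lambda>x. 1 * f x + 1 * g x) (\<lambda>x. 1 * Cfun (S \<phi>) x + 1 * Cfun (S \<psi>) x)"
        unfolding f(2) g(2) by (rule bvp_lincomb[OF S[OF f(1)] S[OF g(1)]])
      then have "bvp bc v z (\<lambda>x. f x + g x) (\<lambda>x. Cfun (S \<phi>) x + Cfun (S \<psi>) x)" by simp
      from uniq[OF fg this x] show "Cfun (S (\<phi> + \<psi>)) x = Cfun (S \<phi> + S \<psi>) x"
        using f g by (simp add: Lp_class_ops)
    qed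
    have rf: "(\<lambda>x. of_real r * f x) \<in> Lp_fun 1" using f by (intro Lp_fun_scale) auto
    show "S (r *\<^sub>R \<phi>) = r *\<^sub>R S \<phi>"
    proof (rule Cfun_eqI)
      fix x assume x: "x \<in> {0..pi}"
      have "bvp bc v z (\<lambda>x. of_real r * f x + 0 * f x) (\<lambda>x. of_real r * Cfun (S \<phi>) x + 0 * Cfun (S \<phi>) x)"
        unfolding f(2) by (rule bvp_lincomb[OF S[OF f(1)] S[OF f(1)]])
      then have "bvp bc v z (\<lambda>x. of_real r * f x) (\<lambda>x. of_real r * Cfun (S \<phi>) x)" by simp
      from uniq[OF rf this x] show "Cfun (S (r *\<^sub>R \<phi>)) x = Cfun (r *\<^sub>R S \<phi>) x"
        using f by (simp add: Lp_class_scaleR scaleR_conv_of_real)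
    qed
    show "norm (S \<phi>) \<le> norm \<phi> * (C * pi)"
    proof (rule norm_Cspace_le)
      fix x assume x: "x \<in> {0..pi}"
      obtain y where y: "bvp bc v z f y" "\<And>x. x \<in> {0..pi} \<Longrightarrow> norm (y x) \<le> C * L1_norm f"
        using C(2)[of f] f(1) unfolding Lp_fun_1_iff by blast
      have "norm (Cfun (S \<phi>) x) \<le> C * L1_norm f" using uniq[OF f(1) y(1) x] y(2)[OF x] f(2) by simp
      then show "norm (Cfun (S \<phi>) x) \<le> norm \<phi> * (C * pi)" using f norm_L1_class[OF f(1)] by (simp add: mult.commute)
    qed
  qed
  then have "blinfun_apply (sol_op bc v z) = S"
    unfolding sol_op_def S_def[abs_def] by (rule bounded_linear_Blinfun_apply)
  then show ?thesis using S[OF f] by simp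
qed

lemma sol_op_eqI:
  assumes "v \<in> Lp_fun 1" "\<not> is_eigenvalue (hill_op bc v) z" "f \<in> Lp_fun 1" "bvp bc v z f y" "x \<in> {0..pi}"
  shows "Cfun (blinfun_apply (sol_op bc v z) (Lp_class f)) x = y x"
  by (rule bvp_unique[OF assms(1,2) sol_op_bvp[OF assms(1-3)] assms(4,5)])

text \<open>The type of operators records real linearity only. Complex homogeneity is proved
  separately because the difference quotient in the spectral parameter divides by a complex
  number.\<close>

lemma sol_op_scaleC:
  assumes "v \<in> Lp_fun 1" "\<not> is_eigenvalue (hill_op bc v) z" "x \<in> {0..pi}"
  shows "Cfun (blinfun_apply (sol_op bc v z) (scaleC_Lp c \<phi>)) x = c * Cfun (blinfun_apply (sol_op bc v z) \<phi>) x"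
proof -
  obtain f where f: "f \<in> Lp_fun 1" "\<phi> = Lp_class f" using Lp_class_exhaust[of \<phi>] by auto
  have cf: "(\<lambda>x. c * f x) \<in> Lp_fun 1" by (rule Lp_fun_scale[OF f(1)])
  let ?y = "Cfun (blinfun_apply (sol_op bc v z) \<phi>)"
  have "bvp bc v z (\<lambda>x. c * f x + 0 * f x) (\<lambda>x. c * ?y x + 0 * ?y x)"
    unfolding f(2) by (intro bvp_lincomb sol_op_bvp assms f)
  then have "bvp bc v z (\<lambda>x. c * f x) (\<lambda>x. c * ?y x)" by simp
  from sol_op_eqI[OF assms(1,2) cf this assms(3)] show ?thesis
    using f by (simp add: Lp_class_scaleC)
qed

text \<open>By construction \<open>A\<close> extends \<open>embed_op A\<close> in the sense of
  \<open>extends_to_L1_C\<close>; being bounded and linear in \<open>A\<close>, the passage commutes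
  with integrals.\<close>

definition embed_op :: "(L1 \<Rightarrow>\<^sub>L Cspace) \<Rightarrow> (L2 \<Rightarrow>\<^sub>L L2)" where
  "embed_op A = Blinfun C_to_Lp o\<^sub>L A o\<^sub>L Blinfun L2_to_L1"

lemma embed_op_apply: "blinfun_apply (embed_op A) \<phi> = C_to_L2 (blinfun_apply A (L2_to_L1 \<phi>))"
  by (simp add: embed_op_def bounded_linear_Blinfun_apply bounded_linear_C_to_Lp bounded_linear_L2_to_L1 C_to_L2_eq C_to_Lp_def)

lemma bounded_linear_embed_op: "bounded_linear embed_op"
  unfolding embed_op_def[abs_def]
  by (intro bounded_linear_intros)

lemma resolvent_eq_embed_sol_op:
  assumes v: "v \<in> Lp_fun 1" and z: "\<not> is_eigenvalue (hill_op bc v) z"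
  shows "resolvent (hill_op bc v) z = embed_op (sol_op bc v z)"
proof -
  have "is_resolvent (hill_op bc v) z (embed_op (sol_op bc v z))"
    unfolding is_resolvent_def
  proof (intro allI)
    fix \<phi> u :: L2
    obtain f where f: "f \<in> Lp_fun 2" "\<phi> = Lp_class f" using Lp_class_exhaust[of \<phi>] by auto
    note f1 = Lp_fun_2_imp_1[OF f(1)]
    let ?y = "Cfun (blinfun_apply (sol_op bc v z) (Lp_class f))"
    have R: "blinfun_apply (embed_op (sol_op bc v z)) \<phi> = Lp_class ?y"
      by (simp add: embed_op_apply f L2_to_L1_class C_to_L2_eq)
    have y: "bvp bc v z f ?y" by (rule sol_op_bvp[OF v z f1])
    have "(\<exists>y. u = Lp_class y \<and> bvp bc v z f y) \<longleftrightarrow> u = Lp_class ?y"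
    proof
      assume "\<exists>y. u = Lp_class y \<and> bvp bc v z f y"
      then obtain y where y': "u = Lp_class y" "bvp bc v z f y" by blast
      have "y \<in> Lp_fun 2" using bvp_continuous[OF y'(2)] by (rule Lp_fun_continuous) simp
      moreover have "?y \<in> Lp_fun 2" by (rule Cfun_Lp) simp
      moreover have "?y x = y x" if "x \<in> {0..pi}" for x by (rule sol_op_eqI[OF v z f1 y'(2) that])
      ultimately have "(Lp_class y :: L2) = Lp_class ?y"
        using Lp_class_eq_iff[where 'n = 2, of y ?y] negligible_empty by auto
      then show "u = Lp_class ?y" using y' by simp
    qed (use y in blast)
    then show "blinfun_apply (embed_op (sol_op bc v z)) \<phi> = u \<longleftrightarrow> (\<exists>g. (u, g) \<in> hill_op bc v \<and> scaleC_Lp z u - g = \<phi>)"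
      using hill_graph_iff_bvp[OF v f(1), of u bc z] R unfolding f(2) by auto
  qed
  moreover have "R = R'" if "is_resolvent (hill_op bc v) z R" "is_resolvent (hill_op bc v) z R'" for R R'
  proof (rule blinfun_eqI)
    fix \<phi>
    show "blinfun_apply R \<phi> = blinfun_apply R' \<phi>" using that unfolding is_resolvent_def by metis
  qed
  ultimately show ?thesis unfolding resolvent_def by (intro the_equality)
qed

section \<open>Dependence on the spectral parameter\<close>

text \<open>The solution \<open>y\<close> at \<open>z\<close> also solves the problem at
  \<open>a\<close>, with source \<open>f - (z - a) * y\<close>.\<close>

lemma sol_op_resolvent_identity:
  assumes v: "v \<in> Lp_fun 1" and a: "\<not> is_eigenvalue (hill_op bc v) a" and z: "\<not> is_eigenvalue (hill_op bc v) z"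
  shows "sol_op bc v z = sol_op bc v a - (sol_op bc v a o\<^sub>L scalarop (z - a) o\<^sub>L Blinfun C_to_Lp o\<^sub>L sol_op bc v z)"
proof (rule blinfun_eqI)
  fix \<phi> :: L1
  obtain f where f: "f \<in> Lp_fun 1" "\<phi> = Lp_class f" using Lp_class_exhaust[of \<phi>] by auto
  let ?y = "Cfun (blinfun_apply (sol_op bc v z) \<phi>)"
  have y1: "?y \<in> Lp_fun 1" by (rule Cfun_Lp) simp
  have cy: "(\<lambda>x. (z - a) * ?y x) \<in> Lp_fun 1" by (rule Lp_fun_scale[OF y1])
  have g: "(\<lambda>x. f x - (z - a) * ?y x) \<in> Lp_fun 1" using f cy by (intro Lp_fun_diff) auto
  have "bvp bc v z f ?y" unfolding f(2) by (rule sol_op_bvp[OF v z f(1)])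
  then have b: "bvp bc v a (\<lambda>x. f x - (z - a) * ?y x) ?y"
    by (rule bvp_shift) (simp add: algebra_simps)
  have eq: "blinfun_apply (sol_op bc v z) \<phi> = blinfun_apply (sol_op bc v a) (Lp_class (\<lambda>x. f x - (z - a) * ?y x))"
    by (rule Cfun_eqI) (rule sol_op_eqI[OF v a g b, symmetric])
  have "(Lp_class (\<lambda>x. f x - (z - a) * ?y x) :: L1) = \<phi> - scaleC_Lp (z - a) (C_to_Lp (blinfun_apply (sol_op bc v z) \<phi>))"
    unfolding C_to_Lp_def using f y1 cy by (simp add: Lp_class_minus Lp_class_scaleC)
  then show "blinfun_apply (sol_op bc v z) \<phi> = blinfun_apply (sol_op bc v a - (sol_op bc v a o\<^sub>L scalarop (z - a) o\<^sub>L Blinfun C_to_Lp o\<^sub>L sol_op bc v z)) \<phi>"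
    by (subst eq) (simp add: blinfun.diff_left blinfun.diff_right bounded_linear_Blinfun_apply bounded_linear_C_to_Lp scalarop.rep_eq)
qed

lemma norm_scalarop_le: "norm (scalarop c :: 'n::finite Lp \<Rightarrow>\<^sub>L 'n Lp) \<le> norm c"
  by (rule norm_blinfun_bound) (simp_all add: scalarop.rep_eq norm_scaleC_Lp)

lemma norm_Blinfun_C_to_Lp_le: "norm (Blinfun C_to_Lp :: Cspace \<Rightarrow>\<^sub>L 'n::finite Lp) \<le> 1"
  by (rule norm_blinfun_bound) (simp_all add: bounded_linear_Blinfun_apply bounded_linear_C_to_Lp norm_C_to_Lp_le)

lemma norm_sol_op_diff_le:
  assumes v: "v \<in> Lp_fun 1" and a: "\<not> is_eigenvalue (hill_op bc v) a" and z: "\<not> is_eigenvalue (hill_op bc v) z"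
  shows "norm (sol_op bc v z - sol_op bc v a) \<le> norm (sol_op bc v a) * norm (z - a) * norm (sol_op bc v z)"
proof -
  let ?T = "sol_op bc v a o\<^sub>L scalarop (z - a) o\<^sub>L Blinfun C_to_Lp o\<^sub>L sol_op bc v z"
  have "sol_op bc v z - sol_op bc v a = - ?T"
    using sol_op_resolvent_identity[OF v a z] by (metis add_diff_cancel_left' diff_conv_add_uminus)
  then have "norm (sol_op bc v z - sol_op bc v a) = norm ?T" by simp
  also have "\<dots> \<le> norm (sol_op bc v a) * norm (z - a) * 1 * norm (sol_op bc v z)"
    by (intro order_trans[OF norm_blinfun_compose] mult_mono norm_scalarop_le norm_Blinfun_C_to_Lp_le) auto
  finally show ?thesis by simp
qed

text \<open>An eigenfunction \<open>u\<close> at a nearby \<open>z\<close> satisfies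
  \<open>u = R ((a - z) u)\<close> with \<open>R\<close> the solution operator at \<open>a\<close>;
  for small \<open>z - a\<close> this halves the norm of \<open>u\<close>. The summand 1 in
  \<open>e\<close> avoids division by zero.\<close>

lemma open_resolvent_set:
  assumes v: "v \<in> Lp_fun 1"
  shows "open {z. \<not> is_eigenvalue (hill_op bc v) z}"
  unfolding open_dist
proof (intro ballI)
  fix a assume "a \<in> {z. \<not> is_eigenvalue (hill_op bc v) z}"
  then have a: "\<not> is_eigenvalue (hill_op bc v) a" by simp
  define e where "e = 1 / (2 * (norm (sol_op bc v a) + 1))"
  have pos: "0 < norm (sol_op bc v a) + 1" by (rule add_nonneg_pos) auto
  then have "0 < e" by (simp add: e_def)
  have "\<not> is_eigenvalue (hill_op bc v) z" if z: "dist z a < e" for z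
    unfolding is_eigenvalue_iff_bvp[OF v]
  proof (intro notI, elim exE conjE bexE)
    fix y x assume y: "bvp bc v z (\<lambda>_. 0) y" and x: "x \<in> {0..pi}" "y x \<noteq> 0"
    note c = bvp_continuous[OF y]
    define u where "u = mkC y"
    have u: "Cfun u x = y x" if "x \<in> {0..pi}" for x unfolding u_def by (rule Cfun_mkC[OF c that])
    have u1: "Cfun u \<in> Lp_fun 1" by (rule Cfun_Lp) simp
    have "bvp bc v a (\<lambda>x. (a - z) * Cfun u x) y" by (rule bvp_shift[OF y]) (simp add: u algebra_simps)
    then have "u = blinfun_apply (sol_op bc v a) (Lp_class (\<lambda>x. (a - z) * Cfun u x))"
      by (intro Cfun_eqI) (simp add: u sol_op_eqI[OF v a Lp_fun_scale[OF u1]])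
    also have "\<dots> = blinfun_apply (sol_op bc v a) (scaleC_Lp (a - z) (C_to_Lp u))"
      by (simp add: C_to_Lp_def Lp_class_scaleC u1)
    finally have "norm u \<le> norm (sol_op bc v a) * norm (scaleC_Lp (a - z) (C_to_Lp u) :: L1)"
      using norm_blinfun by metis
    also have "\<dots> \<le> norm (sol_op bc v a) * (norm (a - z) * norm u)"
      unfolding norm_scaleC_Lp by (intro mult_left_mono norm_C_to_Lp_le) auto
    also have "\<dots> \<le> (norm (sol_op bc v a) + 1) * (e * norm u)"
      using z \<open>0 < e\<close> by (intro mult_mono) (auto simp: dist_norm norm_minus_commute mult_right_mono)
    also have "\<dots> = norm u / 2" using pos by (simp add: e_def field_simps)
    finally have "norm u = 0" by simp
    then show False using x u[OF x(1)] by (simp add: Cfun_def)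
  qed
  then show "\<exists>e>0. \<forall>y. dist y a < e \<longrightarrow> y \<in> {z. \<not> is_eigenvalue (hill_op bc v) z}"
    using \<open>0 < e\<close> by blast
qed

lemma continuous_on_sol_op:
  assumes v: "v \<in> Lp_fun 1"
  shows "continuous_on {z. \<not> is_eigenvalue (hill_op bc v) z} (sol_op bc v)"
  unfolding continuous_on_iff
proof (intro ballI allI impI)
  fix a :: complex and e :: real
  assume "a \<in> {z. \<not> is_eigenvalue (hill_op bc v) z}" and e: "0 < e"
  then have a: "\<not> is_eigenvalue (hill_op bc v) a" by simp
  define n where "n = norm (sol_op bc v a) + 1"
  have n: "0 < n" "norm (sol_op bc v a) \<le> n" unfolding n_def by (auto intro: add_nonneg_pos)
  \<comment> \<open>The resolvent identity bounds the difference by the unknown norm at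
    \<open>z\<close>. The first radius absorbs it and gives norm at most \<open>2 * n\<close>; the
    second makes the difference smaller than \<open>e\<close>.\<close>
  define d where "d = min (1 / (2 * n)) (e / (2 * n * n))"
  have d: "0 < d" using n e by (simp add: d_def)
  have "dist (sol_op bc v z) (sol_op bc v a) < e" if z: "\<not> is_eigenvalue (hill_op bc v) z" "dist z a < d" for z
  proof -
    have le: "norm (sol_op bc v z - sol_op bc v a) \<le> norm (sol_op bc v a) * norm (z - a) * norm (sol_op bc v z)"
      by (rule norm_sol_op_diff_le[OF v a z(1)])
    have za: "norm (z - a) < 1 / (2 * n)" "norm (z - a) < e / (2 * n * n)" using z(2) by (auto simp: d_def dist_norm)
    have "norm (sol_op bc v a) * norm (z - a) * norm (sol_op bc v z) \<le> n * (1 / (2 * n)) * norm (sol_op bc v z)"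
      using n za by (intro mult_mono) auto
    then have "norm (sol_op bc v z - sol_op bc v a) \<le> norm (sol_op bc v z) / 2" using le n by simp
    then have "norm (sol_op bc v z) \<le> 2 * n"
      using norm_triangle_sub[of "sol_op bc v z" "sol_op bc v a"] n by linarith
    then have "norm (sol_op bc v z - sol_op bc v a) \<le> n * norm (z - a) * (2 * n)"
      using n by (intro order_trans[OF le] mult_mono) auto
    also have "\<dots> < n * (e / (2 * n * n)) * (2 * n)" using n za by (intro mult_strict_right_mono mult_strict_left_mono) auto
    also have "\<dots> = e" using n by simp
    finally show ?thesis by (simp add: dist_norm)
  qed
  then show "\<exists>d>0. \<forall>z\<in>{z. \<not> is_eigenvalue (hill_op bc v) z}. dist z a < d \<longrightarrow> dist (sol_op bc v z) (sol_op bc v a) < e"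
    using d by blast
qed

lemma bounded_linear_Cfun: "bounded_linear (\<lambda>u. Cfun u x)"
  by (rule bounded_linear_intro[where K = 1]) (simp_all add: norm_Cfun_le)

text \<open>With \<open>R z\<close> for the solution operator, the difference quotient at
  \<open>a\<close> equals \<open>- R a (R z)\<close> exactly, so continuity of the operator in
  \<open>z\<close> already gives the derivative.\<close>

lemma sol_op_holomorphic:
  assumes v: "v \<in> Lp_fun 1" and x: "x \<in> {0..pi}"
  shows "(\<lambda>z. Cfun (blinfun_apply (sol_op bc v z) \<phi>) x) holomorphic_on {z. \<not> is_eigenvalue (hill_op bc v) z}"
    (is "?f holomorphic_on ?\<rho>")
  unfolding holomorphic_on_def
proof
  fix a assume "a \<in> ?\<rho>"
  then have a: "\<not> is_eigenvalue (hill_op bc v) a" by simp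
  define g where "g z = - Cfun (blinfun_apply (sol_op bc v a) (C_to_Lp (blinfun_apply (sol_op bc v z) \<phi>))) x" for z
  have op: "open ?\<rho>" by (rule open_resolvent_set[OF v])
  have cont: "continuous (at a) (sol_op bc v)"
    using continuous_on_sol_op[OF v, of bc] \<open>a \<in> ?\<rho>\<close> unfolding continuous_on_eq_continuous_at[OF op] by blast
  have "isCont g a"
    unfolding g_def using cont
    by (intro continuous_intros bounded_linear.isCont[OF bounded_linear_Cfun] bounded_linear.isCont[OF bounded_linear_C_to_Lp])
  then have lim: "(g \<longlongrightarrow> g a) (at a)" by (simp add: isCont_def)
  have "(?f has_field_derivative g a) (at a)"
    unfolding has_field_derivative_iff
  proof (rule Lim_transform_eventually[OF lim])
    have "\<forall>\<^sub>F z in at a. z \<in> ?\<rho> \<and> z \<noteq> a"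
      using op \<open>a \<in> ?\<rho>\<close> eventually_at_in_open[OF op \<open>a \<in> ?\<rho>\<close>] by (auto elim: eventually_mono)
    then show "\<forall>\<^sub>F z in at a. g z = (?f z - ?f a) / (z - a)"
    proof eventually_elim
      case (elim z)
      then have z: "\<not> is_eigenvalue (hill_op bc v) z" "z - a \<noteq> 0" by auto
      have "blinfun_apply (sol_op bc v z) \<phi> = blinfun_apply (sol_op bc v a) \<phi>
          - blinfun_apply (sol_op bc v a) (scaleC_Lp (z - a) (C_to_Lp (blinfun_apply (sol_op bc v z) \<phi>)))"
        by (subst sol_op_resolvent_identity[OF v a z(1)])
          (simp add: blinfun.diff_left bounded_linear_Blinfun_apply bounded_linear_C_to_Lp scalarop.rep_eq)
      then have "?f z = ?f a - (z - a) * Cfun (blinfun_apply (sol_op bc v a) (C_to_Lp (blinfun_apply (sol_op bc v z) \<phi>))) x"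
        by (metis Cfun_diff sol_op_scaleC[OF v a x])
      then show ?case using z(2) by (simp add: g_def)
    qed
  qed
  then show "?f field_differentiable at a within ?\<rho>"
    using field_differentiable_at_within field_differentiable_def by blast
qed

section \<open>Contour integrals over rectangles\<close>

lemma in_segment_Complex_Re:
  "z \<in> closed_segment (Complex x1 y) (Complex x2 y) \<Longrightarrow> x1 \<le> x2 \<Longrightarrow> Im z = y \<and> x1 \<le> Re z \<and> Re z \<le> x2"
  using closed_segment_same_Im[of "Complex x1 y" "Complex x2 y"] by (auto simp: closed_segment_eq_real_ivl)

lemma in_segment_Complex_Im:
  "z \<in> closed_segment (Complex x y1) (Complex x y2) \<Longrightarrow> y1 \<le> y2 \<Longrightarrow> Re z = x \<and> y1 \<le> Im z \<and> Im z \<le> y2"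
  using closed_segment_same_Re[of "Complex x y1" "Complex x y2"] by (auto simp: closed_segment_eq_real_ivl)

abbreviation hor :: "(complex \<Rightarrow> complex) \<Rightarrow> real \<Rightarrow> real \<Rightarrow> real \<Rightarrow> complex" where
  "hor f x1 x2 y \<equiv> contour_integral (linepath (Complex x1 y) (Complex x2 y)) f"

abbreviation vert :: "(complex \<Rightarrow> complex) \<Rightarrow> real \<Rightarrow> real \<Rightarrow> real \<Rightarrow> complex" where
  "vert f x y1 y2 \<equiv> contour_integral (linepath (Complex x y1) (Complex x y2)) f"

lemma contour_integral_rectpath:
  assumes f: "continuous_on (path_image (rectpath (Complex x1 y1) (Complex x2 y2))) f"
  shows "contour_integral (rectpath (Complex x1 y1) (Complex x2 y2)) f = hor f x1 x2 y1 + vert f x2 y1 y2 - hor f x1 x2 y2 - vert f x1 y1 y2"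
proof -
  have pi: "path_image (rectpath (Complex x1 y1) (Complex x2 y2)) =
    closed_segment (Complex x1 y1) (Complex x2 y1) \<union> (closed_segment (Complex x2 y1) (Complex x2 y2) \<union>
    (closed_segment (Complex x2 y2) (Complex x1 y2) \<union> closed_segment (Complex x1 y2) (Complex x1 y1)))"
    by (simp add: rectpath_def Let_def path_image_join)
  have c: "continuous_on (closed_segment (Complex x1 y1) (Complex x2 y1)) f" "continuous_on (closed_segment (Complex x2 y1) (Complex x2 y2)) f"
    "continuous_on (closed_segment (Complex x2 y2) (Complex x1 y2)) f" "continuous_on (closed_segment (Complex x1 y2) (Complex x1 y1)) f"
    by (rule continuous_on_subset[OF f], use pi in blast)+
  have i: "f contour_integrable_on linepath (Complex x1 y1) (Complex x2 y1)" "f contour_integrable_on linepath (Complex x2 y1) (Complex x2 y2)"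
    "f contour_integrable_on linepath (Complex x2 y2) (Complex x1 y2)" "f contour_integrable_on linepath (Complex x1 y2) (Complex x1 y1)"
    by (intro contour_integrable_continuous_linepath c)+
  have "contour_integral (rectpath (Complex x1 y1) (Complex x2 y2)) f =
      hor f x1 x2 y1 + (vert f x2 y1 y2 + (hor f x2 x1 y2 + vert f x1 y2 y1))"
    unfolding rectpath_def Let_def using i by (simp add: valid_path_join contour_integrable_joinI)
  then show ?thesis
    using contour_integral_reverse_linepath[OF c(3)] contour_integral_reverse_linepath[OF c(4)] by simp
qed

lemma rectangle_integral_zero:
  assumes f: "f holomorphic_on U" and "x1 \<le> x2" "y1 \<le> y2"
    and U: "\<And>z. x1 \<le> Re z \<Longrightarrow> Re z \<le> x2 \<Longrightarrow> y1 \<le> Im z \<Longrightarrow> Im z \<le> y2 \<Longrightarrow> z \<in> U"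
  shows "hor f x1 x2 y1 + vert f x2 y1 y2 - hor f x1 x2 y2 - vert f x1 y1 y2 = 0"
proof -
  let ?a = "Complex x1 y1" and ?b = "Complex x2 y2"
  have cb: "cbox ?a ?b \<subseteq> U" using U by (auto simp: in_cbox_complex_iff)
  have sub: "path_image (rectpath ?a ?b) \<subseteq> cbox ?a ?b" using assms by (intro path_image_rectpath_subset_cbox) auto
  have "(f has_contour_integral 0) (rectpath ?a ?b)"
    by (rule Cauchy_theorem_convex_simple[OF holomorphic_on_subset[OF f cb] convex_box(1)]) (use sub in auto)
  then have "contour_integral (rectpath ?a ?b) f = 0" by (rule contour_integral_unique)
  moreover have "continuous_on (path_image (rectpath ?a ?b)) f"
    using f sub cb holomorphic_on_imp_continuous_on continuous_on_subset by blast
  ultimately show ?thesis using contour_integral_rectpath by metis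
qed

text \<open>The region between the two rectangles is cut into a left piece and two full-width
  strips, above and below. Both rectangles share the line \<open>Re z = X\<close>, so no piece lies
  to the right, and Cauchy's theorem is applied on convex sets only.\<close>

lemma rectangle_deformation:
  assumes f: "f holomorphic_on U" and R: "0 < \<omega>" "\<omega> \<le> R" "0 < h" "h \<le> R" "0 < X"
    and U: "\<And>z. Re z \<le> X \<Longrightarrow> \<not> (- \<omega> < Re z \<and> Re z < X \<and> \<bar>Im z\<bar> < h) \<Longrightarrow> z \<in> U"
  shows "contour_integral (rectpath (Complex (- \<omega>) (- h)) (Complex X h)) f
    = hor f (- R) X (- R) + vert f X (- R) R - hor f (- R) X R - vert f (- R) (- R) R"
proof -
  have cf: "continuous_on U f" using f by (rule holomorphic_on_imp_continuous_on)
  have cH: "continuous_on (closed_segment (Complex x1 y) (Complex x2 y)) f"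
    if "x1 \<le> x2" "x2 \<le> X" "h \<le> \<bar>y\<bar>" for x1 x2 y
    using that by (intro continuous_on_subset[OF cf] subsetI U) (auto dest!: in_segment_Complex_Re)
  have cV: "continuous_on (closed_segment (Complex x y1) (Complex x y2)) f"
    if "y1 \<le> y2" "x \<le> - \<omega> \<or> x = X" for x y1 y2
    using that R by (intro continuous_on_subset[OF cf] subsetI U) (auto dest!: in_segment_Complex_Im)
  have segH: "Complex x y \<in> closed_segment (Complex x1 y) (Complex x2 y)" if "x1 \<le> x" "x \<le> x2" for x x1 x2 y
    using that by (subst closed_segment_same_Im) (auto simp: closed_segment_eq_real_ivl)
  have segV: "Complex x y \<in> closed_segment (Complex x y1) (Complex x y2)" if "y1 \<le> y" "y \<le> y2" for x y y1 y2
    using that by (subst closed_segment_same_Re) (auto simp: closed_segment_eq_real_ivl)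
  have H: "hor f (- R) X y = hor f (- R) (- \<omega>) y + hor f (- \<omega>) X y" if "h \<le> \<bar>y\<bar>" for y
    using R that by (intro contour_integral_split_linepath cH segH) auto
  have V: "vert f x (- R) R = vert f x (- R) (- h) + (vert f x (- h) h + vert f x h R)" if "x \<le> - \<omega> \<or> x = X" for x
  proof -
    have "vert f x (- R) R = vert f x (- R) (- h) + vert f x (- h) R"
      using R that by (intro contour_integral_split_linepath cV segV) auto
    moreover have "vert f x (- h) R = vert f x (- h) h + vert f x h R"
      using R that by (intro contour_integral_split_linepath cV segV) auto
    ultimately show ?thesis by simp
  qed
  have left: "hor f (- R) (- \<omega>) (- h) + vert f (- \<omega>) (- h) h - hor f (- R) (- \<omega>) h - vert f (- R) (- h) h = 0"
    by (rule rectangle_integral_zero[OF f]) (use R in \<open>auto intro!: U\<close>)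
  have top: "hor f (- R) X h + vert f X h R - hor f (- R) X R - vert f (- R) h R = 0"
    by (rule rectangle_integral_zero[OF f]) (use R in \<open>auto intro!: U\<close>)
  have bot: "hor f (- R) X (- R) + vert f X (- R) (- h) - hor f (- R) X (- h) - vert f (- R) (- R) (- h) = 0"
    by (rule rectangle_integral_zero[OF f]) (use R in \<open>auto intro!: U\<close>)
  have "continuous_on (path_image (rectpath (Complex (- \<omega>) (- h)) (Complex X h))) f"
  proof (rule continuous_on_subset[OF cf], rule subsetI)
    fix z assume "z \<in> path_image (rectpath (Complex (- \<omega>) (- h)) (Complex X h))"
    then have "z \<in> cbox (Complex (- \<omega>) (- h)) (Complex X h) - box (Complex (- \<omega>) (- h)) (Complex X h)"
      using R by (subst (asm) path_image_rectpath_cbox_minus_box) auto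
    then show "z \<in> U" by (intro U) (auto simp: in_cbox_complex_iff in_box_complex_iff)
  qed
  from contour_integral_rectpath[OF this]
  have "contour_integral (rectpath (Complex (- \<omega>) (- h)) (Complex X h)) f
      = hor f (- \<omega>) X (- h) + vert f X (- h) h - hor f (- \<omega>) X h - vert f (- \<omega>) (- h) h" .
  moreover have Hh: "hor f (- R) X h = hor f (- R) (- \<omega>) h + hor f (- \<omega>) X h"
    "hor f (- R) X (- h) = hor f (- R) (- \<omega>) (- h) + hor f (- \<omega>) X (- h)" using H[of h] H[of "- h"] R by auto
  have VV: "vert f X (- R) R = vert f X (- R) (- h) + (vert f X (- h) h + vert f X h R)"
    "vert f (- R) (- R) R = vert f (- R) (- R) (- h) + (vert f (- R) (- h) h + vert f (- R) h R)"
    using V[of X] V[of "- R"] R by auto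
  have "hor f (- R) X (- R) + vert f X (- R) R - hor f (- R) X R - vert f (- R) (- R) R
      = (hor f (- \<omega>) X (- h) + vert f X (- h) h - hor f (- \<omega>) X h - vert f (- \<omega>) (- h) h)
        + (hor f (- R) (- \<omega>) (- h) + vert f (- \<omega>) (- h) h - hor f (- R) (- \<omega>) h - vert f (- R) (- h) h)
        + (hor f (- R) X h + vert f X h R - hor f (- R) X R - vert f (- R) h R)
        + (hor f (- R) X (- R) + vert f X (- R) (- h) - hor f (- R) X (- h) - vert f (- R) (- R) (- h))"
    unfolding VV Hh by (simp add: algebra_simps)
  ultimately show ?thesis unfolding left top bot by simp
qed

section \<open>Integrals along a vertical line\<close>

text \<open>Up to \<open>X\<close> the majorant is a multiple of \<open>t powr (- \<beta>)\<close>,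
  integrable at 0 as \<open>\<beta> < 1\<close>; beyond \<open>X\<close> it is
  \<open>t powr (- \<beta> / 2 - 1)\<close>, integrable at infinity as \<open>\<beta> > 0\<close>.
  Both parts scale like \<open>X powr (- \<beta> / 2)\<close>, uniformly in
  \<open>R\<close>.\<close>

lemma half_line_bound:
  fixes g :: "real \<Rightarrow> complex"
  assumes \<beta>: "0 < \<beta>" "\<beta> < 1" and X: "0 < X" "X \<le> R" and M: "0 \<le> M" and g: "continuous_on {0..R} g"
    and b: "\<And>t. 0 < t \<Longrightarrow> t \<le> R \<Longrightarrow> norm (g t) \<le> M * (max X t powr (\<beta> / 2 - 1) * t powr (- \<beta>))"
  shows "norm (integral {0..R} g) \<le> M * (1 / (1 - \<beta>) + 2 / \<beta>) * X powr (- \<beta> / 2)"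
proof -
  have i1: "((\<lambda>t. t powr (- \<beta>)) has_integral (X powr (- \<beta> + 1) / (- \<beta> + 1))) {0..X}"
    using \<beta> X by (intro has_integral_powr_from_0) auto
  have i1': "((\<lambda>t. M * X powr (\<beta> / 2 - 1) * t powr (- \<beta>)) has_integral (M * X powr (\<beta> / 2 - 1) * (X powr (- \<beta> + 1) / (- \<beta> + 1)))) {0..X}"
    by (rule has_integral_mult_right[OF i1])
  \<comment> \<open>\<open>0 powr (- \<beta>)\<close> is 0 by convention, so the majorant is
    redefined at 0 in order to dominate \<open>g\<close> there; one point does not change the
    integral.\<close>
  have i1'': "((\<lambda>t. if t = 0 then norm (g 0) else M * X powr (\<beta> / 2 - 1) * t powr (- \<beta>)) has_integral (M * X powr (\<beta> / 2 - 1) * (X powr (- \<beta> + 1) / (- \<beta> + 1)))) {0..X}"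
    by (rule has_integral_spike_finite[of "{0}" _ _ "\<lambda>t. M * X powr (\<beta> / 2 - 1) * t powr (- \<beta>)", OF _ _ i1']) auto
  have n1: "norm (integral {0..X} g) \<le> M * X powr (\<beta> / 2 - 1) * (X powr (- \<beta> + 1) / (- \<beta> + 1))"
    unfolding integral_unique[OF i1'', symmetric]
  proof (rule integral_norm_bound_integral)
    show "g integrable_on {0..X}"
      using X by (intro integrable_continuous_real continuous_on_subset[OF g]) auto
    show "norm (g t) \<le> (if t = 0 then norm (g 0) else M * X powr (\<beta> / 2 - 1) * t powr (- \<beta>))" if "t \<in> {0..X}" for t
      using b[of t] that X by (auto simp: max_absorb1 mult.assoc)
  qed (use i1'' in blast)
  have i2: "((\<lambda>t. t powr (- \<beta> / 2 - 1)) has_integral (R powr (- \<beta> / 2) / (- \<beta> / 2) - X powr (- \<beta> / 2) / (- \<beta> / 2))) {X..R}"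
  proof (rule fundamental_theorem_of_calculus[OF X(2)])
    fix t assume t: "t \<in> {X..R}"
    then have "0 < t" using X by auto
    then have "((\<lambda>t. t powr (- \<beta> / 2) / (- \<beta> / 2)) has_real_derivative ((- \<beta> / 2) * t powr (- \<beta> / 2 - 1)) / (- \<beta> / 2)) (at t within {X..R})"
      by (intro DERIV_cdivide has_real_derivative_powr'[THEN DERIV_subset]) (auto intro!: derivative_eq_intros)
    then show "((\<lambda>t. t powr (- \<beta> / 2) / (- \<beta> / 2)) has_vector_derivative t powr (- \<beta> / 2 - 1)) (at t within {X..R})"
      using \<beta> by (simp add: has_real_derivative_iff_has_vector_derivative)
  qed
  have i2': "((\<lambda>t. M * t powr (- \<beta> / 2 - 1)) has_integral (M * (R powr (- \<beta> / 2) / (- \<beta> / 2) - X powr (- \<beta> / 2) / (- \<beta> / 2)))) {X..R}"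
    by (rule has_integral_mult_right[OF i2])
  have "norm (integral {X..R} g) \<le> M * (R powr (- \<beta> / 2) / (- \<beta> / 2) - X powr (- \<beta> / 2) / (- \<beta> / 2))"
    unfolding integral_unique[OF i2', symmetric]
  proof (rule integral_norm_bound_integral)
    show "g integrable_on {X..R}"
      using X by (intro integrable_continuous_real continuous_on_subset[OF g]) auto
    show "norm (g t) \<le> M * t powr (- \<beta> / 2 - 1)" if t: "t \<in> {X..R}" for t
    proof -
      have t0: "0 < t" "X \<le> t" "t \<le> R" using t X by auto
      have "max X t powr (\<beta> / 2 - 1) * t powr (- \<beta>) = t powr (- \<beta> / 2 - 1)"
        using t0 by (simp add: max_absorb2 powr_add[symmetric])
      then show ?thesis using b[OF t0(1,3)] by simp
    qed
  qed (use i2' in blast)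
  also have "\<dots> \<le> M * (2 / \<beta> * X powr (- \<beta> / 2))"
  proof (rule mult_left_mono[OF _ M])
    have "0 \<le> 2 / \<beta> * R powr (- \<beta> / 2)" using \<beta> by simp
    then show "R powr (- \<beta> / 2) / (- \<beta> / 2) - X powr (- \<beta> / 2) / (- \<beta> / 2) \<le> 2 / \<beta> * X powr (- \<beta> / 2)"
      using \<beta> by (simp add: field_simps)
  qed
  finally have n2: "norm (integral {X..R} g) \<le> M * (2 / \<beta> * X powr (- \<beta> / 2))" .
  have "integral {0..R} g = integral {0..X} g + integral {X..R} g"
    using X by (intro Henstock_Kurzweil_Integration.integral_combine[symmetric] integrable_continuous_real g) auto
  then have "norm (integral {0..R} g) \<le> norm (integral {0..X} g) + norm (integral {X..R} g)"
    using norm_triangle_ineq by metis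
  also have "\<dots> \<le> M * X powr (\<beta> / 2 - 1) * (X powr (- \<beta> + 1) / (- \<beta> + 1)) + M * (2 / \<beta> * X powr (- \<beta> / 2))"
    by (rule add_mono[OF n1 n2])
  also have "M * X powr (\<beta> / 2 - 1) * (X powr (- \<beta> + 1) / (- \<beta> + 1)) = M * (1 / (1 - \<beta>)) * X powr (- \<beta> / 2)"
  proof -
    have "X powr (\<beta> / 2 - 1) * X powr (- \<beta> + 1) = X powr (- \<beta> / 2)"
      by (simp add: powr_add[symmetric])
    then show ?thesis by (simp add: algebra_simps)
  qed
  finally show ?thesis by (simp add: algebra_simps)
qed

lemma vertical_line_bound:
  assumes \<beta>: "0 < \<beta>" "\<beta> < 1" and X: "0 < X" "X \<le> R" and M: "0 \<le> M"
    and f: "continuous_on (closed_segment (Complex X (- R)) (Complex X R)) f"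
    and b: "\<And>t. t \<noteq> 0 \<Longrightarrow> \<bar>t\<bar> \<le> R \<Longrightarrow> norm (f (Complex X t)) \<le> M * (max X \<bar>t\<bar> powr (\<beta> / 2 - 1) * \<bar>t\<bar> powr (- \<beta>))"
  shows "norm (vert f X (- R) R) \<le> 2 * (M * (1 / (1 - \<beta>) + 2 / \<beta>) * X powr (- \<beta> / 2))"
proof -
  define g where "g t = f (Complex X t)" for t
  have g: "continuous_on {- R..R} g"
    unfolding g_def
  proof (rule continuous_on_compose2[OF f])
    show "continuous_on {- R..R} (Complex X)"
      unfolding Complex_eq by (intro continuous_intros)
    show "Complex X ` {- R..R} \<subseteq> closed_segment (Complex X (- R)) (Complex X R)"
      using X by (subst closed_segment_same_Re) (auto simp: closed_segment_eq_real_ivl)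
  qed
  have g0: "continuous_on {0..R} g" "continuous_on {- R..0} g" using X by (auto intro!: continuous_on_subset[OF g])
  have gm: "continuous_on {0..R} (\<lambda>t. g (- t))"
    by (rule continuous_on_compose2[OF g0(2)]) (auto intro!: continuous_intros)
  have p: "norm (integral {0..R} g) \<le> M * (1 / (1 - \<beta>) + 2 / \<beta>) * X powr (- \<beta> / 2)"
  proof (rule half_line_bound[OF \<beta> X M g0(1)])
    show "norm (g t) \<le> M * (max X t powr (\<beta> / 2 - 1) * t powr (- \<beta>))" if "0 < t" "t \<le> R" for t
      using b[of t] that by (simp add: g_def)
  qed
  have m: "norm (integral {0..R} (\<lambda>t. g (- t))) \<le> M * (1 / (1 - \<beta>) + 2 / \<beta>) * X powr (- \<beta> / 2)"
  proof (rule half_line_bound[OF \<beta> X M gm])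
    show "norm (g (- t)) \<le> M * (max X t powr (\<beta> / 2 - 1) * t powr (- \<beta>))" if "0 < t" "t \<le> R" for t
      using b[of "- t"] that by (simp add: g_def)
  qed
  have refl: "integral {- R..0} g = integral {0..R} (\<lambda>t. g (- t))"
    using Henstock_Kurzweil_Integration.integral_reflect_real[of R 0 "\<lambda>t. g (- t)"] by simp
  have "vert f X (- R) R = \<i> * integral {- R..R} g"
    unfolding g_def using X by (intro contour_integral_linepath_same_Re) auto
  also have "integral {- R..R} g = integral {- R..0} g + integral {0..R} g"
    using X by (intro Henstock_Kurzweil_Integration.integral_combine[symmetric] integrable_continuous_real g) auto
  finally have "norm (vert f X (- R) R) = norm (integral {- R..0} g + integral {0..R} g)" by (simp add: norm_mult)
  also have "\<dots> \<le> norm (integral {- R..0} g) + norm (integral {0..R} g)" by (rule norm_triangle_ineq)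
  finally show ?thesis using p m refl by simp
qed

section \<open>Integrability over the boundary of a rectangle\<close>

text \<open>Joining of paths nests to the right, so the sides take parameter intervals of lengths
  1/2, 1/4, 1/8 and 1/8. On each of them the derivative of the path is constant.\<close>

lemma rectpath_affine_pieces:
  fixes a b :: complex
  obtains A c where
    "\<And>t. t \<in> {0<..<1/2} \<Longrightarrow> rectpath a b t = A (0::nat) + of_real t * c (0::nat)"
    "\<And>t. t \<in> {1/2<..<3/4} \<Longrightarrow> rectpath a b t = A 1 + of_real t * c 1"
    "\<And>t. t \<in> {3/4<..<7/8} \<Longrightarrow> rectpath a b t = A 2 + of_real t * c 2"
    "\<And>t. t \<in> {7/8<..<1} \<Longrightarrow> rectpath a b t = A 3 + of_real t * c 3"
proof -
  define a2 where "a2 = Complex (Re b) (Im a)"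
  define a4 where "a4 = Complex (Re a) (Im b)"
  have r: "rectpath a b = linepath a a2 +++ linepath a2 b +++ linepath b a4 +++ linepath a4 a"
    by (simp add: rectpath_def Let_def a2_def a4_def)
  define A where "A k = (if k = (0::nat) then a else if k = 1 then a2 - 2 * (b - a2) else if k = 2 then b - 6 * (a4 - b) else a4 - 7 * (a - a4))" for k
  define c where "c k = (if k = (0::nat) then 2 * (a2 - a) else if k = 1 then 4 * (b - a2) else if k = 2 then 8 * (a4 - b) else 8 * (a - a4))" for k
  show thesis
  proof (rule that[of A c])
    show "rectpath a b t = A 0 + of_real t * c 0" if "t \<in> {0<..<1/2}" for t
      using that by (simp add: r joinpaths_def linepath_def A_def c_def scaleR_conv_of_real algebra_simps)
    show "rectpath a b t = A 1 + of_real t * c 1" if "t \<in> {1/2<..<3/4}" for t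
      using that by (simp add: r joinpaths_def linepath_def A_def c_def scaleR_conv_of_real algebra_simps)
    show "rectpath a b t = A 2 + of_real t * c 2" if "t \<in> {3/4<..<7/8}" for t
      using that by (simp add: r joinpaths_def linepath_def A_def c_def scaleR_conv_of_real algebra_simps)
    show "rectpath a b t = A 3 + of_real t * c 3" if "t \<in> {7/8<..<1}" for t
      using that by (simp add: r joinpaths_def linepath_def A_def c_def scaleR_conv_of_real algebra_simps)
  qed
qed

text \<open>\<open>prd c\<close> stands for multiplication by the complex number \<open>c\<close>;
  for operators it is composition with \<open>mulC c\<close>. On each side the integrand is
  continuous up to the two end points.\<close>

lemma rectpath_integrable:
  fixes F :: "complex \<Rightarrow> 'a::banach" and prd :: "complex \<Rightarrow> 'a \<Rightarrow> 'a"
  assumes F: "continuous_on (path_image (rectpath a b)) F" and prd: "\<And>c. bounded_linear (prd c)"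
  shows "(\<lambda>t. prd (vector_derivative (rectpath a b) (at t within {0..1})) (F (rectpath a b t))) integrable_on {0..1}"
proof -
  let ?\<gamma> = "rectpath a b"
  have "continuous_on {0..1} ?\<gamma>" using path_rectpath by (simp add: path_def)
  then have cF: "continuous_on {0..1} (\<lambda>t. F (?\<gamma> t))"
    by (rule continuous_on_compose2[OF F]) (auto simp: path_image_def)
  have piece: "(\<lambda>t. prd (vector_derivative ?\<gamma> (at t within {0..1})) (F (?\<gamma> t))) integrable_on {l..r}"
    if lr: "0 \<le> l" "r \<le> 1" and aff: "\<And>t. t \<in> {l<..<r} \<Longrightarrow> ?\<gamma> t = A + of_real t * c" for l r A c
  proof (rule integrable_spike_finite[of "{l, r}"])
    show "(\<lambda>t. prd c (F (?\<gamma> t))) integrable_on {l..r}"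
      using lr by (intro integrable_continuous_real bounded_linear.continuous_on[OF prd] continuous_on_subset[OF cF]) auto
    fix t assume "t \<in> {l..r} - {l, r}"
    then have t: "t \<in> {l<..<r}" by auto
    have "((\<lambda>t. A + of_real t * c) has_vector_derivative 0 + of_real 1 * c) (at t within {0..1})"
      by (intro has_vector_derivative_add has_vector_derivative_const has_vector_derivative_mult_left has_vector_derivative_of_real) auto
    then have "((\<lambda>t. A + of_real t * c) has_vector_derivative c) (at t within {0..1})" by simp
    then have "(?\<gamma> has_vector_derivative c) (at t within {0..1})"
    proof (rule has_vector_derivative_transform_within)
      show "0 < min (t - l) (r - t)" "t \<in> {0..1}" using t lr by auto
      show "A + of_real s * c = ?\<gamma> s" if "s \<in> {0..1}" "dist s t < min (t - l) (r - t)" for s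
        using that by (intro aff[symmetric]) (auto simp: dist_real_def)
    qed
    then have "vector_derivative ?\<gamma> (at t within {0..1}) = c"
      using t lr by (intro vector_derivative_within_closed_interval) auto
    then show "prd (vector_derivative ?\<gamma> (at t within {0..1})) (F (?\<gamma> t)) = prd c (F (?\<gamma> t))" by simp
  qed simp
  obtain A c where
    "\<And>t. t \<in> {0<..<1/2} \<Longrightarrow> ?\<gamma> t = A (0::nat) + of_real t * c (0::nat)"
    "\<And>t. t \<in> {1/2<..<3/4} \<Longrightarrow> ?\<gamma> t = A 1 + of_real t * c 1"
    "\<And>t. t \<in> {3/4<..<7/8} \<Longrightarrow> ?\<gamma> t = A 2 + of_real t * c 2"
    "\<And>t. t \<in> {7/8<..<1} \<Longrightarrow> ?\<gamma> t = A 3 + of_real t * c 3"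
    using rectpath_affine_pieces[of a b] by blast
  note aff = this
  define f where "f t = prd (vector_derivative ?\<gamma> (at t within {0..1})) (F (?\<gamma> t))" for t
  have p: "f integrable_on {0..1/2}" "f integrable_on {1/2..3/4}" "f integrable_on {3/4..7/8}" "f integrable_on {7/8..1}"
    unfolding f_def by (rule piece[OF _ _ aff(1)] piece[OF _ _ aff(2)] piece[OF _ _ aff(3)] piece[OF _ _ aff(4)]; simp)+
  have "f integrable_on {0..3/4}"
    by (rule Henstock_Kurzweil_Integration.integrable_combine[OF _ _ p(1,2)]) auto
  then have "f integrable_on {0..7/8}"
    by (rule Henstock_Kurzweil_Integration.integrable_combine[OF _ _ _ p(3), rotated 2]) auto
  then have "f integrable_on {0..1}"
    by (rule Henstock_Kurzweil_Integration.integrable_combine[OF _ _ _ p(4), rotated 2]) auto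
  then show ?thesis unfolding f_def[abs_def] .
qed

section \<open>Location of the spectrum\<close>

lemma sqrt_upper_half_plane:
  obtains \<mu> where "\<mu>\<^sup>2 = z" "0 \<le> Im \<mu>"
proof (cases "0 \<le> Im (csqrt z)")
  case True
  then show ?thesis using that[of "csqrt z"] by simp
next
  case False
  then show ?thesis using that[of "- csqrt z"] by simp
qed

lemma Re_square: "Re (\<mu>\<^sup>2) = (Re \<mu>)\<^sup>2 - (Im \<mu>)\<^sup>2"
  by (simp add: power2_eq_square)

lemma norm_square: "norm (\<mu>\<^sup>2) = (Re \<mu>)\<^sup>2 + (Im \<mu>)\<^sup>2"
  by (simp add: norm_power cmod_power2)

lemma exp_i_pi_square:
  "norm ((exp (\<i> * \<mu> * of_real pi))\<^sup>2) = exp (- (2 * pi * Im \<mu>))"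
  "Re ((exp (\<i> * \<mu> * of_real pi))\<^sup>2) = exp (- (2 * pi * Im \<mu>)) * cos (2 * pi * Re \<mu>)"
proof -
  have "(exp (\<i> * \<mu> * of_real pi))\<^sup>2 = exp (2 * (\<i> * \<mu> * of_real pi))" by (simp add: exp_double)
  moreover have "Re (2 * (\<i> * \<mu> * of_real pi)) = - (2 * pi * Im \<mu>)" "Im (2 * (\<i> * \<mu> * of_real pi)) = 2 * pi * Re \<mu>" by simp_all
  ultimately show "norm ((exp (\<i> * \<mu> * of_real pi))\<^sup>2) = exp (- (2 * pi * Im \<mu>))"
    "Re ((exp (\<i> * \<mu> * of_real pi))\<^sup>2) = exp (- (2 * pi * Im \<mu>)) * cos (2 * pi * Re \<mu>)"
    by (simp_all only: norm_exp_eq_Re Re_exp)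
qed

text \<open>Here \<open>exp (2 * pi * \<i> * \<mu>)\<close> has modulus at most
  \<open>exp (- pi)\<close>, which is below \<open>1 / 2\<close>.\<close>

lemma good_high:
  assumes "1 / 2 \<le> Im \<mu>"
  shows "good \<mu>"
proof -
  let ?w = "(exp (\<i> * \<mu> * of_real pi))\<^sup>2"
  have "pi * 1 \<le> pi * (2 * Im \<mu>)" using assms by (intro mult_left_mono) auto
  then have "norm ?w \<le> exp (- pi)" unfolding exp_i_pi_square by simp
  also have "\<dots> \<le> 1 / 2"
  proof -
    have "2 \<le> exp pi" using exp_ge_add_one_self[of pi] pi_gt3 by linarith
    then show ?thesis by (simp add: exp_minus field_simps)
  qed
  finally have "1 / 2 \<le> norm (1 - ?w)" using norm_triangle_ineq2[of 1 ?w] by simp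
  moreover have "\<mu> \<noteq> 0" using assms by auto
  ultimately show ?thesis using assms by (simp add: good_def)
qed

text \<open>For small \<open>Im \<mu>\<close> the equation
  \<open>Re (\<mu>\<^sup>2) = N\<^sup>2 + N\<close> forces \<open>\<bar>Re \<mu>\<bar>\<close> into
  the interval from \<open>N + 1 / 4\<close> to \<open>N + 1 / 2\<close>. There the cosine of
  \<open>2 * pi * Re \<mu>\<close> is nonpositive, so the exponential lies in the left half-plane
  and has distance at least 1 from 1.\<close>

lemma good_line:
  assumes re: "Re (\<mu>\<^sup>2) = (real N)\<^sup>2 + real N" and im: "0 \<le> Im \<mu>" and N: "1 \<le> N"
  shows "good \<mu>"
proof (cases "1 / 2 \<le> Im \<mu>")
  case True
  then show ?thesis by (rule good_high)
next
  case False
  define r where "r = \<bar>Re \<mu>\<bar>"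
  define n where "n = real N"
  have n: "1 \<le> n" using N by (simp add: n_def)
  have r2: "r\<^sup>2 = n\<^sup>2 + n + (Im \<mu>)\<^sup>2" using re unfolding Re_square by (simp add: r_def n_def)
  have "(Im \<mu>)\<^sup>2 \<le> (1 / 2)\<^sup>2" using False im by (intro power_mono) auto
  then have "r\<^sup>2 \<le> (n + 1 / 2)\<^sup>2" unfolding r2 by (simp add: power2_eq_square algebra_simps)
  then have up: "r \<le> n + 1 / 2" by (rule power2_le_imp_le) (use n in simp)
  have "(n + 1 / 4)\<^sup>2 \<le> r\<^sup>2"
  proof -
    have "(n + 1 / 4)\<^sup>2 = n\<^sup>2 + n / 2 + 1 / 16" by (simp add: power2_eq_square algebra_simps)
    then show ?thesis unfolding r2 using n zero_le_power2[of "Im \<mu>"] by linarith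
  qed
  then have lo: "n + 1 / 4 \<le> r" by (rule power2_le_imp_le) (simp add: r_def)
  define d where "d = n + 1 / 2 - r"
  have d: "0 \<le> d" "d \<le> 1 / 4" using up lo by (auto simp: d_def)
  have "cos (2 * pi * Re \<mu>) = cos (2 * pi * r)"
    by (cases "0 \<le> Re \<mu>") (auto simp: r_def)
  also have "2 * pi * r = (pi - 2 * pi * d) + 2 * pi * real N" by (simp add: d_def n_def algebra_simps)
  also have "cos \<dots> = - cos (2 * pi * d)"
    using cos.plus_of_nat[of "pi - 2 * pi * d" N] by (simp add: cos_diff mult_ac)
  also have "\<dots> \<le> 0"
  proof -
    have "2 * pi * d \<le> 2 * pi * (1 / 4)" using d by (intro mult_left_mono) auto
    moreover have "0 \<le> 2 * pi * d" using d by simp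
    ultimately have "0 \<le> cos (2 * pi * d)" using pi_gt_zero by (intro cos_ge_zero) linarith+
    then show ?thesis by simp
  qed
  finally have "Re ((exp (\<i> * \<mu> * of_real pi))\<^sup>2) \<le> 0" unfolding exp_i_pi_square by (simp add: mult_nonneg_nonpos)
  then have "1 \<le> norm (1 - (exp (\<i> * \<mu> * of_real pi))\<^sup>2)"
    using complex_Re_le_cmod[of "1 - (exp (\<i> * \<mu> * of_real pi))\<^sup>2"] by simp
  moreover have "\<mu> \<noteq> 0" using lo n by (auto simp: r_def)
  ultimately show ?thesis using im by (simp add: good_def)
qed

lemma not_eigenvalue:
  assumes v: "v \<in> Lp_fun 1" and \<mu>: "good \<mu>" and big: "10 * L1_norm v \<le> norm \<mu>"
  shows "\<not> is_eigenvalue (hill_op bc v) (\<mu>\<^sup>2)"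
  unfolding is_eigenvalue_iff_bvp[OF v]
proof (intro notI, elim exE conjE bexE)
  fix y x assume y: "bvp bc v (\<mu>\<^sup>2) (\<lambda>_. 0) y" and x: "x \<in> {0..pi}" "y x \<noteq> 0"
  have z: "(\<lambda>_. 0 :: complex) absolutely_integrable_on {0..pi}" by (intro absolutely_integrable_continuous_real) auto
  have "norm (y x) \<le> 10 * L1_norm (\<lambda>_. 0) / norm \<mu>"
    by (rule bvp_a_priori[OF y \<mu> _ z big x(1)]) (use v in \<open>simp add: Lp_fun_1_iff\<close>)
  then show False using x(2) by simp
qed

definition Lp_const :: "real \<Rightarrow> (real \<Rightarrow> complex) \<Rightarrow> real" where
  "Lp_const p v = 2 + integral {0..pi} (\<lambda>t. norm (v t) powr p)"

lemma Lp_const_pos: "0 < Lp_const p v"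
proof -
  have "0 \<le> integral {0..pi} (\<lambda>t. norm (v t) powr p)"
    by (cases "(\<lambda>t. norm (v t) powr p) integrable_on {0..pi}") (auto intro: integral_nonneg simp: not_integrable_integral)
  then show ?thesis by (simp add: Lp_const_def)
qed

text \<open>The factor \<open>pi\<close> converts the normalised norm of the class into the plain
  L^1 norm of a representative; 50 is the product of the constants 5 and 10 of the free and the
  perturbed a priori estimates.\<close>

lemma sol_op_difference_bound:
  fixes p q :: real
  assumes pq: "1 < p" "1 / p + 1 / q = 1" and v: "v \<in> Lp_fun p" and \<mu>: "good \<mu>" "0 < Im \<mu>"
    and big: "10 * L1_norm v \<le> norm \<mu>" and x: "x \<in> {0..pi}"
  shows "norm (Cfun (blinfun_apply (sol_op bc v (\<mu>\<^sup>2)) \<phi>) x - Cfun (blinfun_apply (sol_op bc (\<lambda>_. 0) (\<mu>\<^sup>2)) \<phi>) x)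
    \<le> 50 * Lp_const p v * (pi * norm \<phi>) * (Im \<mu> powr (- 1 / q) / norm (\<mu>\<^sup>2))"
proof -
  obtain f where f: "f \<in> Lp_fun 1" "\<phi> = Lp_class f" using Lp_class_exhaust[of \<phi>] by auto
  have v1: "v \<in> Lp_fun 1" using Lp_fun_mono[OF v, of 1] pq by simp
  have z1: "(\<lambda>_. 0) \<in> Lp_fun 1" by (rule Lp_fun_zero)
  have y: "bvp bc v (\<mu>\<^sup>2) f (Cfun (blinfun_apply (sol_op bc v (\<mu>\<^sup>2)) \<phi>))"
    unfolding f(2) by (rule sol_op_bvp[OF v1 not_eigenvalue[OF v1 \<mu>(1) big] f(1)])
  have u: "bvp bc (\<lambda>_. 0) (\<mu>\<^sup>2) f (Cfun (blinfun_apply (sol_op bc (\<lambda>_. 0) (\<mu>\<^sup>2)) \<phi>))"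
    unfolding f(2) by (rule sol_op_bvp[OF z1 not_eigenvalue[OF z1 \<mu>(1)] f(1)]) simp
  have F: "L1_norm f = pi * norm \<phi>" using norm_L1_class[OF f(1)] f(2) by simp
  have "norm (Cfun (blinfun_apply (sol_op bc v (\<mu>\<^sup>2)) \<phi>) x - Cfun (blinfun_apply (sol_op bc (\<lambda>_. 0) (\<mu>\<^sup>2)) \<phi>) x)
    \<le> 50 * (Im \<mu> powr (- 1 / q) * Lp_const p v) * L1_norm f / (norm \<mu>)\<^sup>2"
    using v1 f(1) kernel_bound_Lp[OF pq v \<mu>(2)]
    by (intro bvp_difference_a_priori[OF y u \<mu>(1) _ _ big _ x]) (simp_all add: Lp_fun_1_iff Lp_const_def)
  then show ?thesis unfolding F by (simp add: norm_power mult_ac)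
qed

section \<open>Contour integrals of the resolvent\<close>

text \<open>Makes the operators from \<open>L1\<close> to \<open>Cspace\<close> a Banach space,
  where continuity implies integrability.\<close>

instance bcontfun :: (metric_space, banach) banach ..

lemma Cfun_outside: "x \<notin> {0..pi} \<Longrightarrow> Cfun u x = 0"
  unfolding Cfun_def by (rule if_not_P)

lemma Cfun_mkC_mult: "Cfun (mkC (\<lambda>x. c * Cfun u x)) x = c * Cfun u x"
proof (cases "x \<in> {0..pi}")
  case True
  then show ?thesis by (intro Cfun_mkC continuous_intros continuous_on_Cfun)
next
  case False
  then show ?thesis by (simp only: Cfun_outside mult_zero_right not_False_eq_True)
qed

text \<open>The counterpart of \<open>scalarop\<close> on the side of the values: operators form a
  real vector space only, so complex scalars act by composition.\<close>

definition mulC :: "complex \<Rightarrow> Cspace \<Rightarrow>\<^sub>L Cspace" where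
  "mulC c = Blinfun (\<lambda>u. mkC (\<lambda>x. c * Cfun u x))"

lemma Cfun_mulC: "Cfun (blinfun_apply (mulC c) u) x = c * Cfun u x"
proof -
  have "bounded_linear (\<lambda>u. mkC (\<lambda>x. c * Cfun u x))"
  proof (rule bounded_linear_intro[where K = "norm c"])
    fix u w :: Cspace and r :: real
    show "mkC (\<lambda>x. c * Cfun (u + w) x) = mkC (\<lambda>x. c * Cfun u x) + mkC (\<lambda>x. c * Cfun w x)"
      by (rule Cfun_eqI, rule trans[OF Cfun_mkC_mult]) (simp add: Cfun_mkC_mult distrib_left)
    show "mkC (\<lambda>x. c * Cfun (r *\<^sub>R u) x) = r *\<^sub>R mkC (\<lambda>x. c * Cfun u x)"
      by (rule Cfun_eqI, rule trans[OF Cfun_mkC_mult]) (simp add: Cfun_mkC_mult)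
    show "norm (mkC (\<lambda>x. c * Cfun u x)) \<le> norm u * norm c"
      by (rule norm_Cspace_le) (simp add: Cfun_mkC_mult norm_mult mult.commute[of _ "norm c"] mult_left_mono norm_Cfun_le)
  qed
  then show ?thesis by (simp add: mulC_def bounded_linear_Blinfun_apply Cfun_mkC_mult)
qed

lemma embed_op_mulC: "embed_op (mulC c o\<^sub>L A) = scalarop c o\<^sub>L embed_op A"
proof (rule blinfun_eqI)
  fix \<phi> :: L2
  let ?u = "blinfun_apply A (L2_to_L1 \<phi>)"
  have "Cfun (blinfun_apply (mulC c) ?u) = (\<lambda>x. c * Cfun ?u x)" by (rule ext) (rule Cfun_mulC)
  then show "blinfun_apply (embed_op (mulC c o\<^sub>L A)) \<phi> = blinfun_apply (scalarop c o\<^sub>L embed_op A) \<phi>"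
    using Cfun_Lp[of 2 ?u] by (simp add: embed_op_apply C_to_L2_eq scalarop.rep_eq Lp_class_scaleC)
qed

definition sol_integral :: "(real \<Rightarrow> complex) \<Rightarrow> bc \<Rightarrow> (real \<Rightarrow> complex) \<Rightarrow> L1 \<Rightarrow>\<^sub>L Cspace" where
  "sol_integral \<gamma> bc v = integral {0..1} (\<lambda>t. mulC (vector_derivative \<gamma> (at t within {0..1})) o\<^sub>L sol_op bc v (\<gamma> t))"

text \<open>Both claims interchange the integral with a bounded linear map: \<open>embed_op\<close>
  leads to the operators on \<open>L2\<close>, evaluation at \<open>\<phi>\<close> and
  \<open>x\<close> to scalar contour integrals.\<close>

lemma
  assumes v: "v \<in> Lp_fun 1" and ne: "\<And>z. z \<in> path_image (rectpath a b) \<Longrightarrow> \<not> is_eigenvalue (hill_op bc v) z"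
  shows op_contour_integral_resolvent:
      "op_contour_integral (rectpath a b) (resolvent (hill_op bc v)) = embed_op (sol_integral (rectpath a b) bc v)"
    and sol_integral_eval:
      "((\<lambda>z. Cfun (blinfun_apply (sol_op bc v z) \<phi>) x) has_contour_integral
          Cfun (blinfun_apply (sol_integral (rectpath a b) bc v) \<phi>) x) (rectpath a b)"
proof -
  let ?\<gamma> = "rectpath a b"
  let ?A = "\<lambda>t. mulC (vector_derivative ?\<gamma> (at t within {0..1})) o\<^sub>L sol_op bc v (?\<gamma> t)"
  have bl: "bounded_linear (\<lambda>B :: L1 \<Rightarrow>\<^sub>L Cspace. mulC c o\<^sub>L B)" for c by (intro bounded_linear_intros)
  have "continuous_on (path_image ?\<gamma>) (sol_op bc v)"
    by (rule continuous_on_subset[OF continuous_on_sol_op[OF v]]) (use ne in blast)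
  from rectpath_integrable[OF this bl] have int: "?A integrable_on {0..1}" .
  have \<gamma>: "?\<gamma> t \<in> path_image ?\<gamma>" if "t \<in> {0..1}" for t using that by (auto simp: path_image_def)
  have "op_contour_integral ?\<gamma> (resolvent (hill_op bc v)) = integral {0..1} (embed_op \<circ> ?A)"
    unfolding op_contour_integral_def
  proof (rule Henstock_Kurzweil_Integration.integral_cong)
    fix t :: real assume "t \<in> {0..1}"
    then show "scalarop (vector_derivative ?\<gamma> (at t within {0..1})) o\<^sub>L resolvent (hill_op bc v) (?\<gamma> t) = (embed_op \<circ> ?A) t"
      using resolvent_eq_embed_sol_op[OF v ne[OF \<gamma>]] by (simp add: embed_op_mulC)
  qed
  also have "\<dots> = embed_op (sol_integral ?\<gamma> bc v)"
    unfolding sol_integral_def by (rule integral_linear[OF int bounded_linear_embed_op])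
  finally show "op_contour_integral ?\<gamma> (resolvent (hill_op bc v)) = embed_op (sol_integral ?\<gamma> bc v)" .
  have ev: "bounded_linear (\<lambda>B :: L1 \<Rightarrow>\<^sub>L Cspace. Cfun (blinfun_apply B \<phi>) x)"
    by (rule bounded_linear_compose[OF bounded_linear_Cfun]) (rule blinfun.bounded_linear_left)
  have "(((\<lambda>B. Cfun (blinfun_apply B \<phi>) x) \<circ> ?A) has_integral Cfun (blinfun_apply (sol_integral ?\<gamma> bc v) \<phi>) x) {0..1}"
    unfolding sol_integral_def by (rule has_integral_linear[OF integrable_integral[OF int] ev])
  then show "((\<lambda>z. Cfun (blinfun_apply (sol_op bc v z) \<phi>) x) has_contour_integral
          Cfun (blinfun_apply (sol_integral ?\<gamma> bc v) \<phi>) x) ?\<gamma>"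
    unfolding has_contour_integral_def by (simp add: o_def Cfun_mulC mult.commute)
qed

section \<open>The estimate\<close>

lemma Pi_rect_eq_cbox: "Pi_rect \<omega> h N = cbox (Complex (- \<omega>) (- h)) (Complex ((real N)\<^sup>2 + real N) h)"
  unfolding Pi_rect_def by (auto simp: in_cbox_complex_iff abs_le_iff)

lemma interior_Pi_rect:
  "z \<in> interior (Pi_rect \<omega> h N) \<longleftrightarrow> - \<omega> < Re z \<and> Re z < (real N)\<^sup>2 + real N \<and> \<bar>Im z\<bar> < h"
  unfolding Pi_rect_eq_cbox interior_cbox by (auto simp: in_box_complex_iff abs_less_iff)

lemma powr_neg_mono:
  fixes a b \<beta> :: real
  assumes "0 < a" "a \<le> b" "0 \<le> \<beta>"
  shows "b powr (- \<beta>) \<le> a powr (- \<beta>)"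
  by (rule powr_mono2') (use assms in auto)

text \<open>Rests on the identity \<open>norm (\<mu>\<^sup>2) - Re (\<mu>\<^sup>2) = 2 * (Im
  \<mu>)\<^sup>2\<close>.\<close>

lemma Im_sqrt_lower:
  assumes "0 \<le> Im \<mu>" "0 \<le> r" "2 * r\<^sup>2 \<le> norm (\<mu>\<^sup>2) - Re (\<mu>\<^sup>2)"
  shows "r \<le> Im \<mu>"
proof -
  have "r\<^sup>2 \<le> (Im \<mu>)\<^sup>2" using assms(3) unfolding norm_square Re_square by simp
  then show ?thesis using assms(1) by (rule power2_le_imp_le)
qed

text \<open>On a horizontal side the product of \<open>norm z - Re z\<close> and
  \<open>norm z + Re z\<close> is \<open>R\<^sup>2\<close>, and the second factor is at most
  \<open>5 / 2 * R\<close>. Together with \<open>Im_sqrt_lower\<close> this gives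
  \<open>Im \<mu> \<ge> sqrt (R / 6)\<close> on the outer sides.\<close>

lemma far_side:
  fixes z :: complex
  assumes "0 < R" "- R \<le> Re z" "Re z \<le> R" "\<bar>Im z\<bar> \<le> R" "\<bar>Im z\<bar> = R \<or> Re z = - R"
  shows "R \<le> norm z" "R / 3 \<le> norm z - Re z"
proof -
  show *: "R \<le> norm z" using assms(5) abs_Im_le_cmod[of z] abs_Re_le_cmod[of z] assms(1) by auto
  show "R / 3 \<le> norm z - Re z"
  proof (cases "Re z = - R")
    case True
    then show ?thesis using * assms(1) by simp
  next
    case False
    then have im: "\<bar>Im z\<bar> = R" using assms(5) by blast
    have n2: "(norm z)\<^sup>2 = (Re z)\<^sup>2 + R\<^sup>2" unfolding cmod_power2 using im by (metis power2_abs)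
    have "(Re z)\<^sup>2 \<le> R\<^sup>2" using assms(1-3) by (intro abs_le_square_iff[THEN iffD1]) auto
    then have "(norm z)\<^sup>2 \<le> (3 / 2 * R)\<^sup>2" 
    proof -
      have "(3 / 2 * R)\<^sup>2 = 9 / 4 * R\<^sup>2" by (simp add: power2_eq_square)
      then show ?thesis using n2 zero_le_power2[of R] \<open>(Re z)\<^sup>2 \<le> R\<^sup>2\<close> by linarith
    qed
    then have "norm z \<le> 3 / 2 * R" by (rule power2_le_imp_le) (use assms(1) in simp)
    then have le: "norm z + Re z \<le> 5 / 2 * R" using assms(3) by linarith
    have pr: "(norm z - Re z) * (norm z + Re z) = R\<^sup>2" using n2 by (simp add: power2_eq_square algebra_simps)
    have nn: "0 \<le> norm z - Re z" using complex_Re_le_cmod[of z] by simp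
    have "R\<^sup>2 \<le> (norm z - Re z) * (5 / 2 * R)" using mult_left_mono[OF le nn] pr by simp
    then have "R \<le> (norm z - Re z) * (5 / 2)" using assms(1) by (simp add: power2_eq_square)
    moreover define a where "a = norm z - Re z"
    ultimately have "R \<le> a * (5 / 2)" by simp
    then have "R / 3 \<le> a" using assms(1) by linarith
    then show ?thesis by (simp add: a_def)
  qed
qed

text \<open>On the critical line \<open>norm \<mu>\<close> is at least \<open>N\<close>, so the
  second condition on \<open>N\<close> is the size condition of the a priori estimate there.\<close>

locale hill_estimate =
  fixes p q :: real and v :: "real \<Rightarrow> complex" and N :: nat
  assumes p: "1 < p" and pq: "1 / p + 1 / q = 1" and v: "v \<in> Lp_fun p"
    and N: "1 \<le> N" "10 * L1_norm v \<le> real N"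
begin

definition X :: real where "X = (real N)\<^sup>2 + real N"

text \<open>A height for \<open>Im \<mu>\<close> above which both the size condition and
  \<open>good_high\<close> apply; the summand 1 ensures the latter for small potentials.\<close>

definition b0 :: real where "b0 = 10 * L1_norm v + 1"

lemma X: "(real N)\<^sup>2 \<le> X" "0 < X"
  using N by (auto simp: X_def intro: add_nonneg_pos)

lemma b0: "1 \<le> b0"
  using L1_norm_nonneg[of v] by (simp add: b0_def)

lemma v1: "v \<in> Lp_fun 1"
  using Lp_fun_mono[OF v, of 1] p by simp

lemma beta: "0 < 1 / q" "1 / q < 1"
proof -
  have "0 < 1 / p" "1 / p < 1" using p by auto
  then show "0 < 1 / q" "1 / q < 1" using pq by linarith+
qed

lemma on_line:
  assumes "Re (\<mu>\<^sup>2) = X" "0 \<le> Im \<mu>"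
  shows "good \<mu>" "10 * L1_norm v \<le> norm \<mu>"
proof -
  show "good \<mu>" using good_line[of \<mu> N] assms N by (simp add: X_def)
  have "(real N)\<^sup>2 \<le> (norm \<mu>)\<^sup>2"
    using X(1) complex_Re_le_cmod[of "\<mu>\<^sup>2"] assms(1) unfolding norm_power by linarith
  then have "real N \<le> norm \<mu>" by (rule power2_le_imp_le) simp
  then show "10 * L1_norm v \<le> norm \<mu>" using N by linarith
qed

lemma far_away:
  assumes "b0 \<le> Im \<mu>"
  shows "good \<mu>" "10 * L1_norm v \<le> norm \<mu>"
proof -
  show "good \<mu>" using assms b0 by (intro good_high) auto
  show "10 * L1_norm v \<le> norm \<mu>" using assms abs_Im_le_cmod[of \<mu>] by (simp add: b0_def)
qed

lemma resolvent_set: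
  assumes "good \<mu>" "10 * L1_norm v \<le> norm \<mu>"
  shows "\<not> is_eigenvalue (hill_op bc v) (\<mu>\<^sup>2)" "\<not> is_eigenvalue (hill_op bc (\<lambda>_. 0)) (\<mu>\<^sup>2)"
  using not_eigenvalue[OF v1 assms] not_eigenvalue[OF Lp_fun_zero assms(1)] by auto

text \<open>An eigenvalue left of the line has a square root with \<open>Im \<mu> < b0\<close>, and
  its modulus is its real part plus \<open>2 * (Im \<mu>)\<^sup>2\<close>. Hence all such
  eigenvalues lie in a disc of radius \<open>\<omega>\<close>, and one number serves for width and
  height.\<close>

lemma admissible_exists: "\<exists>\<omega> h. admissible bc v N \<omega> h"
proof -
  define \<omega> where "\<omega> = X + 2 * b0\<^sup>2 + 1"
  have "0 < \<omega>" using X by (simp add: \<omega>_def add_pos_nonneg)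
  moreover have "z \<in> interior (Pi_rect \<omega> \<omega> N)"
    if e: "is_eigenvalue (hill_op bc v) z \<or> is_eigenvalue (hill_op bc (\<lambda>_. 0)) z" and re: "Re z \<le> X" for z
  proof -
    obtain \<mu> where \<mu>: "\<mu>\<^sup>2 = z" "0 \<le> Im \<mu>" by (rule sqrt_upper_half_plane)
    have "Re z \<noteq> X" using e resolvent_set[OF on_line] \<mu> by blast
    then have lt: "Re z < X" using re by simp
    have "Im \<mu> < b0" using e resolvent_set[OF far_away] \<mu>(1) by (meson not_le)
    then have "(Im \<mu>)\<^sup>2 \<le> b0\<^sup>2" using \<mu>(2) by (intro power_mono) auto
    then have "norm z < \<omega>" using lt Re_square[of \<mu>] norm_square[of \<mu>] \<mu>(1) by (simp add: \<omega>_def)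
    then show ?thesis
      unfolding interior_Pi_rect using lt abs_Re_le_cmod[of z] abs_Im_le_cmod[of z] by (auto simp: X_def)
  qed
  ultimately show ?thesis unfolding admissible_def X_def by blast
qed

text \<open>The factor 4 collects the two halves of the line and a factor 2 from
  \<open>2 powr \<beta>\<close>; \<open>2 * q\<close> is \<open>2 / \<beta>\<close>; 36 comes from
  three outer sides with 12 each. The remaining factor is the constant of
  \<open>sol_op_difference_bound\<close>.\<close>

definition C0 :: real where
  "C0 = (4 * (1 / (1 - 1 / q) + 2 * q) + 36) * (50 * Lp_const p v * pi)"

lemma C0_pos: "0 < C0"
  unfolding C0_def using beta Lp_const_pos[of p v] by (intro mult_pos_pos add_nonneg_pos) (auto simp: field_simps)

lemma estimate:
  assumes adm: "admissible bc v N \<omega> h"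
  shows "\<exists>T. extends_to_L1_C T (spectral_proj (hill_op bc v) \<omega> h N - spectral_proj (hill_op bc (\<lambda>_. 0)) \<omega> h N) \<and>
    norm T \<le> C0 * real N powr (- 1 / q)"
proof -
  define \<beta> where "\<beta> = 1 / q"
  have \<beta>: "0 < \<beta>" "\<beta> < 1" using beta by (simp_all add: \<beta>_def)
  define \<rho> where "\<rho> = {z. \<not> is_eigenvalue (hill_op bc v) z} \<inter> {z. \<not> is_eigenvalue (hill_op bc (\<lambda>_. 0)) z}"
  define \<gamma> where "\<gamma> = rectpath (Complex (- \<omega>) (- h)) (Complex X h)"
  have \<gamma>_path: "Pi_path \<omega> h N = \<gamma>" by (simp add: Pi_path_def \<gamma>_def X_def)
  have pos: "0 < \<omega>" "0 < h" using adm by (auto simp: admissible_def)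
  \<comment> \<open>By admissibility the closed half-plane minus the open rectangle is free of
    eigenvalues of both operators.\<close>
  have out: "z \<in> \<rho>" if "Re z \<le> X" "\<not> (- \<omega> < Re z \<and> Re z < X \<and> \<bar>Im z\<bar> < h)" for z
  proof (rule ccontr)
    assume "z \<notin> \<rho>"
    then have "z \<in> interior (Pi_rect \<omega> h N)" using adm that(1) unfolding \<rho>_def admissible_def X_def by blast
    then show False using that(2) unfolding interior_Pi_rect X_def by blast
  qed
  have \<gamma>_\<rho>: "z \<in> \<rho>" if "z \<in> path_image \<gamma>" for z
  proof (rule out)
    have "z \<in> cbox (Complex (- \<omega>) (- h)) (Complex X h) - box (Complex (- \<omega>) (- h)) (Complex X h)"
      using that pos X unfolding \<gamma>_def by (subst (asm) path_image_rectpath_cbox_minus_box) auto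
    then show "Re z \<le> X" "\<not> (- \<omega> < Re z \<and> Re z < X \<and> \<bar>Im z\<bar> < h)"
      by (auto simp: in_cbox_complex_iff in_box_complex_iff)
  qed
  have nev: "\<And>z. z \<in> path_image \<gamma> \<Longrightarrow> \<not> is_eigenvalue (hill_op bc v) z"
    and ne0: "\<And>z. z \<in> path_image \<gamma> \<Longrightarrow> \<not> is_eigenvalue (hill_op bc (\<lambda>_. 0)) z"
    using \<gamma>_\<rho> by (auto simp: \<rho>_def)
  define k where "k = 1 / (2 * of_real pi * \<i>)"
  define T where "T = mulC k o\<^sub>L (sol_integral \<gamma> bc v - sol_integral \<gamma> bc (\<lambda>_. 0))"
  have ocv: "op_contour_integral \<gamma> (resolvent (hill_op bc v)) = embed_op (sol_integral \<gamma> bc v)"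
    unfolding \<gamma>_def by (rule op_contour_integral_resolvent[OF v1 nev[unfolded \<gamma>_def]])
  have oc0: "op_contour_integral \<gamma> (resolvent (hill_op bc (\<lambda>_. 0))) = embed_op (sol_integral \<gamma> bc (\<lambda>_. 0))"
    unfolding \<gamma>_def by (rule op_contour_integral_resolvent[OF Lp_fun_zero ne0[unfolded \<gamma>_def]])
  have "embed_op T = spectral_proj (hill_op bc v) \<omega> h N - spectral_proj (hill_op bc (\<lambda>_. 0)) \<omega> h N"
    unfolding spectral_proj_def \<gamma>_path ocv oc0 T_def embed_op_mulC k_def[symmetric]
    by (simp add: bounded_linear.linear[OF bounded_linear_embed_op, THEN linear_diff] bounded_bilinear.diff_right[OF bounded_bilinear_blinfun_compose])
  then have ext: "extends_to_L1_C T (spectral_proj (hill_op bc v) \<omega> h N - spectral_proj (hill_op bc (\<lambda>_. 0)) \<omega> h N)"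
    unfolding extends_to_L1_C_def by (metis embed_op_apply)
  have "norm T \<le> C0 * real N powr (- \<beta>)"
  proof (rule norm_blinfun_bound)
    show "0 \<le> C0 * real N powr (- \<beta>)" using C0_pos by simp
    fix \<phi> :: L1
    show "norm (blinfun_apply T \<phi>) \<le> C0 * real N powr (- \<beta>) * norm \<phi>"
    proof (rule norm_Cspace_le)
      fix x assume x: "x \<in> {0..pi}"
      \<comment> \<open>Fixing \<open>\<phi>\<close> and \<open>x\<close> makes the integrand
        scalar; the bounds below are uniform in \<open>x\<close>, so the norm of \<open>T\<close>
        follows.\<close>
      define f where "f z = Cfun (blinfun_apply (sol_op bc v z) \<phi>) x - Cfun (blinfun_apply (sol_op bc (\<lambda>_. 0) z) \<phi>) x" for z
      define M0 where "M0 = 50 * Lp_const p v * (pi * norm \<phi>)"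
      have M0: "0 \<le> M0" using Lp_const_pos[of p v] by (simp add: M0_def)
      have hol: "f holomorphic_on \<rho>"
        unfolding f_def \<rho>_def
        by (intro holomorphic_on_diff holomorphic_on_subset[OF sol_op_holomorphic[OF v1 x]] holomorphic_on_subset[OF sol_op_holomorphic[OF Lp_fun_zero x]]) auto
      have cont: "continuous_on \<rho> f" using hol by (rule holomorphic_on_imp_continuous_on)
      have fb: "norm (f (\<mu>\<^sup>2)) \<le> M0 * (Im \<mu> powr (- \<beta>) / norm (\<mu>\<^sup>2))"
        if "good \<mu>" "0 < Im \<mu>" "10 * L1_norm v \<le> norm \<mu>" for \<mu>
        using sol_op_difference_bound[OF p pq v that x, of bc \<phi>] by (simp add: f_def M0_def \<beta>_def)
      have "(f has_contour_integral (Cfun (blinfun_apply (sol_integral \<gamma> bc v) \<phi>) x - Cfun (blinfun_apply (sol_integral \<gamma> bc (\<lambda>_. 0)) \<phi>) x)) \<gamma>"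
        unfolding f_def \<gamma>_def
        by (intro has_contour_integral_diff sol_integral_eval v1 Lp_fun_zero nev[unfolded \<gamma>_def] ne0[unfolded \<gamma>_def])
      then have ci: "contour_integral \<gamma> f = Cfun (blinfun_apply (sol_integral \<gamma> bc v - sol_integral \<gamma> bc (\<lambda>_. 0)) \<phi>) x"
        by (simp add: contour_integral_unique blinfun.diff_left)
      have Teq: "Cfun (blinfun_apply T \<phi>) x = k * contour_integral \<gamma> f"
        unfolding T_def ci by (simp add: Cfun_mulC)
      \<comment> \<open>No limit is taken. The entry \<open>6 * b0\<^sup>2\<close> puts the outer
        sides into the region of \<open>far_away\<close>, and \<open>X \<le> R\<close> makes their
        contribution, of order \<open>R powr (- \<beta> / 2)\<close>, no larger than that of the
        line.\<close>
      define R where "R = max (max \<omega> h) (max X (6 * b0\<^sup>2))"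
      have R: "\<omega> \<le> R" "h \<le> R" "X \<le> R" "6 * b0\<^sup>2 \<le> R" "0 < R" using X(2) by (auto simp: R_def)
      have deform: "contour_integral \<gamma> f = hor f (- R) X (- R) + vert f X (- R) R - hor f (- R) X R - vert f (- R) (- R) R"
        unfolding \<gamma>_def by (rule rectangle_deformation[OF hol pos(1) R(1) pos(2) R(2) X(2) out])
      have side: "norm (f z) \<le> 6 * M0 * R powr (- \<beta> / 2) / R"
        if z: "- R \<le> Re z" "Re z \<le> X" "\<bar>Im z\<bar> \<le> R" "\<bar>Im z\<bar> = R \<or> Re z = - R" for z
      proof -
        obtain \<mu> where \<mu>: "\<mu>\<^sup>2 = z" "0 \<le> Im \<mu>" by (rule sqrt_upper_half_plane)
        have far: "R \<le> norm z" "R / 3 \<le> norm z - Re z" using far_side[OF R(5) z(1) _ z(3,4)] z(2) R(3) by auto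
        have s: "sqrt (R / 6) \<le> Im \<mu>"
          by (rule Im_sqrt_lower[OF \<mu>(2)]) (use far R \<mu>(1) in auto)
        have "b0 \<le> sqrt (R / 6)" using R(4) b0 by (intro real_le_rsqrt) simp
        then have \<mu>b: "b0 \<le> Im \<mu>" using s by linarith
        have "Im \<mu> powr (- \<beta>) \<le> sqrt (R / 6) powr (- \<beta>)" using s R(5) \<beta> by (intro powr_neg_mono) auto
        also have "\<dots> = (R / 6) powr (- \<beta> / 2)" using R(5) by (simp add: powr_half_sqrt[symmetric] powr_powr)
        also have "\<dots> = 6 powr (\<beta> / 2) * R powr (- \<beta> / 2)" using R(5) by (simp add: powr_divide powr_minus field_simps)
        also have "\<dots> \<le> 6 powr 1 * R powr (- \<beta> / 2)" using \<beta> by (intro mult_right_mono powr_mono) auto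
        finally have p6: "Im \<mu> powr (- \<beta>) \<le> 6 * R powr (- \<beta> / 2)" by simp
        have "norm (f z) \<le> M0 * (Im \<mu> powr (- \<beta>) / norm z)"
          using fb[OF far_away(1)[OF \<mu>b] _ far_away(2)[OF \<mu>b]] \<mu>b b0 \<mu>(1) by simp
        also have "\<dots> \<le> M0 * (6 * R powr (- \<beta> / 2) / R)"
          using p6 far(1) R(5) M0 by (intro mult_left_mono frac_le) auto
        finally show ?thesis by (simp add: mult_ac)
      qed
      have line: "norm (f (Complex X t)) \<le> 2 * M0 * (max X \<bar>t\<bar> powr (\<beta> / 2 - 1) * \<bar>t\<bar> powr (- \<beta>))" if t: "t \<noteq> 0" for t
      proof -
        define z where "z = Complex X t"
        have z: "Re z = X" "Im z = t" by (simp_all add: z_def)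
        obtain \<mu> where \<mu>: "\<mu>\<^sup>2 = z" "0 \<le> Im \<mu>" by (rule sqrt_upper_half_plane)
        have nz: "0 < norm z" "X \<le> norm z" "\<bar>t\<bar> \<le> norm z"
          using complex_Re_le_cmod[of z] abs_Im_le_cmod[of z] z X(2) by auto
        \<comment> \<open>From \<open>(norm z - X) * (norm z + X) = t\<^sup>2\<close> and
          \<open>X \<le> norm z\<close> one gets \<open>(Im \<mu>)\<^sup>2 = (norm z - X) / 2 \<ge>
          t\<^sup>2 / (4 * norm z)\<close>, which is \<open>r\<^sup>2\<close>.\<close>
        define r where "r = \<bar>t\<bar> / (2 * sqrt (norm z))"
        have r: "0 < r" using t nz by (simp add: r_def)
        have "r \<le> Im \<mu>"
        proof (rule Im_sqrt_lower[OF \<mu>(2)])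
          have "(norm z - X) * (norm z + X) = t\<^sup>2"
            using cmod_power2[of z] z by (simp add: power2_eq_square algebra_simps)
          moreover have "(norm z - X) * (norm z + X) \<le> (norm z - X) * (2 * norm z)"
            using nz by (intro mult_left_mono) auto
          ultimately have "t\<^sup>2 / (2 * norm z) \<le> norm z - X" using nz(1) by (simp add: field_simps)
          moreover have "2 * r\<^sup>2 = t\<^sup>2 / (2 * norm z)" using nz(1) by (simp add: r_def power_divide power_mult_distrib)
          ultimately show "2 * r\<^sup>2 \<le> norm (\<mu>\<^sup>2) - Re (\<mu>\<^sup>2)" by (simp add: \<mu>(1) z)
        qed (use r in auto)
        have i: "Re (\<mu>\<^sup>2) = X" using \<mu>(1) z by simp
        have "Im \<mu> powr (- \<beta>) \<le> r powr (- \<beta>)" using \<open>r \<le> Im \<mu>\<close> r \<beta> by (intro powr_neg_mono) auto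
        also have "\<dots> = \<bar>t\<bar> powr (- \<beta>) * (2 powr \<beta> * norm z powr (\<beta> / 2))"
        proof -
          have "sqrt (norm z) powr \<beta> = norm z powr (\<beta> / 2)"
            using nz(1) by (simp add: powr_half_sqrt[symmetric] powr_powr)
          then show ?thesis
            unfolding r_def using nz(1) t by (simp add: powr_divide powr_mult powr_minus field_simps)
        qed
        also have "\<dots> \<le> \<bar>t\<bar> powr (- \<beta>) * (2 powr 1 * norm z powr (\<beta> / 2))"
          using \<beta> by (intro mult_left_mono mult_right_mono powr_mono) auto
        finally have a: "Im \<mu> powr (- \<beta>) / norm z \<le> 2 * \<bar>t\<bar> powr (- \<beta>) * (norm z powr (\<beta> / 2) / norm z)"
          using nz(1) by (simp add: field_simps)
        have "norm z powr (\<beta> / 2) / norm z = norm z powr (\<beta> / 2 - 1)" using nz(1) by (simp add: powr_diff)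
        also have "\<dots> \<le> max X \<bar>t\<bar> powr (\<beta> / 2 - 1)"
          using nz X(2) \<beta> by (intro powr_mono2') auto
        finally have b: "norm z powr (\<beta> / 2) / norm z \<le> max X \<bar>t\<bar> powr (\<beta> / 2 - 1)" .
        have "norm (f z) \<le> M0 * (Im \<mu> powr (- \<beta>) / norm z)"
          using fb[OF on_line(1)[OF i \<mu>(2)] _ on_line(2)[OF i \<mu>(2)]] r \<open>r \<le> Im \<mu>\<close> \<mu>(1) by simp
        also have "\<dots> \<le> M0 * (2 * \<bar>t\<bar> powr (- \<beta>) * (norm z powr (\<beta> / 2) / norm z))"
          using a M0 by (rule mult_left_mono)
        also have "\<dots> \<le> M0 * (2 * \<bar>t\<bar> powr (- \<beta>) * max X \<bar>t\<bar> powr (\<beta> / 2 - 1))"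
          using b M0 by (intro mult_left_mono) auto
        finally show ?thesis by (simp add: z_def mult_ac)
      qed
      have in\<rho>: "z \<in> \<rho>" if "Re z \<le> X" "Re z = X \<or> R \<le> \<bar>Im z\<bar> \<or> Re z \<le> - R" for z
        using that R by (intro out) auto
      have cH: "continuous_on (closed_segment (Complex (- R) y) (Complex X y)) f" if "\<bar>y\<bar> = R" for y
        using that R X(2) by (intro continuous_on_subset[OF cont] subsetI in\<rho>) (auto dest!: in_segment_Complex_Re)
      have cV: "continuous_on (closed_segment (Complex y (- R)) (Complex y R)) f" if "y = X \<or> y = - R" for y
        using that R X(2) by (intro continuous_on_subset[OF cont] subsetI in\<rho>) (auto dest!: in_segment_Complex_Im)
      define B where "B = 6 * M0 * R powr (- \<beta> / 2) / R"
      have B0: "0 \<le> B" using M0 R by (simp add: B_def)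
      have bH: "norm (hor f (- R) X y) \<le> B * (2 * R)" if "\<bar>y\<bar> = R" for y
      proof -
        have "norm (hor f (- R) X y) \<le> B * norm (Complex X y - Complex (- R) y)"
        proof (rule contour_integral_bound_linepath[OF contour_integrable_continuous_linepath[OF cH[OF that]] B0])
          fix z assume "z \<in> closed_segment (Complex (- R) y) (Complex X y)"
          then have "Im z = y \<and> - R \<le> Re z \<and> Re z \<le> X" by (rule in_segment_Complex_Re) (use R X(2) in auto)
          then show "norm (f z) \<le> B" unfolding B_def using that by (intro side) auto
        qed
        also have "Complex X y - Complex (- R) y = of_real (X + R)" by (simp add: complex_eq_iff)
        also have "B * norm (complex_of_real (X + R)) \<le> B * (2 * R)" using R X(2) B0 unfolding norm_of_real by (intro mult_left_mono) auto
        finally show ?thesis .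
      qed
      have bV: "norm (vert f (- R) (- R) R) \<le> B * (2 * R)"
      proof -
        have "norm (vert f (- R) (- R) R) \<le> B * norm (Complex (- R) R - Complex (- R) (- R))"
        proof (rule contour_integral_bound_linepath[OF contour_integrable_continuous_linepath[OF cV] B0])
          fix z assume "z \<in> closed_segment (Complex (- R) (- R)) (Complex (- R) R)"
          then have "Re z = - R \<and> - R \<le> Im z \<and> Im z \<le> R" by (rule in_segment_Complex_Im) (use R in auto)
          then show "norm (f z) \<le> B" unfolding B_def using R X(2) by (intro side) auto
        qed simp
        also have "Complex (- R) R - Complex (- R) (- R) = \<i> * of_real (2 * R)" by (simp add: complex_eq_iff)
        finally show ?thesis using R by (simp add: norm_mult)
      qed
      have bX: "norm (vert f X (- R) R) \<le> 2 * (2 * M0 * (1 / (1 - \<beta>) + 2 / \<beta>) * X powr (- \<beta> / 2))"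
        by (rule vertical_line_bound[OF \<beta> X(2) R(3) _ cV line]) (use M0 in auto)
      have Rpow: "R powr (- \<beta> / 2) \<le> X powr (- \<beta> / 2)" using powr_neg_mono[OF X(2) R(3), of "\<beta> / 2"] \<beta> by simp
      have "norm (contour_integral \<gamma> f) \<le> norm (hor f (- R) X (- R)) + norm (vert f X (- R) R) + norm (hor f (- R) X R) + norm (vert f (- R) (- R) R)"
        unfolding deform by (intro order_trans[OF norm_triangle_ineq4] add_mono norm_triangle_ineq order_refl)
      also have "\<dots> \<le> B * (2 * R) + 2 * (2 * M0 * (1 / (1 - \<beta>) + 2 / \<beta>) * X powr (- \<beta> / 2)) + B * (2 * R) + B * (2 * R)"
        using R by (intro add_mono bH bV bX) auto
      also have "\<dots> = 36 * M0 * R powr (- \<beta> / 2) + 4 * M0 * (1 / (1 - \<beta>) + 2 / \<beta>) * X powr (- \<beta> / 2)"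
        using R by (simp add: B_def)
      also have "\<dots> \<le> 36 * M0 * X powr (- \<beta> / 2) + 4 * M0 * (1 / (1 - \<beta>) + 2 / \<beta>) * X powr (- \<beta> / 2)"
        using Rpow M0 by (intro add_right_mono mult_left_mono) auto
      also have "\<dots> = (4 * (1 / (1 - \<beta>) + 2 / \<beta>) + 36) * M0 * X powr (- \<beta> / 2)" by (simp add: algebra_simps)
      also have "\<dots> \<le> (4 * (1 / (1 - \<beta>) + 2 / \<beta>) + 36) * M0 * real N powr (- \<beta>)"
      proof (rule mult_left_mono)
        have "X powr (- \<beta> / 2) \<le> ((real N)\<^sup>2) powr (- \<beta> / 2)"
          using powr_neg_mono[OF _ X(1), of "\<beta> / 2"] \<beta> N by simp
        also have "\<dots> = (real N powr 2) powr (- \<beta> / 2)" using N by simp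
        also have "\<dots> = real N powr (- \<beta>)" unfolding powr_powr by simp
        finally show "X powr (- \<beta> / 2) \<le> real N powr (- \<beta>)" .
        show "0 \<le> (4 * (1 / (1 - \<beta>) + 2 / \<beta>) + 36) * M0" using \<beta> M0 by simp
      qed
      also have "\<dots> = C0 * real N powr (- \<beta>) * norm \<phi>" by (simp add: C0_def M0_def \<beta>_def)
      finally have main: "norm (contour_integral \<gamma> f) \<le> C0 * real N powr (- \<beta>) * norm \<phi>" .
      have "norm k \<le> 1" using pi_gt3 by (simp add: k_def norm_divide norm_mult)
      then have "norm (k * contour_integral \<gamma> f) \<le> 1 * norm (contour_integral \<gamma> f)"
        unfolding norm_mult by (intro mult_right_mono) auto
      then show "norm (Cfun (blinfun_apply T \<phi>) x) \<le> C0 * real N powr (- \<beta>) * norm \<phi>"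
        unfolding Teq using main by simp
    qed
  qed
  then show ?thesis using ext by (auto simp: \<beta>_def)
qed

end

text \<open>The crude bound \<open>norm (v x) \<le> 1 + norm (v x) powr p\<close> suffices to make
  the threshold a function of the L^p norm alone.\<close>

lemma L1_norm_le_Lp_norm:
  assumes p: "1 \<le> p" and v: "v \<in> Lp_fun p"
  shows "L1_norm v \<le> pi + pi * Lp_norm p v powr p"
proof -
  have v1: "v \<in> Lp_fun 1" using Lp_fun_mono[OF v, of 1] p by simp
  let ?M = "lebesgue_on {0..pi}"
  have i1: "integrable ?M (\<lambda>x. norm (v x))" using Lp_fun_int[OF v1] by simp
  have "L1_norm v = (\<integral>x. norm (v x) \<partial>?M)" using i1 by (subst lebesgue_integral_eq_integral) auto
  also have "\<dots> \<le> (\<integral>x. 1 + norm (v x) powr p \<partial>?M)"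
  proof (rule integral_mono[OF i1])
    show "integrable ?M (\<lambda>x. 1 + norm (v x) powr p)"
      using Lp_fun_int[OF v] by (auto simp: emeasure_restrict_space)
    show "norm (v x) \<le> 1 + norm (v x) powr p" for x
    proof (cases "norm (v x) \<le> 1")
      case True
      then show ?thesis using powr_ge_zero[of "norm (v x)" p] by linarith
    next
      case False
      then have "norm (v x) powr 1 \<le> norm (v x) powr p" using p by (intro powr_mono) auto
      then show ?thesis using False by simp
    qed
  qed
  also have "\<dots> = pi + (\<integral>x. norm (v x) powr p \<partial>?M)"
    using Lp_fun_int[OF v] by (simp add: emeasure_restrict_space measure_restrict_space)
  also have "(\<integral>x. norm (v x) powr p \<partial>?M) = pi * Lp_norm p v powr p"
    using Lp_norm_powr[OF p, of v] by simp
  finally show ?thesis .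
qed

theorem theorem4:
  fixes p q :: real and bc :: bc
  assumes "1 < p" and "p \<le> 2" and "1 / p + 1 / q = 1"
  shows "\<exists>Nstar :: real \<Rightarrow> nat. \<forall>v \<in> Lp_fun p. \<exists>C>0. \<forall>N \<ge> Nstar (Lp_norm p v).
           (\<exists>\<omega> h. admissible bc v N \<omega> h) \<and>
           (\<forall>\<omega> h. admissible bc v N \<omega> h \<longrightarrow>
              (\<exists>T. extends_to_L1_C T
                      (spectral_proj (hill_op bc v) \<omega> h N - spectral_proj (hill_op bc (\<lambda>_. 0)) \<omega> h N) \<and>
                   norm T \<le> C * real N powr (- 1 / q)))"
proof (rule exI[of _ "\<lambda>n. nat \<lceil>10 * (pi + pi * n powr p)\<rceil> + 1"], rule ballI)
  \<comment> \<open>The ceiling dominates \<open>10 * L1_norm v\<close> by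
    \<open>L1_norm_le_Lp_norm\<close>, and the summand 1 gives \<open>1 \<le> N\<close>.\<close>
  let ?Ns = "\<lambda>n. nat \<lceil>10 * (pi + pi * n powr p)\<rceil> + 1"
  fix v assume v: "v \<in> Lp_fun p"
  define C where "C = (4 * (1 / (1 - 1 / q) + 2 * q) + 36) * (50 * Lp_const p v * pi)"
  have he: "hill_estimate p q v N" if "?Ns (Lp_norm p v) \<le> N" for N
  proof
    have "10 * (pi + pi * Lp_norm p v powr p) \<le> real (nat \<lceil>10 * (pi + pi * Lp_norm p v powr p)\<rceil>)"
      by (rule real_nat_ceiling_ge)
    also have "\<dots> \<le> real N" using that by simp
    finally show "10 * L1_norm v \<le> real N" using L1_norm_le_Lp_norm[OF _ v] assms(1) by force
    show "1 \<le> N" using that by simp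
  qed (use assms v in auto)
  \<comment> \<open>\<open>C0\<close> does not involve \<open>N\<close>; its definition is unfolded
    at the threshold itself and the same value then serves for all larger \<open>N\<close>.\<close>
  have C: "C = hill_estimate.C0 p q v" unfolding C_def hill_estimate.C0_def[OF he[OF order_refl]] ..
  show "\<exists>C>0. \<forall>N \<ge> ?Ns (Lp_norm p v).
           (\<exists>\<omega> h. admissible bc v N \<omega> h) \<and>
           (\<forall>\<omega> h. admissible bc v N \<omega> h \<longrightarrow>
              (\<exists>T. extends_to_L1_C T
                      (spectral_proj (hill_op bc v) \<omega> h N - spectral_proj (hill_op bc (\<lambda>_. 0)) \<omega> h N) \<and>
                   norm T \<le> C * real N powr (- 1 / q)))"
  proof (rule exI[of _ C], intro conjI allI impI)
    show "0 < C" unfolding C by (rule hill_estimate.C0_pos[OF he[OF order_refl]])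
    fix N assume "?Ns (Lp_norm p v) \<le> N"
    note h = he[OF this]
    show "\<exists>\<omega> h. admissible bc v N \<omega> h" by (rule hill_estimate.admissible_exists[OF h])
    show "\<exists>T. extends_to_L1_C T
                      (spectral_proj (hill_op bc v) \<omega> h N - spectral_proj (hill_op bc (\<lambda>_. 0)) \<omega> h N) \<and>
                   norm T \<le> C * real N powr (- 1 / q)" if "admissible bc v N \<omega> h" for \<omega> h
      unfolding C by (rule hill_estimate.estimate[OF \<open>hill_estimate p q v N\<close> that])
  qed
qed

end
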